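(* Let $n\ge 2$, $m\ge 2$, let $U\subset\mathbb{R}^m$ be open and connected, and let $H_0,H_1,\dots,H_m$ be $n\times n$ Hermitian matrices. Set $H(u)=H_0+u_1H_1+\cdots+u_mH_m$ for $u=(u_1,\dots,u_m)\in U$. Assume that the spectrum of $H(\cdot)$ is conically connected on $U$. Then the Lie algebra generated by $\{iH(u)\mid u\in U\}$ equals $\mathfrak{su}(n)$ if $\operatorname{tr}H(u)=0$ for every $u\in U$, and equals $\mathfrak{u}(n)$ otherwise. Consequently, the system $i\dot g(t)=H(u(t))g(t)$, with controls $u\in L^\infty([0,T],U)$, is exactly controllable in $\mathrm{U}(n)$ in the second case, and is well-posed and exactly controllable in $\mathrm{SU}(n)$ in the first case. In particular, the system $i\dot\psi(t)=H(u(t))\psi(t)$ on the unit sphere $S^{2n-1}\subset\mathbb{C}^n$ is exactly controllable.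
   Context: For $u\in U$ let $\lambda_1(u)\le\cdots\le\lambda_n(u)$ be the eigenvalues of $H(u)$, counted with multiplicity. A point $\bar u\in U$ is a conical intersection between $\lambda_j$ and $\lambda_{j+1}$ if $\lambda_j(\bar u)=\lambda_{j+1}(\bar u)$ is an eigenvalue of multiplicity exactly two and there is a constant $c>0$ such that for every unit vector $v\in\mathbb{R}^m$ and all sufficiently small $t>0$, $\lambda_{j+1}(\bar u+tv)-\lambda_j(\bar u+tv)>ct$. The spectrum of $H(\cdot)$ is conically connected if every eigenvalue intersection (every $u\in U$ with $\lambda_j(u)=\lambda_{j+1}(u)$ for some $j$) is conical, and for every $j=1,\dots,n-1$ there is a conical intersection $\bar u_j\in U$ between $\lambda_j$ and $\lambda_{j+1}$ such that $\lambda_l(\bar u_j)$ is a simple eigenvalue for all $l\ne j,j+1$. A control system $\dot q=f(q,u)$ on a connected manifold $M$ with controls in $U$ is exactly controllable if for every $q_0\in M$ the reachable set from $q_0$ (the set of endpoints $q(T)$, $T\ge0$, of solutions with $q(0)=q_0$ and $L^\infty$ controls $u:[0,T]\to U$) equals $M$. *)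

theory Defs
  imports "HOL-Analysis.Analysis" "HOL-Computational_Algebra.Polynomial" "HOL-Library.Multiset"
begin

definition cmat_scale :: "complex \<Rightarrow> complex^'n::finite^'n::finite \<Rightarrow> complex^'n::finite^'n::finite" where
  "cmat_scale c A = (\<chi> i j. c * A$i$j)"

definition mat_adj :: "complex^'n::finite^'n::finite \<Rightarrow> complex^'n::finite^'n::finite" where
  "mat_adj A = (\<chi> i j. cnj (A$j$i))"

definition hermitian :: "complex^'n::finite^'n::finite \<Rightarrow> bool" where
  "hermitian A \<longleftrightarrow> mat_adj A = A"

definition skew_hermitian :: "complex^'n::finite^'n::finite \<Rightarrow> bool" where
  "skew_hermitian A \<longleftrightarrow> mat_adj A = - A"

definition u_alg :: "(complex^'n::finite^'n::finite) set" where
  "u_alg = {A. skew_hermitian A}"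

definition su_alg :: "(complex^'n::finite^'n::finite) set" where
  "su_alg = {A. skew_hermitian A \<and> trace A = 0}"

definition unitary_group :: "(complex^'n::finite^'n::finite) set" where
  "unitary_group = {g. mat_adj g ** g = mat 1}"

definition special_unitary_group :: "(complex^'n::finite^'n::finite) set" where
  "special_unitary_group = {g. mat_adj g ** g = mat 1 \<and> det g = 1}"

definition comm :: "complex^'n::finite^'n::finite \<Rightarrow> complex^'n::finite^'n::finite \<Rightarrow> complex^'n::finite^'n::finite" where
  "comm A B = A ** B - B ** A"

definition lie_generated :: "(complex^'n::finite^'n::finite) set \<Rightarrow> (complex^'n::finite^'n::finite) set" where
  "lie_generated S = \<Inter>{L. S \<subseteq> L \<and> subspace L \<and> (\<forall>A\<in>L. \<forall>B\<in>L. comm A B \<in> L)}"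

definition char_poly :: "complex^'n::finite^'n::finite \<Rightarrow> complex poly" where
  "char_poly A = det (\<chi> i j. (if i = j then [:0, 1:] else 0) - [:A$i$j:])"

text \<open>Real parts of the eigenvalues (= eigenvalues, for Hermitian A), counted with
  algebraic multiplicity and sorted increasingly; eig A j for j = 1..n.\<close>

definition eig :: "complex^'n::finite^'n::finite \<Rightarrow> nat \<Rightarrow> real" where
  "eig A j = sorted_list_of_multiset (image_mset Re (proots (char_poly A))) ! (j - 1)"

definition eig_mult :: "complex^'n::finite^'n::finite \<Rightarrow> real \<Rightarrow> nat" where
  "eig_mult A x = count (proots (char_poly A)) (complex_of_real x)"

definition conical_intersection ::
  "(real^'m \<Rightarrow> complex^'n::finite^'n::finite) \<Rightarrow> (real^'m) set \<Rightarrow> real^'m \<Rightarrow> nat \<Rightarrow> bool" where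
  "conical_intersection H U ub j \<longleftrightarrow>
     ub \<in> U \<and> 1 \<le> j \<and> j < CARD('n) \<and>
     eig (H ub) j = eig (H ub) (j + 1) \<and> eig_mult (H ub) (eig (H ub) j) = 2 \<and>
     (\<exists>c>0. \<forall>v. norm v = 1 \<longrightarrow>
        (\<exists>\<delta>>0. \<forall>t. 0 < t \<and> t < \<delta> \<longrightarrow>
           eig (H (ub + t *\<^sub>R v)) (j + 1) - eig (H (ub + t *\<^sub>R v)) j > c * t))"

definition conically_connected :: "(real^'m \<Rightarrow> complex^'n::finite^'n::finite) \<Rightarrow> (real^'m) set \<Rightarrow> bool" where
  "conically_connected H U \<longleftrightarrow>
     (\<forall>u\<in>U. \<forall>j. 1 \<le> j \<and> j < CARD('n) \<and> eig (H u) j = eig (H u) (j + 1)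
        \<longrightarrow> conical_intersection H U u j) \<and>
     (\<forall>j. 1 \<le> j \<and> j < CARD('n) \<longrightarrow>
        (\<exists>ub\<in>U. conical_intersection H U ub j \<and>
           (\<forall>l. 1 \<le> l \<and> l \<le> CARD('n) \<and> l \<noteq> j \<and> l \<noteq> j + 1
              \<longrightarrow> eig_mult (H ub) (eig (H ub) l) = 1)))"

definition admissible_control :: "(real^'m) set \<Rightarrow> real \<Rightarrow> (real \<Rightarrow> real^'m) \<Rightarrow> bool" where
  "admissible_control U T u \<longleftrightarrow>
     u \<in> borel_measurable (lebesgue_on {0..T}) \<and> bounded (u ` {0..T}) \<and> (\<forall>t\<in>{0..T}. u t \<in> U)"

text \<open>Carath\'eodory solution of q' = f(q,u) on [0,T] (integral form).\<close>

definition is_solution ::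
  "(real^'m \<Rightarrow> 'x::euclidean_space \<Rightarrow> 'x) \<Rightarrow> real \<Rightarrow> (real \<Rightarrow> real^'m) \<Rightarrow> (real \<Rightarrow> 'x) \<Rightarrow> bool" where
  "is_solution f T u q \<longleftrightarrow>
     (\<forall>t\<in>{0..T}. ((\<lambda>s. f (u s) (q s)) has_integral (q t - q 0)) {0..t})"

definition reachable_set ::
  "(real^'m \<Rightarrow> 'x::euclidean_space \<Rightarrow> 'x) \<Rightarrow> (real^'m) set \<Rightarrow> 'x \<Rightarrow> 'x set" where
  "reachable_set f U q0 =
     {q T | T u q. 0 \<le> T \<and> admissible_control U T u \<and> is_solution f T u q \<and> q 0 = q0}"

definition exactly_controllable ::
  "(real^'m \<Rightarrow> 'x::euclidean_space \<Rightarrow> 'x) \<Rightarrow> (real^'m) set \<Rightarrow> 'x set \<Rightarrow> bool" where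
  "exactly_controllable f U M \<longleftrightarrow> (\<forall>q0\<in>M. reachable_set f U q0 = M)"

end

theory Submission
  imports Defs "HOL-Computational_Algebra.Fundamental_Theorem_Algebra"
begin

text \<open>
  Let \<open>u'\<close> be a conical intersection of the two lowest eigenvalues and let \<open>M\<close> be the complexification
  of the generated Lie algebra, written in an eigenbasis of \<open>H u'\<close>. Projecting to the commutant
  of \<open>H u'\<close> keeps \<open>M\<close> invariant; as the intersection is conical and there are at least two controls,
  this produces the traceless matrices on the double eigenspace \<open>E\<close>. Since all other eigenvalues are
  simple and lie above \<open>E\<close>, every nonzero coupling of an eigenvector to \<open>E\<close> gives a matrix unit in \<open>M\<close>,
  so \<open>M\<close> contains the traceless matrices on some invariant subspace. The family is irreducible:
  if an orthogonal projection commutes with all \<open>H u\<close>, then conicity of all intersections forces each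
  eigenspace to lie in its range or in its kernel, the alternative is constant along the connected set
  \<open>U\<close>, and the intersections tie consecutive eigenvalues together.

  For controllability, the closure of the semigroup of propagators is a group whose tangent vectors form
  a Lie algebra, hence it is everything. A chart with values in the semigroup is built by composing
  trajectories whose velocities, transported by the (dense) semigroup, span the Lie algebra;
  thus the semigroup has interior points, and being dense it is the whole group.
\<close>

section \<open>Complex matrices\<close>

text \<open>The family may have resonances: different transitions of \<open>H u'\<close> can share a
  frequency, and averaging over the flow of \<open>H u'\<close> does not separate them. The remedy
  is the matrix h with eigenvalues 1 and -1 on E and 0 elsewhere, available once \<open>M\<close>
  contains the traceless matrices on E: after adding a generic multiple of h to \<open>H u'\<close>,
  only transitions of equal h-weight can coincide. A transition from a vector of E upwards then
  competes only with those from the same vector to other eigenvectors, excluded by simplicity, and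
  with those down into the other vector of E, excluded by sign. The sign argument is the reason for
  taking the lowest intersection.

  Time runs only forward, so inverses appear only in the closure, by recurrence in the compact
  group. For the same reason the chart is not centred at the identity, where every flow has an end
  point; flows are run for times near 1.

  Controls are merely measurable, so trajectories need not be differentiable everywhere. Norm and
  determinant are conserved because their increments are bounded by a multiple of (t - s)^2.\<close>

definition cip :: "complex^'n \<Rightarrow> complex^'n \<Rightarrow> complex" where
  "cip x y = (\<Sum>i\<in>UNIV. cnj (x$i) * y$i)"

definition diag_mat :: "('n \<Rightarrow> complex) \<Rightarrow> complex^'n^'n" where
  "diag_mat d = (\<chi> i j. if i = j then d i else 0)"

lemma cip_add_right: "cip x (y + z) = cip x y + cip x z"
  and cip_add_left: "cip (y + z) x = cip y x + cip z x"
  and cip_diff_right: "cip x (y - z) = cip x y - cip x z"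
  and cip_diff_left: "cip (y - z) x = cip y x - cip z x"
  and cip_scale_right: "cip x (c *s y) = c * cip x y"
  and cip_scale_left: "cip (c *s y) x = cnj c * cip y x"
  and cip_zero_right [simp]: "cip x 0 = 0"
  and cip_zero_left [simp]: "cip 0 x = 0"
  by (simp_all add: cip_def algebra_simps sum.distrib sum_subtractf sum_distrib_left)

lemmas cip_simps = cip_add_right cip_add_left cip_diff_right cip_diff_left cip_scale_right cip_scale_left

lemma cnj_cip: "cnj (cip x y) = cip y x"
  by (simp add: cip_def mult.commute)

lemma cip_commute_eq_0: "cip x y = 0 \<longleftrightarrow> cip y x = 0"
  by (metis cnj_cip complex_cnj_zero)

lemma inner_eq_Re_cip: "inner x y = Re (cip x y)"
  by (simp add: inner_vec_def cip_def inner_complex_def)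

lemma cip_self: "cip x x = complex_of_real ((norm x)\<^sup>2)"
proof -
  have "Im (cip x x) = 0"
    using cnj_cip[of x x] by (metis complex_cnj_cancel_iff cnj.simps(2) equation_minus_iff neg_equal_zero)
  then show ?thesis
    using inner_eq_Re_cip[of x x] by (simp add: complex_eq_iff power2_norm_eq_inner)
qed

lemma cip_self_eq_0 [simp]: "cip x x = 0 \<longleftrightarrow> x = 0"
  by (simp add: cip_self)

lemma norm_scale_vec: "norm (c *s (x::complex^'n)) = cmod c * norm x"
proof -
  have "complex_of_real ((norm (c *s x))\<^sup>2) = complex_of_real ((cmod c * norm x)\<^sup>2)"
    unfolding cip_self[symmetric] cip_simps
    using complex_norm_square[of c] by (simp add: cip_self power_mult_distrib)
  then have "(norm (c *s x))\<^sup>2 = (cmod c * norm x)\<^sup>2"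
    using of_real_eq_iff by blast
  then show ?thesis by (simp add: power2_eq_iff_nonneg)
qed

lemma scaleR_eq_smult: "r *\<^sub>R (x::complex^'n) = complex_of_real r *s x"
  by (simp add: vec_eq_iff scaleR_conv_of_real[where 'a=complex])

lemma mat_adj_nth [simp]: "mat_adj A $ i $ j = cnj (A $ j $ i)"
  by (simp add: mat_adj_def)

lemma cmat_scale_nth [simp]: "cmat_scale c A $ i $ j = c * A $ i $ j"
  by (simp add: cmat_scale_def)

lemma diag_mat_nth: "diag_mat d $ i $ j = (if i = j then d i else 0)"
  by (simp add: diag_mat_def)

lemma mat_adj_adj [simp]: "mat_adj (mat_adj A) = A"
  and mat_adj_add: "mat_adj (A + B) = mat_adj A + mat_adj B"
  and mat_adj_diff: "mat_adj (A - B) = mat_adj A - mat_adj B"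
  and mat_adj_uminus: "mat_adj (- A) = - mat_adj A"
  and mat_adj_scale: "mat_adj (cmat_scale c A) = cmat_scale (cnj c) (mat_adj A)"
  and mat_adj_scaleR: "mat_adj (r *\<^sub>R A) = r *\<^sub>R mat_adj A"
  and mat_adj_one [simp]: "mat_adj (mat 1) = mat 1"
  and mat_adj_zero [simp]: "mat_adj 0 = 0"
  and mat_adj_diag: "mat_adj (diag_mat d) = diag_mat (\<lambda>i. cnj (d i))"
  by (auto simp: vec_eq_iff mat_def diag_mat_nth)

lemma mat_adj_mult: "mat_adj (A ** B) = mat_adj B ** mat_adj A"
  by (simp add: vec_eq_iff matrix_matrix_mult_def mult.commute)

lemma cmat_scale_simps:
  "cmat_scale c (A + B) = cmat_scale c A + cmat_scale c B"
  "cmat_scale c (A - B) = cmat_scale c A - cmat_scale c B"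
  "cmat_scale (a + c) A = cmat_scale a A + cmat_scale c A"
  "cmat_scale (a - c) A = cmat_scale a A - cmat_scale c A"
  "cmat_scale a (cmat_scale c A) = cmat_scale (a * c) A"
  "cmat_scale (- a) A = - cmat_scale a A"
  "cmat_scale a (- A) = - cmat_scale a A"
  "cmat_scale 1 A = A"
  "cmat_scale 0 A = 0"
  "cmat_scale c 0 = 0"
  by (simp_all add: vec_eq_iff algebra_simps)

lemma cmat_scale_mult_left: "cmat_scale c A ** B = cmat_scale c (A ** B)"
  and cmat_scale_mult_right: "A ** cmat_scale c B = cmat_scale c (A ** B)"
  by (simp_all add: vec_eq_iff matrix_matrix_mult_def sum_distrib_left mult_ac)

lemma cmat_scale_mult_vec: "cmat_scale c A *v x = c *s (A *v x)"
  by (simp add: vec_eq_iff matrix_vector_mult_def sum_distrib_left mult_ac)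

lemma scaleR_eq_cmat_scale: "r *\<^sub>R (A::complex^'n^'n) = cmat_scale (complex_of_real r) A"
  by (simp add: vec_eq_iff scaleR_conv_of_real[where 'a=complex])

lemma mult_vec_scale: "A *v (c *s x) = c *s (A *v (x::complex^'n))"
  by (simp add: vec_eq_iff matrix_vector_mult_def sum_distrib_left mult_ac)

lemma matrix_mult_diff_left: "(A - B) ** C = A ** C - B ** (C::complex^'n^'n)"
  and matrix_mult_diff_right: "C ** (A - B) = C ** A - C ** (B::complex^'n^'n)"
  and matrix_mult_add_left: "(A + B) ** C = A ** C + B ** (C::complex^'n^'n)"
  and matrix_mult_minus_left: "(- A) ** C = - (A ** (C::complex^'n^'n))"
  and matrix_mult_minus_right: "A ** (- C) = - (A ** (C::complex^'n^'n))"
  and matrix_mult_scaleR_left: "(r *\<^sub>R A) ** C = r *\<^sub>R (A ** (C::complex^'n^'n))"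
  and matrix_mult_scaleR_right: "A ** (r *\<^sub>R C) = r *\<^sub>R (A ** (C::complex^'n^'n))"
  by (simp_all add: vec_eq_iff matrix_matrix_mult_def algebra_simps sum.distrib sum_subtractf
      sum_negf scaleR_sum_right)

lemmas matrix_ring_simps = matrix_mult_diff_left matrix_mult_diff_right matrix_mult_add_left
  matrix_add_ldistrib matrix_mult_minus_left matrix_mult_minus_right matrix_mult_scaleR_left
  matrix_mult_scaleR_right

lemma diag_mat_mult_left: "(diag_mat d ** A) $ i $ j = d i * A $ i $ j"
  and diag_mat_mult_right: "(A ** diag_mat d) $ i $ j = A $ i $ j * d j"
  by (simp_all add: matrix_matrix_mult_def diag_mat_nth if_distrib if_distribR
      sum.delta sum.delta' cong: if_cong)

lemma diag_mat_mult: "diag_mat d ** diag_mat e = diag_mat (\<lambda>i. d i * e i)"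
  by (simp add: vec_eq_iff diag_mat_mult_left diag_mat_nth)

lemma diag_mat_one [simp]: "diag_mat (\<lambda>i. 1) = mat 1"
  by (simp add: vec_eq_iff diag_mat_nth mat_def)

lemma cip_adj: "cip (A *v x) y = cip x (mat_adj A *v y)"
proof -
  have "cip (A *v x) y = (\<Sum>i\<in>UNIV. \<Sum>j\<in>UNIV. cnj (A$i$j) * cnj (x$j) * y$i)"
    by (simp add: cip_def matrix_vector_mult_def sum_distrib_right)
  also have "\<dots> = (\<Sum>j\<in>UNIV. \<Sum>i\<in>UNIV. cnj (A$i$j) * cnj (x$j) * y$i)"
    by (rule sum.swap)
  also have "\<dots> = cip x (mat_adj A *v y)"
    by (simp add: cip_def matrix_vector_mult_def sum_distrib_left mult_ac)
  finally show ?thesis .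
qed

lemma hermitian_cip: "hermitian A \<Longrightarrow> cip (A *v x) y = cip x (A *v y)"
  by (simp add: cip_adj hermitian_def)

lemma column_mult: "A *v column j B = column j (A ** B)"
  by (simp add: vec_eq_iff column_def matrix_vector_mult_def matrix_matrix_mult_def)

lemma adj_mult_nth: "(mat_adj A ** B) $ i $ j = cip (column i A) (column j B)"
  by (simp add: matrix_matrix_mult_def cip_def column_def)

lemma conj_nth: "(mat_adj W ** A ** W) $ i $ j = cip (column i W) (A *v column j W)"
  by (simp add: adj_mult_nth column_mult flip: matrix_mul_assoc)

lemma unitary_left: "g \<in> unitary_group \<Longrightarrow> mat_adj g ** g = mat 1"
  by (simp add: unitary_group_def)

lemma unitary_right: "g \<in> unitary_group \<Longrightarrow> g ** mat_adj g = mat 1"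
  using unitary_left matrix_left_right_inverse by blast

lemma unitary_left': "g \<in> unitary_group \<Longrightarrow> mat_adj g ** (g ** A) = A"
  for A :: "complex^'n^'n"
  by (simp add: matrix_mul_assoc unitary_left)

lemma unitary_right': "g \<in> unitary_group \<Longrightarrow> g ** (mat_adj g ** A) = A"
  for A :: "complex^'n^'n"
  by (simp add: matrix_mul_assoc unitary_right)

lemma unitary_one [simp]: "mat 1 \<in> unitary_group"
  by (simp add: unitary_group_def)

lemma unitary_adj: "g \<in> unitary_group \<Longrightarrow> mat_adj g \<in> unitary_group"
  using unitary_right by (auto simp: unitary_group_def)

lemma unitary_mult: "g \<in> unitary_group \<Longrightarrow> h \<in> unitary_group \<Longrightarrow> g ** h \<in> unitary_group"
  by (simp add: unitary_group_def mat_adj_mult)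
     (metis matrix_mul_assoc matrix_mul_lid)

lemma unitary_cip: "g \<in> unitary_group \<Longrightarrow> cip (g *v x) (g *v y) = cip x y"
  by (simp add: cip_adj matrix_vector_mul_assoc unitary_left)

lemma norm_eq_cip: "norm x = sqrt (Re (cip x x))"
  by (simp add: cip_self)

lemma unitary_norm_vec: "g \<in> unitary_group \<Longrightarrow> norm (g *v x) = norm x"
  by (simp add: norm_eq_cip unitary_cip)

lemma unitary_iff_columns:
  "g \<in> unitary_group \<longleftrightarrow> (\<forall>i j. cip (column i g) (column j g) = (if i = j then 1 else 0))"
  by (simp add: unitary_group_def vec_eq_iff adj_mult_nth mat_def)

lemma unitary_diag: "(\<And>i. cmod (d i) = 1) \<Longrightarrow> diag_mat d \<in> unitary_group"
  unfolding unitary_group_def mem_Collect_eq mat_adj_diag diag_mat_mult diag_mat_one[symmetric]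
  by (rule arg_cong[where f = diag_mat]) (simp add: fun_eq_iff mult.commute flip: complex_norm_square)

subsection \<open>The Frobenius norm\<close>

lemma norm_row_sum: "(norm (A::complex^'n^'m))\<^sup>2 = (\<Sum>i\<in>UNIV. (norm (A$i))\<^sup>2)"
  by (simp add: norm_vec_def L2_set_def sum_nonneg)

lemma norm_column_sum: "(norm (A::complex^'n^'n))\<^sup>2 = (\<Sum>j\<in>UNIV. (norm (column j A))\<^sup>2)"
proof -
  have "(norm A)\<^sup>2 = (\<Sum>i\<in>UNIV. \<Sum>j\<in>UNIV. (cmod (A$i$j))\<^sup>2)"
    by (simp add: norm_row_sum) (simp add: norm_vec_def L2_set_def sum_nonneg)
  also have "\<dots> = (\<Sum>j\<in>UNIV. \<Sum>i\<in>UNIV. (cmod (A$i$j))\<^sup>2)"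
    by (rule sum.swap)
  finally show ?thesis by (simp add: norm_vec_def L2_set_def sum_nonneg column_def)
qed

lemma norm_mat_adj [simp]: "norm (mat_adj A) = norm A"
proof -
  have "(norm (mat_adj A))\<^sup>2 = (norm A)\<^sup>2"
    unfolding norm_column_sum[of "mat_adj A"] norm_row_sum[of A]
    by (simp add: norm_vec_def column_def L2_set_def)
  then show ?thesis by simp
qed

lemma norm_mult_vec_le: "norm (A *v x) \<le> norm (A::complex^'n^'n) * norm x"
proof -
  have 1: "cmod ((A *v x) $ i) \<le> norm (A$i) * norm x" for i
  proof -
    have "cmod ((A *v x) $ i) \<le> (\<Sum>j\<in>UNIV. cmod (A$i$j) * cmod (x$j))"
      unfolding matrix_vector_mult_def by (simp add: sum_norm_le norm_mult)
    also have "\<dots> \<le> L2_set (\<lambda>j. cmod (A$i$j)) UNIV * L2_set (\<lambda>j. cmod (x$j)) UNIV"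
      using L2_set_mult_ineq[of "\<lambda>j. cmod (A$i$j)" "\<lambda>j. cmod (x$j)" UNIV] by simp
    finally show ?thesis by (simp add: norm_vec_def)
  qed
  have "(norm (A *v x))\<^sup>2 = (\<Sum>i\<in>UNIV. (cmod ((A *v x) $ i))\<^sup>2)"
    by (simp add: norm_vec_def L2_set_def sum_nonneg)
  also have "\<dots> \<le> (\<Sum>i\<in>UNIV. (norm (A$i) * norm x)\<^sup>2)"
    by (intro sum_mono power_mono 1) auto
  also have "\<dots> = (norm A * norm x)\<^sup>2"
    by (simp add: power_mult_distrib norm_row_sum sum_distrib_right)
  finally show ?thesis
    by (rule power2_le_imp_le) simp
qed

text \<open>The norm of the nested vector type is the Frobenius norm, so submultiplicativity follows
  column by column from \<open>norm_mult_vec_le\<close>.\<close>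

lemma norm_matrix_mult_le: "norm (A ** B) \<le> norm (A::complex^'n^'n) * norm (B::complex^'n^'n)"
proof -
  have "(norm (A ** B))\<^sup>2 = (\<Sum>j\<in>UNIV. (norm (A *v column j B))\<^sup>2)"
    by (simp add: norm_column_sum column_mult)
  also have "\<dots> \<le> (\<Sum>j\<in>UNIV. (norm A * norm (column j B))\<^sup>2)"
    by (intro sum_mono power_mono norm_mult_vec_le) auto
  also have "\<dots> = (norm A * norm B)\<^sup>2"
    by (simp add: power_mult_distrib norm_column_sum[of B] sum_distrib_left)
  finally show ?thesis
    by (rule power2_le_imp_le) simp
qed

lemma unitary_norm_mult_left: "g \<in> unitary_group \<Longrightarrow> norm (g ** A) = norm A"
  for A :: "complex^'n^'n"
  by (rule power2_eq_imp_eq) (simp_all add: norm_column_sum unitary_norm_vec flip: column_mult)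

lemma unitary_norm_mult_right: "g \<in> unitary_group \<Longrightarrow> norm (A ** g) = norm A"
  for A :: "complex^'n^'n"
  by (metis norm_mat_adj mat_adj_mult unitary_adj unitary_norm_mult_left)

lemma bounded_bilinear_matrix_mult: 
  "bounded_bilinear ((**) :: complex^'n^'n \<Rightarrow> complex^'n^'n \<Rightarrow> complex^'n^'n)"
  by standard (auto simp: matrix_ring_simps intro!: exI[of _ 1] norm_matrix_mult_le)

interpretation mm: bounded_bilinear "(**) :: complex^'n^'n \<Rightarrow> complex^'n^'n \<Rightarrow> complex^'n^'n"
  by (rule bounded_bilinear_matrix_mult)

interpretation mv: bounded_bilinear "(*v) :: complex^'n^'n \<Rightarrow> complex^'n \<Rightarrow> complex^'n"
  by standard (simp_all add: matrix_vector_mult_add_rdistrib matrix_vector_right_distrib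
      scaleR_eq_cmat_scale cmat_scale_mult_vec scaleR_eq_smult mult_vec_scale,
      metis norm_mult_vec_le mult.right_neutral)

lemma bounded_linear_mat_adj: "bounded_linear (mat_adj :: complex^'n^'n \<Rightarrow> _)"
  by (rule bounded_linear_intro[where K=1]) (auto simp: mat_adj_add mat_adj_scaleR)

lemma closed_unitary_group: "closed (unitary_group :: (complex^'n^'n) set)"
  unfolding unitary_group_def
  by (intro closed_Collect_eq mm.continuous_on bounded_linear.continuous_on[OF bounded_linear_mat_adj] continuous_on_id continuous_on_const)

lemma unitary_norm: "g \<in> unitary_group \<Longrightarrow> norm g = norm (mat 1 :: complex^'n^'n)"
  for g :: "complex^'n^'n"
  by (metis matrix_mul_rid unitary_norm_mult_left)

lemma compact_unitary_group: "compact (unitary_group :: (complex^'n^'n) set)"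
  by (auto simp: compact_eq_bounded_closed closed_unitary_group bounded_iff
      intro!: exI[of _ "norm (mat 1 :: complex^'n^'n)"] dest: unitary_norm)

subsection \<open>Orthogonality\<close>

text \<open>Real orthogonality to both \<open>y\<close> and \<open>\<i> *s y\<close> is complex
  orthogonality to \<open>y\<close>. Doubling \<open>S\<close> in this way reduces the claim to a
  count in real dimension 2n.\<close>

lemma exists_orthogonal:
  fixes S :: "(complex^'n) set"
  assumes "finite S" "card S < CARD('n)"
  obtains x where "x \<noteq> 0" "\<And>y. y \<in> S \<Longrightarrow> cip y x = 0"
proof -
  let ?T = "S \<union> (\<lambda>y. \<i> *s y) ` S"
  have "dim ?T \<le> card ?T" using assms(1) by (intro dim_le_card) (auto simp: span_base subsetI)
  also have "\<dots> \<le> card S + card S"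
    by (meson assms(1) card_Un_le card_image_le le_trans nat_add_left_cancel_le)
  finally have "dim ?T < DIM(complex^'n)" using assms(2) by simp
  then obtain x where x: "x \<noteq> 0" "\<And>y. y \<in> span ?T \<Longrightarrow> orthogonal x y"
    using orthogonal_to_subspace_exists by blast
  have "cip y x = 0" if "y \<in> S" for y
  proof -
    have "inner x y = 0" "inner x (\<i> *s y) = 0"
      using x(2)[of y] x(2)[of "\<i> *s y"] that by (auto simp: orthogonal_def span_base)
    then have "cip x y = 0"
      by (simp add: inner_eq_Re_cip cip_scale_right complex_eq_iff)
    then show ?thesis using cip_commute_eq_0 by blast
  qed
  with x show thesis using that by blast
qed

lemma unitary_expand:
  assumes "g \<in> unitary_group"
  shows "x = (\<Sum>i\<in>UNIV. cip (column i g) x *s column i g)"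
proof -
  have "x = g *v (mat_adj g *v x)"
    using assms by (simp add: matrix_vector_mul_assoc unitary_right)
  also have "mat_adj g *v x = (\<chi> i. cip (column i g) x)"
    by (simp add: vec_eq_iff matrix_vector_mult_def cip_def column_def)
  finally show ?thesis by (simp add: matrix_mult_sum)
qed

lemma unitary_parseval:
  assumes "g \<in> unitary_group"
  shows "(norm x)\<^sup>2 = (\<Sum>i\<in>UNIV. (cmod (cip (column i g) x))\<^sup>2)"
proof -
  have "mat_adj g *v x = (\<chi> i. cip (column i g) x)"
    by (simp add: vec_eq_iff matrix_vector_mult_def cip_def column_def)
  moreover have "norm (mat_adj g *v x) = norm x"
    using assms by (simp add: unitary_norm_vec unitary_adj)
  ultimately show ?thesis by (simp add: norm_vec_def L2_set_def sum_nonneg)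
qed

definition orthonormal :: "(complex^'n) set \<Rightarrow> bool" where
  "orthonormal S \<longleftrightarrow> (\<forall>x\<in>S. \<forall>y\<in>S. cip x y = (if x = y then 1 else 0))"

text \<open>A set of n + 1 orthonormal vectors together with its multiple by \<open>\<i>\<close>
  would consist of 2n + 2 nonzero vectors that are pairwise orthogonal in the real sense, too many
  for real dimension 2n.\<close>

lemma orthonormal_card:
  fixes S :: "(complex^'n) set"
  assumes "orthonormal S"
  shows "finite S \<and> card S \<le> CARD('n)"
proof (rule ccontr)
  assume *: "\<not> (finite S \<and> card S \<le> CARD('n))"
  obtain T where T: "T \<subseteq> S" "finite T" "card T = Suc CARD('n)"
  proof (cases "finite S")
    case True
    then show ?thesis
      using * that obtain_subset_with_card_n[of "Suc CARD('n)" S] by (metis not_less_eq_eq)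
  next
    case False
    then show ?thesis using that infinite_arbitrarily_large by blast
  qed
  let ?R = "T \<union> (\<lambda>y. \<i> *s y) ` T"
  have orth: "cip x y = (if x = y then 1 else 0)" if "x \<in> T" "y \<in> T" for x y
    using assms that T(1) unfolding orthonormal_def by (meson subsetD)
  have inj: "inj_on (\<lambda>y. \<i> *s y) T" by (auto simp: inj_on_def)
  have z: "x \<noteq> \<i> *s y" if "x \<in> T" "y \<in> T" for x y
  proof
    assume eq: "x = \<i> *s y"
    have "cip y x = \<i>" using orth[OF that(2) that(2)] by (simp add: eq cip_simps)
    then show False using orth[OF that(2) that(1)] by (auto split: if_splits)
  qed
  have "card ?R = card T + card T"
    using T(2) inj z by (subst card_Un_disjoint) (auto simp: card_image)
  moreover have "pairwise orthogonal ?R"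
    unfolding pairwise_def orthogonal_def inner_eq_Re_cip
    by (auto simp: cip_simps orth)
  moreover have "0 \<notin> ?R"
    using orth[of 0 0] by auto
  ultimately have "card T + card T \<le> DIM(complex^'n)"
    using pairwise_orthogonal_independent[of ?R] independent_bound[of ?R] by simp
  then show False using T(3) by simp
qed

text \<open>An orthonormal set of largest cardinality among those with property \<open>P\<close>
  must be a basis. \<open>ext\<close> supplies \<open>P\<close> for all nonzero multiples because
  the new vector still has to be normalized. The uses are \<open>P\<close> = being an eigenvector
  and a trivial \<open>P\<close>.\<close>

lemma orthonormal_extend:
  fixes S :: "(complex^'n) set"
  assumes S: "orthonormal S" "\<And>x. x \<in> S \<Longrightarrow> P x"
    and ext: "\<And>T. orthonormal T \<Longrightarrow> (\<And>x. x \<in> T \<Longrightarrow> P x) \<Longrightarrow> card T < CARD('n) \<Longrightarrow>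
      \<exists>x. x \<noteq> 0 \<and> (\<forall>y\<in>T. cip y x = 0) \<and> (\<forall>c. c \<noteq> 0 \<longrightarrow> P (c *s x))"
  obtains T where "S \<subseteq> T" "orthonormal T" "\<And>x. x \<in> T \<Longrightarrow> P x" "card T = CARD('n)"
proof -
  define Q where "Q T \<longleftrightarrow> S \<subseteq> T \<and> orthonormal T \<and> (\<forall>x\<in>T. P x)" for T
  have "Q S" using S by (auto simp: Q_def)
  moreover have "\<forall>T. Q T \<longrightarrow> card T < Suc CARD('n)"
    using orthonormal_card unfolding Q_def by (metis less_Suc_eq_le)
  ultimately have "\<exists>T. Q T \<and> (\<forall>T'. Q T' \<longrightarrow> card T' \<le> card T)"
    by (rule ex_has_greatest_nat)
  then obtain T where T: "Q T" "\<And>T'. Q T' \<Longrightarrow> card T' \<le> card T"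
    by blast
  have fin: "finite T" and le: "card T \<le> CARD('n)" using T(1) orthonormal_card unfolding Q_def by blast+
  have "\<not> card T < CARD('n)"
  proof
    assume "card T < CARD('n)"
    then obtain x where x: "x \<noteq> 0" "\<forall>y\<in>T. cip y x = 0" "\<And>c. c \<noteq> 0 \<Longrightarrow> P (c *s x)"
      using ext[of T] T(1) unfolding Q_def by metis
    define z where "z = complex_of_real (1 / norm x) *s x"
    have z1: "cip z z = 1" using x(1)
      by (simp add: z_def cip_self norm_scale_vec norm_divide)
    have z0: "\<forall>y\<in>T. cip y z = 0 \<and> cip z y = 0"
    proof
      fix y assume "y \<in> T"
      then have "cip y x = 0" using x(2) by blast
      then have "cip x y = 0" using cip_commute_eq_0 by blast
      with \<open>cip y x = 0\<close> show "cip y z = 0 \<and> cip z y = 0" by (simp add: z_def cip_simps)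
    qed
    have "P z" unfolding z_def using x by auto
    have "z \<notin> T" using z0 z1 by auto
    have "orthonormal (insert z T)"
      using T(1) z0 z1 \<open>z \<notin> T\<close> by (auto simp: orthonormal_def Q_def)
    then have "Q (insert z T)" using T(1) \<open>P z\<close> by (auto simp: Q_def)
    then have "card (insert z T) \<le> card T" by (rule T(2))
    then show False using fin \<open>z \<notin> T\<close> by simp
  qed
  then have "card T = CARD('n)" using le by simp
  with that T(1) show thesis unfolding Q_def by blast
qed

lemma orthonormal_columns:
  fixes T :: "(complex^'n) set"
  assumes "orthonormal T" "card T = CARD('n)"
  obtains W :: "complex^'n^'n" where "W \<in> unitary_group" "range (\<lambda>i. column i W) = T"
proof -
  have "finite T" using assms orthonormal_card by auto
  then obtain f :: "'n \<Rightarrow> complex^'n" where f: "bij_betw f UNIV T"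
    using assms(2) by (metis finite_class.finite_UNIV finite_same_card_bij)
  define W where "W = (\<chi> i j. f j $ i)"
  have col: "column i W = f i" for i by (simp add: column_def W_def)
  have "W \<in> unitary_group"
    unfolding unitary_iff_columns col
    using assms(1) f by (auto simp: orthonormal_def bij_betw_def inj_eq)
  then show thesis using that f by (auto simp: col bij_betw_def)
qed

section \<open>Spectral theory\<close>

text \<open>Take p of least degree among the nonzero polynomials with p(T) x = 0, and a complex root
  z of p. With p = (X - z) q, minimality gives q(T) x \<noteq> 0, and this vector is an eigenvector
  inside \<open>V\<close>.\<close>

lemma eigenvector_in_invariant_subspace:
  fixes T :: "complex^'n^'n"
  assumes x: "x \<in> V" "x \<noteq> 0"
    and add: "\<And>y z. y \<in> V \<Longrightarrow> z \<in> V \<Longrightarrow> y + z \<in> V"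
    and scale: "\<And>c y. y \<in> V \<Longrightarrow> c *s y \<in> V"
    and inv: "\<And>y. y \<in> V \<Longrightarrow> T *v y \<in> V"
  obtains z y where "y \<in> V" "y \<noteq> 0" "T *v y = z *s y"
proof -
  \<comment> \<open>\<open>ap p\<close> is p(T) applied to \<open>x\<close>, evaluated by Horner's
    scheme.\<close>
  define ap where "ap p = fold_coeffs (\<lambda>a y. a *s x + T *v y) p 0" for p
  have ap_0: "ap 0 = 0" by (simp add: ap_def)
  have ap_pCons: "ap (pCons a p) = a *s x + T *v ap p" for a p
    by (cases "p = 0 \<and> a = 0") (auto simp: ap_def)
  have ap_add: "ap (p + q) = ap p + ap q" for p q
    by (induction p q rule: poly_induct2)
       (simp_all add: ap_0 ap_pCons vector_sadd_rdistrib matrix_vector_right_distrib)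
  have ap_smult: "ap (smult c p) = c *s ap p" for c p
    by (induction p) (simp_all add: ap_0 ap_pCons vector_add_ldistrib mult_vec_scale vector_smult_assoc)
  have ap_V: "ap p \<in> V" for p
  proof (induction p)
    case 0
    have "0 *s x \<in> V" using scale x by blast
    then show ?case by (simp add: ap_0)
  next
    case (pCons a p)
    then show ?case by (simp add: ap_pCons add scale inv x)
  qed
  have ap_sum: "ap (\<Sum>i\<in>I. f i) = (\<Sum>i\<in>I. ap (f i))" for I :: "nat set" and f
    by (induction I rule: infinite_finite_induct) (auto simp: ap_0 ap_add)
  define v where "v i = ap (monom 1 i)" for i
  have ap_monom: "ap (monom c i) = c *s v i" for c i
    unfolding v_def by (metis ap_smult mult.right_neutral smult_monom)
  have "\<exists>p. p \<noteq> 0 \<and> ap p = 0"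
  \<comment> \<open>The n + 1 vectors \<open>v i\<close> = T^i x are linearly dependent as a family.
    Dependence of sets does not see repetitions, so two equal members of the family are treated
    separately.\<close>
  proof (cases "inj_on v {..CARD('n)}")
    case False
    then obtain i j where ij: "i \<noteq> j" "v i = v j" by (auto simp: inj_on_def)
    let ?p = "monom 1 i + monom (-1) j :: complex poly"
    have "coeff ?p i = 1" using ij by simp
    then have "?p \<noteq> 0" by (metis coeff_0 zero_neq_one)
    moreover have "ap ?p = 0" using ij by (simp add: ap_add ap_monom)
    ultimately show ?thesis by blast
  next
    case True
    have "card (v ` {..CARD('n)}) = Suc CARD('n)" using True by (simp add: card_image)
    moreover have "card B \<le> CARD('n)" if "vec.independent B" for B :: "(complex^'n) set"
      using vec.independent_card_le_dim[of B UNIV] that by (simp add: card_cart_basis)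
    ultimately have "vec.dependent (v ` {..CARD('n)})" by (metis Suc_n_not_le_n)
    then obtain u w where u: "(\<Sum>y\<in>v ` {..CARD('n)}. u y *s y) = 0" 
        "w \<in> v ` {..CARD('n)}" "u w \<noteq> 0"
      using vec.dependent_finite[of "v ` {..CARD('n)}"] by auto
    then obtain k where k: "k \<le> CARD('n)" "w = v k" by auto
    let ?p = "\<Sum>i\<le>CARD('n). monom (u (v i)) i"
    have "coeff ?p k = u (v k)"
      using k by (simp add: coeff_sum if_distrib sum.delta cong: if_cong)
    then have "?p \<noteq> 0" using u k by (metis coeff_0)
    moreover have "ap ?p = 0"
      using u(1) by (simp add: ap_sum ap_monom sum.reindex[OF True])
    ultimately show ?thesis by blast
  qed
  then obtain p where p: "p \<noteq> 0" "ap p = 0" 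
      and least: "\<And>q. q \<noteq> 0 \<and> ap q = 0 \<Longrightarrow> degree p \<le> degree q"
    using ex_has_least_nat[of "\<lambda>p. p \<noteq> 0 \<and> ap p = 0" _ degree] by blast
  have "\<not> constant (poly p)"
  proof
    assume "constant (poly p)"
    then obtain c where c: "p = [:c:]"
      using constant_degree degree_eq_zeroE by metis
    then show False using p x(2) by (auto simp: ap_pCons ap_0)
  qed
  then obtain z where "poly p z = 0" using fundamental_theorem_of_algebra by blast
  then obtain q where q: "p = [:-z, 1:] * q" using poly_eq_0_iff_dvd by blast
  then have q0: "q \<noteq> 0" using p by auto
  have "degree p = Suc (degree q)"
    using q0 unfolding q by (subst degree_mult_eq) auto
  then have "ap q \<noteq> 0" using least[of q] q0 by auto
  moreover have "p = smult (-z) q + pCons 0 q" by (simp add: q)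
  then have "T *v ap q = z *s ap q"
    using p(2) ap_add[of "smult (-z) q" "pCons 0 q"] ap_smult[of "-z" q] ap_pCons[of 0 q]
    by (simp add: vector_smult_lneg)
  ultimately show thesis using that ap_V by blast
qed

text \<open>For a normal matrix the residuals of \<open>T\<close> at z and of
  \<open>mat_adj T\<close> at \<open>cnj z\<close> have the same norm, and the first one
  vanishes.\<close>

lemma normal_eigenvector_adj:
  fixes T :: "complex^'n^'n"
  assumes "T ** mat_adj T = mat_adj T ** T" "T *v y = z *s y"
  shows "mat_adj T *v y = cnj z *s y"
proof -
  let ?u = "mat_adj T *v y - cnj z *s y"
  have a: "cip (mat_adj T *v y) (mat_adj T *v y) = cip (T *v y) (T *v y)"
    by (simp add: cip_adj matrix_vector_mul_assoc assms(1))
  have b: "cip (mat_adj T *v y) y = cip y (T *v y)" by (simp add: cip_adj)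
  have c: "cip y (mat_adj T *v y) = cip (T *v y) y" by (simp add: cip_adj)
  have "cip ?u ?u = 0"
    unfolding cip_simps a b c by (simp add: assms(2) cip_simps)
  then show ?thesis by simp
qed

text \<open>Orthonormal eigenvectors are also eigenvectors of \<open>mat_adj T\<close>, so their
  orthogonal complement is invariant under \<open>T\<close> and contains a further eigenvector.
  Working with normal matrices covers the Hermitian and the unitary case at once.\<close>

theorem normal_diagonalizable:
  fixes T :: "complex^'n^'n"
  assumes normal: "T ** mat_adj T = mat_adj T ** T"
  obtains W d where "W \<in> unitary_group" "T ** W = W ** diag_mat d"
proof -
  define P where "P x \<longleftrightarrow> (\<exists>z. T *v x = z *s x)" for x
  obtain S where S: "orthonormal S" "\<And>x. x \<in> S \<Longrightarrow> P x" "card S = CARD('n)"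
  proof (rule orthonormal_extend[of "{}" P])
    show "orthonormal {}" by (simp add: orthonormal_def)
    fix S :: "(complex^'n) set"
    assume S: "orthonormal S" "\<And>x. x \<in> S \<Longrightarrow> P x" "card S < CARD('n)"
    define V where "V = {y. \<forall>s\<in>S. cip s y = 0}"
    have "finite S" using S orthonormal_card by blast
    then obtain x where x0: "x \<noteq> 0" "\<And>y. y \<in> S \<Longrightarrow> cip y x = 0"
      using exists_orthogonal S(3) by blast
    then have x: "x \<noteq> 0" "x \<in> V" by (auto simp: V_def)
    have inv: "T *v y \<in> V" if "y \<in> V" for y
      unfolding V_def mem_Collect_eq
    proof
      fix s assume s: "s \<in> S"
      then obtain z where "T *v s = z *s s" using S(2) P_def by blast
      then have "mat_adj T *v s = cnj z *s s" by (rule normal_eigenvector_adj[OF normal])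
      then have "cip s (T *v y) = z * cip s y"
        using cip_adj[of "mat_adj T" s y] by (simp add: cip_simps)
      then show "cip s (T *v y) = 0" using s that by (simp add: V_def)
    qed
    obtain z y where y: "y \<in> V" "y \<noteq> 0" "T *v y = z *s y"
    proof (rule eigenvector_in_invariant_subspace[of x V T])
      show "y + z \<in> V" "c *s y \<in> V" if "y \<in> V" "z \<in> V" for y z c
        using that by (auto simp: V_def cip_simps)
    qed (use x inv in \<open>auto simp: V_def cip_simps\<close>)
    have "P (c *s y)" for c
      unfolding P_def by (rule exI[of _ z]) (simp add: mult_vec_scale y(3) vector_smult_assoc mult.commute)
    then show "\<exists>x. x \<noteq> 0 \<and> (\<forall>y\<in>S. cip y x = 0) \<and> (\<forall>c. c \<noteq> 0 \<longrightarrow> P (c *s x))"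
      using y by (auto simp: V_def)
  qed auto
  obtain W where W: "W \<in> unitary_group" "range (\<lambda>i. column i W) = S"
    using orthonormal_columns[OF S(1,3)] by blast
  have "\<forall>i. \<exists>z. T *v column i W = z *s column i W"
    using S(2) W(2) unfolding P_def by blast
  then obtain d where d: "\<And>i. T *v column i W = d i *s column i W" by metis
  have "T ** W = W ** diag_mat d"
    using d[unfolded column_mult]
    by (simp add: vec_eq_iff diag_mat_mult_right column_def mult.commute)
  with W that show thesis by blast
qed

lemma column_eigen:
  fixes A W :: "complex^'n^'n"
  shows "A ** W = W ** diag_mat d \<Longrightarrow> A *v column i W = d i *s column i W"
  by (simp add: column_mult) (simp add: vec_eq_iff column_def diag_mat_mult_right mult.commute)

lemma column_nonzero: "W \<in> unitary_group \<Longrightarrow> column i W \<noteq> 0"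
  by (metis cip_self_eq_0 unitary_iff_columns zero_neq_one)

lemma hermitian_diagonalizable:
  fixes A :: "complex^'n^'n"
  assumes "hermitian A"
  obtains W and d :: "'n \<Rightarrow> real"
  where "W \<in> unitary_group" "A ** W = W ** diag_mat (\<lambda>i. complex_of_real (d i))"
proof -
  have N: "A ** mat_adj A = mat_adj A ** A" using assms by (simp add: hermitian_def)
  obtain W d where W: "W \<in> unitary_group" "A ** W = W ** diag_mat d"
    using normal_diagonalizable[OF N] by blast
  have "cnj (d i) = d i" for i
    using normal_eigenvector_adj[OF N column_eigen[OF W(2), of i]] column_eigen[OF W(2), of i]
      column_nonzero[OF W(1), of i] assms by (simp add: hermitian_def)
  then have "complex_of_real (Re (d i)) = d i" for i
    by (metis complex_is_Real_iff Reals_cnj_iff of_real_Re)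
  then show thesis using that[of W "\<lambda>i. Re (d i)"] W by simp
qed

lemma unitary_diagonalizable:
  fixes g :: "complex^'n^'n"
  assumes "g \<in> unitary_group"
  obtains W and \<theta> :: "'n \<Rightarrow> real"
  where "W \<in> unitary_group" "g ** W = W ** diag_mat (\<lambda>i. cis (\<theta> i))"
proof -
  have N: "g ** mat_adj g = mat_adj g ** g" using assms by (simp add: unitary_left unitary_right)
  obtain W d where W: "W \<in> unitary_group" "g ** W = W ** diag_mat d"
    using normal_diagonalizable[OF N] by blast
  have "cmod (d i) = 1" for i
    using unitary_norm_vec[OF assms, of "column i W"] column_nonzero[OF W(1), of i]
    by (simp add: column_eigen[OF W(2)] norm_scale_vec)
  then have "cis (Arg (d i)) = d i" for i
    by (metis cis_Arg norm_zero scaleR_one sgn_div_norm inverse_1 zero_neq_one)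
  then show thesis using that[of W "\<lambda>i. Arg (d i)"] W by simp
qed

subsection \<open>Ordered eigenvalues\<close>

text \<open>\<open>W\<close>, embedded by \<open>cp\<close> as a matrix of constant polynomials,
  intertwines X - A with X - diag d. Polynomials over the complex numbers form an integral domain,
  so det W can be cancelled as soon as it is nonzero.\<close>

lemma char_poly_diagonalized:
  fixes A :: "complex^'n^'n"
  assumes W: "W \<in> unitary_group" and AW: "A ** W = W ** diag_mat d"
  shows "char_poly A = (\<Prod>i\<in>UNIV. [:- d i, 1:])"
proof -
  define cp :: "complex^'n^'n \<Rightarrow> complex poly^'n^'n" where "cp B = (\<chi> i j. [:B$i$j:])" for B
  have cp_mult: "cp B ** cp C = cp (B ** C)" for B C
  proof -
    have "(\<Sum>k\<in>UNIV. [:f k:]) = [:\<Sum>k\<in>UNIV. f k:]" for f :: "'n \<Rightarrow> complex"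
      by (rule poly_eqI) (simp add: coeff_sum coeff_pCons split: nat.split)
    then show ?thesis
      by (simp add: cp_def vec_eq_iff matrix_matrix_mult_def mult.commute)
  qed
  let ?X = "(\<chi> i j. if i = j then [:0, 1:] else 0) :: complex poly^'n^'n"
  have com: "?X ** B = B ** ?X" for B
    by (simp add: vec_eq_iff matrix_matrix_mult_def if_distrib if_distribR sum.delta sum.delta'
        mult.commute cong: if_cong)
  have "(?X - cp A) ** cp W = cp W ** (?X - cp (diag_mat d))"
  proof -
    have "(B - C) ** D = B ** D - C ** D" "D ** (B - C) = D ** B - D ** C"
      for B C D :: "complex poly^'n^'n"
      by (simp_all add: vec_eq_iff matrix_matrix_mult_def algebra_simps sum_subtractf)
    then show ?thesis using com[of "cp W"] by (simp add: cp_mult AW)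
  qed
  then have "det (?X - cp A) * det (cp W) = det (cp W) * det (?X - cp (diag_mat d))"
    unfolding det_mul[symmetric] by simp
  moreover have "det (cp W) \<noteq> 0"
  proof -
    have "cp W ** cp (mat_adj W) = cp (mat 1)" by (simp add: cp_mult unitary_right[OF W])
    also have "cp (mat 1) = mat 1" by (simp add: cp_def mat_def vec_eq_iff)
    finally have "det (cp W) * det (cp (mat_adj W)) = 1" unfolding det_mul[symmetric] by simp
    then show ?thesis by auto
  qed
  ultimately have "det (?X - cp A) = det (?X - cp (diag_mat d))" by simp
  also have "\<dots> = (\<Prod>i\<in>UNIV. [:- d i, 1:])"
    by (subst det_diagonal) (auto simp: cp_def diag_mat_nth)
  finally show ?thesis
    by (simp add: char_poly_def cp_def minus_vec_def)
qed

text \<open>The bridge from \<open>eig\<close>, an entry of a sorted list, to eigenvectors: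
  \<open>\<tau>\<close> numbers the columns of an eigenbasis by the position of their eigenvalue in
  that list, which also fixes an order among equal eigenvalues.\<close>

theorem hermitian_spectrum:
  fixes A :: "complex^'n^'n"
  assumes "hermitian A"
  obtains W \<tau> where "W \<in> unitary_group" "bij_betw \<tau> (UNIV :: 'n set) {1..CARD('n)}"
    "A ** W = W ** diag_mat (\<lambda>i. complex_of_real (eig A (\<tau> i)))"
    "\<And>i j. 1 \<le> i \<Longrightarrow> i \<le> j \<Longrightarrow> j \<le> CARD('n) \<Longrightarrow> eig A i \<le> eig A j"
    "\<And>x. eig_mult A x = card {j \<in> {1..CARD('n)}. eig A j = x}"
proof -
  obtain W and d :: "'n \<Rightarrow> real" where W: "W \<in> unitary_group" 
    and d: "A ** W = W ** diag_mat (\<lambda>i. complex_of_real (d i))"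
    using hermitian_diagonalizable[OF assms] by blast
  obtain ys0 :: "'n list" where ys0: "set ys0 = UNIV" "distinct ys0"
    using finite_distinct_list[OF finite[of UNIV]] by blast
  \<comment> \<open>Sorting the indices instead of the values keeps track of the column to which
    each eigenvalue belongs.\<close>
  define ys where "ys = sort_key d ys0"
  have ys: "set ys = UNIV" "distinct ys" "sorted (map d ys)" "mset ys = mset_set UNIV"
    using ys0 mset_set_set[OF ys0(2)] by (auto simp: ys_def)
  then have len: "length ys = CARD('n)" using distinct_card by fastforce
  have pr: "proots (char_poly A) = image_mset (\<lambda>i. complex_of_real (d i)) (mset_set UNIV)"
    unfolding char_poly_diagonalized[OF W d]
    by (subst proots_prod) (simp_all add: sum_unfold_sum_mset)
  have "sorted_list_of_multiset (image_mset Re (proots (char_poly A))) = map d ys"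
    unfolding pr ys(4)[symmetric] using ys(3)
    by (simp add: multiset.map_comp comp_def sorted_list_of_multiset_mset sorted_sort_id
        flip: mset_map)
  then have eig: "eig A j = d (ys ! (j - 1))" if "j \<in> {1..CARD('n)}" for j
    using that len by (auto simp: eig_def intro!: nth_map)
  define \<sigma> where "\<sigma> j = ys ! (j - 1)" for j
  have \<sigma>: "bij_betw \<sigma> {1..CARD('n)} UNIV"
  proof -
    have "bij_betw (\<lambda>j. ys ! j) {..<length ys} (set ys)"
      using ys(2) by (rule bij_betw_nth) auto
    moreover have "bij_betw (\<lambda>j. j - 1) {1..CARD('n)} {..<length ys}"
      by (rule bij_betwI[where g=Suc]) (auto simp: len)
    ultimately have "bij_betw ((!) ys \<circ> (\<lambda>j. j - 1)) {1..CARD('n)} (set ys)"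
      by (rule bij_betw_trans[rotated])
    moreover have "(!) ys \<circ> (\<lambda>j. j - 1) = \<sigma>" by (simp add: \<sigma>_def fun_eq_iff)
    ultimately show ?thesis using ys(1) by simp
  qed
  define \<tau> where "\<tau> = inv_into {1..CARD('n)} \<sigma>"
  have \<tau>: "bij_betw \<tau> UNIV {1..CARD('n)}"
    unfolding \<tau>_def using \<sigma> by (rule bij_betw_inv_into)
  have d\<tau>: "eig A (\<tau> i) = d i" for i
  proof -
    have "\<tau> i \<in> {1..CARD('n)}" using \<tau> by (auto simp: bij_betw_def)
    moreover have "\<sigma> (\<tau> i) = i"
      unfolding \<tau>_def using \<sigma> by (meson UNIV_I bij_betw_inv_into_right)
    ultimately show ?thesis using eig[of "\<tau> i"] by (simp add: \<sigma>_def)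
  qed
  have mono: "eig A i \<le> eig A j" if "1 \<le> i" "i \<le> j" "j \<le> CARD('n)" for i j
    using eig[of i] eig[of j] that sorted_nth_mono[OF ys(3), of "i - 1" "j - 1"] len by auto
  have mult: "eig_mult A x = card {j \<in> {1..CARD('n)}. eig A j = x}" for x
  proof -
    have "eig_mult A x = card {i. d i = x}"
      unfolding eig_mult_def pr
      by (simp add: count_image_mset vimage_def)
    also have "\<dots> = card {j \<in> {1..CARD('n)}. eig A j = x}"
    proof (rule bij_betw_same_card[of \<tau>])
      show "bij_betw \<tau> {i. d i = x} {j \<in> {1..CARD('n)}. eig A j = x}"
        using bij_betw_subset[OF \<tau>, of "{i. d i = x}"] \<tau> d\<tau>
        by (auto simp: bij_betw_def inj_on_def image_iff set_eq_iff) metis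
    qed
    finally show ?thesis .
  qed
  show thesis
    by (rule that[OF W \<tau> _ mono mult]) (simp_all add: d\<tau> d)
qed

subsection \<open>Perturbation of eigenvalues\<close>

definition spectral_basis :: "complex^'n^'n \<Rightarrow> complex^'n^'n \<Rightarrow> ('n \<Rightarrow> nat) \<Rightarrow> bool" where
  "spectral_basis A W \<tau> \<longleftrightarrow> W \<in> unitary_group \<and> bij_betw \<tau> UNIV {1..CARD('n)} \<and>
     A ** W = W ** diag_mat (\<lambda>i. complex_of_real (eig A (\<tau> i)))"

lemma spectral_basis_exists:
  assumes "hermitian A" obtains W \<tau> where "spectral_basis A W \<tau>"
  using hermitian_spectrum[OF assms] unfolding spectral_basis_def by metis

lemma eig_mono:
  fixes A :: "complex^'n^'n"
  assumes "hermitian A" "1 \<le> i" "i \<le> j" "j \<le> CARD('n)"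
  shows "eig A i \<le> eig A j"
  using hermitian_spectrum[OF assms(1)] assms(2-) by metis

lemma eig_mult_eq_card:
  fixes A :: "complex^'n^'n"
  assumes "hermitian A"
  shows "eig_mult A x = card {j \<in> {1..CARD('n)}. eig A j = x}"
  using hermitian_spectrum[OF assms] by metis

lemma spectral_basis_eigen:
  "spectral_basis A W \<tau> \<Longrightarrow> A *v column i W = complex_of_real (eig A (\<tau> i)) *s column i W"
  unfolding spectral_basis_def using column_eigen by blast

lemma spectral_basis_cip_mult:
  assumes "hermitian A" "spectral_basis A W \<tau>"
  shows "cip (column i W) (A *v x) = eig A (\<tau> i) * cip (column i W) x"
  using hermitian_cip[OF assms(1), of "column i W" x]
  by (simp add: spectral_basis_eigen[OF assms(2)] cip_simps)

lemma spectral_basis_index: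
  fixes A :: "complex^'n^'n"
  assumes "spectral_basis A W \<tau>" "1 \<le> k" "k \<le> CARD('n)"
  obtains i where "\<tau> i = k" "\<And>i'. \<tau> i' = k \<Longrightarrow> i' = i"
proof -
  have "bij_betw \<tau> UNIV {1..CARD('n)}" using assms by (simp add: spectral_basis_def)
  moreover have "k \<in> {1..CARD('n)}" using assms by simp
  ultimately show thesis using that unfolding bij_betw_def by (metis imageE injD)
qed

lemma spectral_basis_range:
  fixes A :: "complex^'n^'n"
  assumes "spectral_basis A W \<tau>"
  shows "1 \<le> \<tau> i" "\<tau> i \<le> CARD('n)"
  using assms unfolding spectral_basis_def bij_betw_def by auto

lemma spectral_basis_card:
  fixes A :: "complex^'n^'n"
  assumes "spectral_basis A W \<tau>"
  shows "card {i. \<tau> i \<in> J} = card (J \<inter> {1..CARD('n)})"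
proof (rule bij_betw_same_card[of \<tau>])
  have "bij_betw \<tau> UNIV {1..CARD('n)}" using assms by (simp add: spectral_basis_def)
  then show "bij_betw \<tau> {i. \<tau> i \<in> J} (J \<inter> {1..CARD('n)})"
    unfolding bij_betw_def inj_on_def by (auto simp: image_iff set_eq_iff) metis
qed

lemma unitary_cip_expand:
  assumes "W \<in> unitary_group"
  shows "cip x y = (\<Sum>i\<in>UNIV. cnj (cip (column i W) x) * cip (column i W) y)"
proof -
  have "cip x y = cip (mat_adj W *v x) (mat_adj W *v y)"
    using assms by (simp add: unitary_cip unitary_adj)
  moreover have "mat_adj W *v z = (\<chi> i. cip (column i W) z)" for z
    by (simp add: vec_eq_iff matrix_vector_mult_def cip_def column_def)
  ultimately show ?thesis by (simp add: cip_def[of "vec_lambda _"])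
qed

lemma unitary_vec_eqI:
  assumes "W \<in> unitary_group" "\<And>i. cip (column i W) x = cip (column i W) y"
  shows "x = y"
  using unitary_expand[OF assms(1), of x] unitary_expand[OF assms(1), of y] assms(2) by simp

lemma spectral_basis_quadratic:
  assumes "hermitian A" "spectral_basis A W \<tau>"
  shows "inner x (A *v x) = (\<Sum>i\<in>UNIV. eig A (\<tau> i) * (cmod (cip (column i W) x))\<^sup>2)"
proof -
  have W: "W \<in> unitary_group" using assms by (simp add: spectral_basis_def)
  have "cip x (A *v x) = (\<Sum>i\<in>UNIV. complex_of_real (eig A (\<tau> i) * (cmod (cip (column i W) x))\<^sup>2))"
    unfolding unitary_cip_expand[OF W, of x] spectral_basis_cip_mult[OF assms]
    by (rule sum.cong) (auto simp: complex_norm_square[symmetric] mult_ac simp flip: of_real_power)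
  then show ?thesis by (simp add: inner_eq_Re_cip)
qed

lemma spectral_basis_residual:
  assumes "hermitian A" "spectral_basis A W \<tau>"
  shows "(norm (A *v x - complex_of_real \<mu> *s x))\<^sup>2 =
    (\<Sum>i\<in>UNIV. (eig A (\<tau> i) - \<mu>)\<^sup>2 * (cmod (cip (column i W) x))\<^sup>2)"
proof -
  have W: "W \<in> unitary_group" using assms by (simp add: spectral_basis_def)
  have "cip (column i W) (A *v x - complex_of_real \<mu> *s x) = 
    complex_of_real (eig A (\<tau> i) - \<mu>) * cip (column i W) x" for i
    by (simp add: cip_simps spectral_basis_cip_mult[OF assms] algebra_simps)
  then show ?thesis
    unfolding unitary_parseval[OF W, of "A *v x - complex_of_real \<mu> *s x"]
    by (simp add: norm_mult power_mult_distrib del: of_real_diff)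
qed

text \<open>The n - k eigenvectors of \<open>A\<close> above position \<open>k\<close> and the k - 1
  eigenvectors of \<open>B\<close> below it are fewer than n in total, so some nonzero
  \<open>x\<close> is orthogonal to all of them. Its quadratic form under \<open>A\<close> is at
  most \<open>eig A k\<close>, under \<open>B\<close> at least \<open>eig B k\<close>, relative to
  its squared norm.\<close>

lemma Weyl_inequality:
  fixes A B :: "complex^'n^'n"
  assumes A: "hermitian A" and B: "hermitian B" and k: "1 \<le> k" "k \<le> CARD('n)"
  shows "eig B k \<le> eig A k + norm (B - A)"
proof -
  obtain WA \<tau>A where a: "spectral_basis A WA \<tau>A" using spectral_basis_exists[OF A] by blast
  obtain WB \<tau>B where b: "spectral_basis B WB \<tau>B" using spectral_basis_exists[OF B] by blast
  let ?SA = "(\<lambda>i. column i WA) ` {i. \<tau>A i \<in> {k<..}}"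
  let ?SB = "(\<lambda>i. column i WB) ` {i. \<tau>B i \<in> {..<k}}"
  have "card ?SA \<le> card ({k<..} \<inter> {1..CARD('n)})"
    by (metis card_image_le finite spectral_basis_card[OF a])
  also have "{k<..} \<inter> {1..CARD('n)} = {k+1..CARD('n)}" by auto
  finally have 1: "card ?SA \<le> CARD('n) - k" by simp
  have "card ?SB \<le> card ({..<k} \<inter> {1..CARD('n)})"
    by (metis card_image_le finite spectral_basis_card[OF b])
  also have "{..<k} \<inter> {1..CARD('n)} = {1..<k}" using k by auto
  finally have 2: "card ?SB \<le> k - 1" by simp
  have "card (?SA \<union> ?SB) < CARD('n)"
    using card_Un_le[of ?SA ?SB] 1 2 k by linarith
  then obtain x where x: "x \<noteq> 0" "\<And>y. y \<in> ?SA \<union> ?SB \<Longrightarrow> cip y x = 0"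
    using exists_orthogonal[of "?SA \<union> ?SB"] by auto
  have WA: "WA \<in> unitary_group" and WB: "WB \<in> unitary_group"
    using a b by (auto simp: spectral_basis_def)
  have "inner x (A *v x) \<le> (\<Sum>i\<in>UNIV. eig A k * (cmod (cip (column i WA) x))\<^sup>2)"
    unfolding spectral_basis_quadratic[OF A a]
  proof (rule sum_mono)
    fix i
    show "eig A (\<tau>A i) * (cmod (cip (column i WA) x))\<^sup>2 \<le> eig A k * (cmod (cip (column i WA) x))\<^sup>2"
    proof (cases "\<tau>A i \<le> k")
      case True
      then show ?thesis using spectral_basis_range[OF a] k
        by (intro mult_right_mono eig_mono[OF A]) auto
    next
      case False
      then have "cip (column i WA) x = 0" using x(2) by auto
      then show ?thesis by simp
    qed
  qed
  also have "\<dots> = eig A k * (norm x)\<^sup>2"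
    by (simp add: unitary_parseval[OF WA, of x] sum_distrib_left)
  finally have A': "inner x (A *v x) \<le> eig A k * (norm x)\<^sup>2" .
  have "eig B k * (norm x)\<^sup>2 = (\<Sum>i\<in>UNIV. eig B k * (cmod (cip (column i WB) x))\<^sup>2)"
    by (simp add: unitary_parseval[OF WB, of x] sum_distrib_left)
  also have "\<dots> \<le> inner x (B *v x)"
    unfolding spectral_basis_quadratic[OF B b]
  proof (rule sum_mono)
    fix i
    show "eig B k * (cmod (cip (column i WB) x))\<^sup>2 \<le> eig B (\<tau>B i) * (cmod (cip (column i WB) x))\<^sup>2"
    proof (cases "k \<le> \<tau>B i")
      case True
      then show ?thesis using spectral_basis_range[OF b] k
        by (intro mult_right_mono eig_mono[OF B]) auto
    next
      case False
      then have "cip (column i WB) x = 0" using x(2) by auto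
      then show ?thesis by simp
    qed
  qed
  also have "\<dots> = inner x (A *v x) + inner x ((B - A) *v x)"
    by (simp add: matrix_vector_mult_diff_rdistrib inner_diff_right)
  also have "inner x ((B - A) *v x) \<le> norm x * norm ((B - A) *v x)"
    by (rule norm_cauchy_schwarz)
  also have "\<dots> \<le> norm x * (norm (B - A) * norm x)"
    by (intro mult_left_mono norm_mult_vec_le) auto
  finally have "eig B k * (norm x)\<^sup>2 \<le> (eig A k + norm (B - A)) * (norm x)\<^sup>2"
    using A' by (simp add: algebra_simps power2_eq_square)
  then show ?thesis using x(1) by simp
qed

corollary eig_Lipschitz:
  fixes A B :: "complex^'n^'n"
  assumes "hermitian A" "hermitian B" "1 \<le> k" "k \<le> CARD('n)"
  shows "\<bar>eig B k - eig A k\<bar> \<le> norm (B - A)"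
  using Weyl_inequality[OF assms] Weyl_inequality[OF assms(2,1,3,4)] norm_minus_commute[of A B]
  by linarith

text \<open>A plane of approximate eigenvectors contains a nonzero vector orthogonal to the one
  eigenvector of index \<open>ka\<close>. All other eigenvalues are farther than
  \<open>\<epsilon>\<close> from \<open>\<mu>\<close>, so the residual of this vector exceeds the
  bound in \<open>near\<close>.\<close>

lemma two_approximate_eigenvectors:
  fixes A :: "complex^'n^'n"
  assumes A: "hermitian A" and \<epsilon>: "\<epsilon> \<ge> 0"
    and far: "\<And>k. 1 \<le> k \<Longrightarrow> k \<le> CARD('n) \<Longrightarrow> k \<noteq> ka \<Longrightarrow> \<bar>eig A k - \<mu>\<bar> > \<epsilon>"
    and near: "\<And>\<alpha> \<beta>. norm (A *v (\<alpha> *s z1 + \<beta> *s z2) - complex_of_real \<mu> *s (\<alpha> *s z1 + \<beta> *s z2))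
        \<le> \<epsilon> * norm (\<alpha> *s z1 + \<beta> *s z2)"
    and indep: "\<And>\<alpha> \<beta>. \<alpha> *s z1 + \<beta> *s z2 = 0 \<Longrightarrow> \<alpha> = 0 \<and> \<beta> = 0"
  shows False
proof -
  obtain W \<tau> where W: "spectral_basis A W \<tau>" using spectral_basis_exists[OF A] by blast
  have Wu: "W \<in> unitary_group" using W by (simp add: spectral_basis_def)
  have inj: "inj \<tau>" using W by (auto simp: spectral_basis_def bij_betw_def)
  obtain \<alpha> \<beta> where ab: "\<not> (\<alpha> = 0 \<and> \<beta> = 0)" 
    and orth: "\<And>i. \<tau> i = ka \<Longrightarrow> cip (column i W) (\<alpha> *s z1 + \<beta> *s z2) = 0"
  proof (cases "\<exists>i. \<tau> i = ka")
    case False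
    then show ?thesis using that[of 1 1] by auto
  next
    case True
    then obtain i where i: "\<tau> i = ka" by blast
    then have u: "i' = i" if "\<tau> i' = ka" for i' using that inj by (auto simp: inj_def)
    let ?a = "cip (column i W) z1" and ?b = "cip (column i W) z2"
    show ?thesis
    proof (cases "?a = 0 \<and> ?b = 0")
      case True
      then have "cip (column i' W) (1 *s z1 + 1 *s z2) = 0" if "\<tau> i' = ka" for i'
        using u[OF that] by (simp add: cip_simps)
      then show ?thesis using that[of 1 1] by auto
    next
      case False
      have "cip (column i' W) (?b *s z1 + (- ?a) *s z2) = 0" if "\<tau> i' = ka" for i'
        using u[OF that] by (simp add: cip_simps)
      then show ?thesis using that[of ?b "- ?a"] False by auto
    qed
  qed
  define z where "z = \<alpha> *s z1 + \<beta> *s z2"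
  have "z \<noteq> 0" using indep ab by (auto simp: z_def)
  then obtain i0 where i0: "cip (column i0 W) z \<noteq> 0"
    using unitary_vec_eqI[OF Wu, of z 0] by auto
  have "\<epsilon>\<^sup>2 * (norm z)\<^sup>2 = (\<Sum>i\<in>UNIV. \<epsilon>\<^sup>2 * (cmod (cip (column i W) z))\<^sup>2)"
    by (simp add: unitary_parseval[OF Wu, of z] sum_distrib_left)
  also have "\<dots> < (\<Sum>i\<in>UNIV. (eig A (\<tau> i) - \<mu>)\<^sup>2 * (cmod (cip (column i W) z))\<^sup>2)"
  proof (rule sum_strict_mono_ex1)
    have lt: "\<epsilon>\<^sup>2 < (eig A (\<tau> i) - \<mu>)\<^sup>2" if "\<tau> i \<noteq> ka" for i
      using far[of "\<tau> i"] spectral_basis_range[OF W, of i] that \<epsilon>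
      by (metis abs_of_nonneg power2_abs power_strict_mono zero_less_numeral)
    show "\<forall>i\<in>UNIV. \<epsilon>\<^sup>2 * (cmod (cip (column i W) z))\<^sup>2 \<le> (eig A (\<tau> i) - \<mu>)\<^sup>2 * (cmod (cip (column i W) z))\<^sup>2"
    proof
      fix i
      show "\<epsilon>\<^sup>2 * (cmod (cip (column i W) z))\<^sup>2 \<le> (eig A (\<tau> i) - \<mu>)\<^sup>2 * (cmod (cip (column i W) z))\<^sup>2"
        using orth[of i] lt[of i] by (cases "\<tau> i = ka") (auto simp: z_def intro!: mult_right_mono)
    qed
    have "\<tau> i0 \<noteq> ka" using i0 orth[of i0] by (auto simp: z_def)
    then have "\<epsilon>\<^sup>2 * (cmod (cip (column i0 W) z))\<^sup>2 < (eig A (\<tau> i0) - \<mu>)\<^sup>2 * (cmod (cip (column i0 W) z))\<^sup>2"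
      using lt i0 by (intro mult_strict_right_mono) auto
    then show "\<exists>i\<in>UNIV. \<epsilon>\<^sup>2 * (cmod (cip (column i W) z))\<^sup>2 < (eig A (\<tau> i) - \<mu>)\<^sup>2 * (cmod (cip (column i W) z))\<^sup>2"
      by blast
  qed simp
  also have "\<dots> = (norm (A *v z - complex_of_real \<mu> *s z))\<^sup>2"
    by (simp add: spectral_basis_residual[OF A W])
  also have "\<dots> \<le> (\<epsilon> * norm z)\<^sup>2"
    using near[of \<alpha> \<beta>] by (intro power_mono) (auto simp: z_def)
  finally show False by (simp add: power_mult_distrib)
qed

text \<open>The inserted 1 keeps the minimum meaningful when \<open>F\<close> is empty.\<close>

lemma finite_positive_lower_bound:
  fixes f :: "'a \<Rightarrow> real"
  assumes "finite F" "\<And>k. k \<in> F \<Longrightarrow> f k > 0"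
  obtains g where "g > 0" "\<And>k. k \<in> F \<Longrightarrow> g \<le> f k"
  using that[of "Min (insert 1 (f ` F))"] assms by auto

text \<open>If the compression of \<open>B\<close> to the eigenspace is a scalar \<open>a\<close>, then \<open>x + t y\<close> with
  \<open>(A - \<lambda>) y = - (B - a) x\<close> is an eigenvector of \<open>A + t B\<close> for \<open>\<lambda> + t a\<close> up to an error \<open>O(t\<^sup>2)\<close>.\<close>

lemma scalar_compression_gap:
  fixes A B :: "complex^'n^'n"
  assumes A: "hermitian A" and B: "hermitian B" and j: "1 \<le> j" "j < CARD('n)"
    and ev: "\<And>k. 1 \<le> k \<Longrightarrow> k \<le> CARD('n) \<Longrightarrow> eig A k = l \<longleftrightarrow> k = j \<or> k = j + 1"
    and scalar: "\<And>x y. A *v x = complex_of_real l *s x \<Longrightarrow> A *v y = complex_of_real l *s y \<Longrightarrow>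
        cip x (B *v y) = complex_of_real a * cip x y"
  obtains C \<delta> where "\<delta> > 0" 
    "\<And>t. 0 < t \<Longrightarrow> t < \<delta> \<Longrightarrow> eig (A + t *\<^sub>R B) (j + 1) - eig (A + t *\<^sub>R B) j \<le> C * t\<^sup>2"
proof -
  obtain W \<tau> where W: "spectral_basis A W \<tau>" using spectral_basis_exists[OF A] by blast
  have Wu: "W \<in> unitary_group" using W by (simp add: spectral_basis_def)
  have onb: "cip (column i W) (column i' W) = (if i = i' then 1 else 0)" for i i'
    using Wu by (simp add: unitary_iff_columns)
  obtain p where p: "\<tau> p = j" "\<And>i. \<tau> i = j \<Longrightarrow> i = p"
    using spectral_basis_index[OF W, of j] j by auto
  obtain q where q: "\<tau> q = j + 1" "\<And>i. \<tau> i = j + 1 \<Longrightarrow> i = q"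
    using spectral_basis_index[OF W, of "j + 1"] j by auto
  have pq: "p \<noteq> q" using p(1) q(1) by auto
  have ev': "eig A (\<tau> i) = l \<longleftrightarrow> i = p \<or> i = q" for i
    using ev[OF spectral_basis_range[OF W, of i]] p q by metis
  \<comment> \<open>Coordinates of \<open>y r\<close> in the eigenbasis: the equation for
    \<open>y r\<close> is solved by division by the spectral gaps. At \<open>p\<close> and
    \<open>q\<close>, where A - l vanishes, the coordinate is free and set to 0; the equation is
    solvable there because the compression is scalar.\<close>
  define co where "co r = (\<chi> i. if i = p \<or> i = q then 0 else
      - cip (column i W) (B *v column r W) / complex_of_real (eig A (\<tau> i) - l))" for r
  define y where "y r = W *v co r" for r
  have cy: "cip (column i W) (y r) = co r $ i" for i r
  proof -
    have "cip (column i W) (y r) = (mat_adj W *v (W *v co r)) $ i"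
      by (simp add: y_def matrix_vector_mult_def cip_def column_def)
    then show ?thesis by (simp add: matrix_vector_mul_assoc unitary_left[OF Wu])
  qed
  have ex: "A *v column r W = complex_of_real l *s column r W" if "r = p \<or> r = q" for r
    using spectral_basis_eigen[OF W, of r] ev'[of r] that by simp
  have solve: "A *v y r - complex_of_real l *s y r = complex_of_real a *s column r W - B *v column r W"
    if r: "r = p \<or> r = q" for r
  proof (rule unitary_vec_eqI[OF Wu])
    fix i
    show "cip (column i W) (A *v y r - complex_of_real l *s y r) =
      cip (column i W) (complex_of_real a *s column r W - B *v column r W)"
    proof (cases "i = p \<or> i = q")
      case True
      then show ?thesis using ev'[of i] scalar[OF ex[of i] ex[OF r]] 
        by (simp add: cip_simps spectral_basis_cip_mult[OF A W] cy)
    next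
      case False
      then have "complex_of_real (eig A (\<tau> i) - l) * co r $ i = - cip (column i W) (B *v column r W)"
        using ev'[of i] by (simp add: co_def del: of_real_diff)
      moreover have "i \<noteq> r" using False r by auto
      ultimately show ?thesis
        by (simp add: cip_simps spectral_basis_cip_mult[OF A W] cy onb algebra_simps)
    qed
  qed
  define K where "K = (norm B + \<bar>a\<bar>) * (norm (y p) + norm (y q))"
  have K: "K \<ge> 0" by (simp add: K_def)
  have "finite {k. 1 \<le> k \<and> k \<le> CARD('n) \<and> k \<noteq> j \<and> k \<noteq> j + 1}"
    by (rule finite_subset[of _ "{1..CARD('n)}"]) auto
  then obtain g where g: "g > 0" 
    "\<And>k. 1 \<le> k \<Longrightarrow> k \<le> CARD('n) \<Longrightarrow> k \<noteq> j \<Longrightarrow> k \<noteq> j + 1 \<Longrightarrow> g \<le> \<bar>eig A k - l\<bar>"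
    by (rule finite_positive_lower_bound[where f = "\<lambda>k. \<bar>eig A k - l\<bar>"]) (use ev in auto)
  \<comment> \<open>For t below this bound, the drift t |B| of the remaining eigenvalues, the drift
    t |a| of the centre \<open>\<mu>\<close> and the window 2 K t^2 together stay below the gap
    \<open>g\<close>. The minimum with 1 allows t^2 to be estimated by t.\<close>
  define \<delta> where "\<delta> = min 1 (g / (norm B + \<bar>a\<bar> + 2 * K + 1))"
  have den: "norm B + \<bar>a\<bar> + 2 * K + 1 > 0" using K by (smt (verit) norm_ge_zero)
  have \<delta>: "\<delta> > 0" using g den by (simp add: \<delta>_def)
  have main: "eig (A + t *\<^sub>R B) (j + 1) - eig (A + t *\<^sub>R B) j \<le> (4 * K) * t\<^sup>2" if t: "0 < t" "t < \<delta>" for t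
  proof -
    define A' where "A' = A + t *\<^sub>R B"
    define \<mu> where "\<mu> = l + t * a"
    define \<epsilon> where "\<epsilon> = 2 * K * t\<^sup>2"
    have A': "hermitian A'" using A B by (simp add: A'_def hermitian_def mat_adj_add mat_adj_scaleR)
    have \<epsilon>: "\<epsilon> \<ge> 0" using K by (simp add: \<epsilon>_def)
    have "t < 1" "t < g / (norm B + \<bar>a\<bar> + 2 * K + 1)" using t by (auto simp: \<delta>_def)
    then have "t * (norm B + \<bar>a\<bar> + 2 * K + 1) < g" using den by (simp add: pos_less_divide_eq)
    moreover have "2 * K * t\<^sup>2 \<le> 2 * K * t"
      using K t \<open>t < 1\<close> by (intro mult_left_mono) (auto simp: power2_eq_square mult_le_one)
    ultimately have gt: "t * norm B + t * \<bar>a\<bar> + \<epsilon> < g"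
      using t by (simp add: \<epsilon>_def algebra_simps)
    have far: "\<bar>eig A' k - \<mu>\<bar> > \<epsilon>" if "1 \<le> k" "k \<le> CARD('n)" "k \<noteq> j" "k \<noteq> j + 1" for k
    proof -
      have "\<bar>eig A' k - eig A k\<bar> \<le> t * norm B"
        using eig_Lipschitz[OF A A' that(1,2)] t by (simp add: A'_def)
      moreover have "\<bar>t * a\<bar> = t * \<bar>a\<bar>" using t by (simp add: abs_mult)
      ultimately show ?thesis using g(2)[OF that] gt unfolding \<mu>_def by linarith
    qed
    define z where "z r = column r W + complex_of_real t *s y r" for r
    have res1: "A' *v z r - complex_of_real \<mu> *s z r = 
        complex_of_real (t\<^sup>2) *s (B *v y r - complex_of_real a *s y r)" if r: "r = p \<or> r = q" for r
    proof -
      have "A' *v z r - complex_of_real \<mu> *s z r =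
        (A *v column r W - complex_of_real l *s column r W)
        + complex_of_real t *s (B *v column r W - complex_of_real a *s column r W
            + (A *v y r - complex_of_real l *s y r))
        + complex_of_real (t\<^sup>2) *s (B *v y r - complex_of_real a *s y r)"
        unfolding A'_def z_def \<mu>_def
        by (simp add: vec_eq_iff matrix_vector_right_distrib matrix_vector_mult_add_rdistrib
            scaleR_eq_cmat_scale cmat_scale_mult_vec mult_vec_scale algebra_simps power2_eq_square)
      then show ?thesis using solve[OF r] ex[OF r] by (simp add: algebra_simps)
    qed
    \<comment> \<open>Since \<open>y p\<close> and \<open>y q\<close> have no component along the
      columns \<open>p\<close> and \<open>q\<close>, the coefficients of a combination of
      \<open>z p\<close> and \<open>z q\<close> can be read off. This gives independence and bounds
      the coefficients by the norm.\<close>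
    have comp: "cip (column p W) (\<alpha> *s z p + \<beta> *s z q) = \<alpha>" "cip (column q W) (\<alpha> *s z p + \<beta> *s z q) = \<beta>" for \<alpha> \<beta>
      using pq by (simp_all add: z_def cip_simps cy onb co_def)
    have nz: "cmod \<alpha> \<le> norm (\<alpha> *s z p + \<beta> *s z q)" "cmod \<beta> \<le> norm (\<alpha> *s z p + \<beta> *s z q)" for \<alpha> \<beta>
    proof -
      have "(cmod (cip (column i W) v))\<^sup>2 \<le> (norm v)\<^sup>2" for i v
        unfolding unitary_parseval[OF Wu, of v] by (rule member_le_sum) auto
      then have "cmod (cip (column i W) v) \<le> norm v" for i v by (rule power2_le_imp_le) auto
      from this[of p "\<alpha> *s z p + \<beta> *s z q"] this[of q "\<alpha> *s z p + \<beta> *s z q"]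
      show "cmod \<alpha> \<le> norm (\<alpha> *s z p + \<beta> *s z q)" "cmod \<beta> \<le> norm (\<alpha> *s z p + \<beta> *s z q)"
        by (simp_all add: comp)
    qed
    have near: "norm (A' *v (\<alpha> *s z p + \<beta> *s z q) - complex_of_real \<mu> *s (\<alpha> *s z p + \<beta> *s z q))
        \<le> \<epsilon> * norm (\<alpha> *s z p + \<beta> *s z q)" for \<alpha> \<beta>
    proof -
      define N where "N = norm (\<alpha> *s z p + \<beta> *s z q)"
      have Br: "norm (B *v y r - complex_of_real a *s y r) \<le> (norm B + \<bar>a\<bar>) * norm (y r)" for r
      proof -
        have "norm (B *v y r - complex_of_real a *s y r) \<le> norm (B *v y r) + norm (complex_of_real a *s y r)"
          by (rule norm_triangle_ineq4)
        also have "\<dots> \<le> norm B * norm (y r) + \<bar>a\<bar> * norm (y r)"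
          using norm_mult_vec_le[of B "y r"] by (simp add: norm_scale_vec)
        finally show ?thesis by (simp add: algebra_simps)
      qed
      have "A' *v (\<alpha> *s z p + \<beta> *s z q) - complex_of_real \<mu> *s (\<alpha> *s z p + \<beta> *s z q)
        = \<alpha> *s (A' *v z p - complex_of_real \<mu> *s z p) + \<beta> *s (A' *v z q - complex_of_real \<mu> *s z q)"
        by (simp add: vec_eq_iff matrix_vector_right_distrib mult_vec_scale algebra_simps)
      also have "norm \<dots> \<le> cmod \<alpha> * norm (A' *v z p - complex_of_real \<mu> *s z p) + cmod \<beta> * norm (A' *v z q - complex_of_real \<mu> *s z q)"
        by (metis norm_scale_vec norm_triangle_ineq)
      also have "\<dots> = t\<^sup>2 * (cmod \<alpha> * norm (B *v y p - complex_of_real a *s y p) + cmod \<beta> * norm (B *v y q - complex_of_real a *s y q))"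
        unfolding res1[OF disjI1[OF refl]] res1[OF disjI2[OF refl]] norm_scale_vec norm_of_real abs_power2
        by (simp only: distrib_left mult_ac)
      also have "\<dots> \<le> t\<^sup>2 * (N * ((norm B + \<bar>a\<bar>) * norm (y p)) + N * ((norm B + \<bar>a\<bar>) * norm (y q)))"
        using nz(1)[of \<alpha> \<beta>] nz(2)[of \<beta> \<alpha>] Br[of p] Br[of q] unfolding N_def
        by (intro mult_left_mono add_mono mult_mono) auto
      also have "\<dots> = K * t\<^sup>2 * N" by (simp add: K_def algebra_simps)
      also have "\<dots> \<le> 2 * K * t\<^sup>2 * N"
        using K by (intro mult_right_mono) (auto simp: N_def)
      finally show ?thesis by (simp add: \<epsilon>_def N_def)
    qed
    have indep: "\<alpha> = 0 \<and> \<beta> = 0" if "\<alpha> *s z p + \<beta> *s z q = 0" for \<alpha> \<beta>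
      using nz(1)[of \<alpha> \<beta>] nz(2)[of \<beta> \<alpha>] that by auto
    \<comment> \<open>If one of the two eigenvalues left the window, only the other index
      \<open>ka\<close> could remain in it, too few for the plane spanned by \<open>z p\<close> and
      \<open>z q\<close>. Two values within \<open>\<epsilon>\<close> of \<open>\<mu>\<close> differ
      by at most 2 \<epsilon> = 4 K t^2.\<close>
    have close: "\<bar>eig A' k0 - \<mu>\<bar> \<le> \<epsilon>" if "k0 = j \<or> k0 = j + 1" for k0
    proof (rule ccontr)
      assume n: "\<not> \<bar>eig A' k0 - \<mu>\<bar> \<le> \<epsilon>"
      define ka where "ka = (if k0 = j then j + 1 else j)"
      have "\<epsilon> < \<bar>eig A' k - \<mu>\<bar>" if "1 \<le> k" "k \<le> CARD('n)" "k \<noteq> ka" for k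
        using n far[OF that(1,2)] that(3) \<open>k0 = j \<or> k0 = j + 1\<close>
        by (cases "k = k0") (auto simp: ka_def split: if_splits)
      then show False
        by (rule two_approximate_eigenvectors[OF A' \<epsilon> _ near indep])
    qed
    from close[of j] close[of "j + 1"] show ?thesis
      by (simp add: A'_def[symmetric] \<epsilon>_def)
  qed
  show thesis by (rule that[OF \<delta> main])
qed

text \<open>An eigenvector for \<open>l\<close> has only the coordinates \<open>p\<close> and
  \<open>q\<close> in the eigenbasis, so the claim lives in a complex plane. The remainder
  \<open>f\<close>, orthogonal to \<open>x\<close> and \<open>y\<close>, vanishes because the
  coordinate determinant \<open>D\<close> of \<open>x\<close> and \<open>y\<close> is
  nonzero.\<close>

lemma two_dim_eigenspace:
  fixes A :: "complex^'n^'n"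
  assumes A: "hermitian A" and j: "1 \<le> j" "j < CARD('n)"
    and ev: "\<And>k. 1 \<le> k \<Longrightarrow> k \<le> CARD('n) \<Longrightarrow> eig A k = l \<longleftrightarrow> k = j \<or> k = j + 1"
    and x: "A *v x = complex_of_real l *s x" and y: "A *v y = complex_of_real l *s y" 
    and xy: "cip x x = 1" "cip y y = 1" "cip x y = 0"
    and e: "A *v e = complex_of_real l *s e"
  shows "e = cip x e *s x + cip y e *s y"
proof -
  obtain W \<tau> where W: "spectral_basis A W \<tau>" using spectral_basis_exists[OF A] by blast
  have Wu: "W \<in> unitary_group" using W by (simp add: spectral_basis_def)
  obtain p where p: "\<tau> p = j" "\<And>i. \<tau> i = j \<Longrightarrow> i = p"
    using spectral_basis_index[OF W, of j] j by auto
  obtain q where q: "\<tau> q = j + 1" "\<And>i. \<tau> i = j + 1 \<Longrightarrow> i = q"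
    using spectral_basis_index[OF W, of "j + 1"] j by auto
  have pq: "p \<noteq> q" using p(1) q(1) by auto
  define c where "c i z = cip (column i W) z" for i z
  have c0: "c i z = 0" if "A *v z = complex_of_real l *s z" "i \<noteq> p" "i \<noteq> q" for i z
  proof -
    have "eig A (\<tau> i) \<noteq> l" using ev[OF spectral_basis_range[OF W, of i]] p(2) q(2) that(2,3) by blast
    moreover have "eig A (\<tau> i) * c i z = l * c i z"
      using spectral_basis_cip_mult[OF A W, of i z] by (auto simp: that(1) cip_simps c_def)
    ultimately show ?thesis by simp
  qed
  have ip: "cip u v = cnj (c p u) * c p v + cnj (c q u) * c q v" 
    if "A *v u = complex_of_real l *s u" for u v
  proof -
    have "cip u v = (\<Sum>i\<in>{p, q}. cnj (c i u) * c i v)"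
      unfolding unitary_cip_expand[OF Wu, of u v] c_def[symmetric]
      by (rule sum.mono_neutral_right) (use c0[OF that] in auto)
    then show ?thesis using pq by simp
  qed
  define f where "f = e - cip x e *s x - cip y e *s y"
  have fE: "A *v f = complex_of_real l *s f"
    by (simp add: f_def matrix_vector_mult_diff_distrib mult_vec_scale x y e vec_eq_iff algebra_simps)
  have yx: "cip y x = 0" using xy cip_commute_eq_0 by blast
  have xf: "cip x f = 0" "cip y f = 0" by (simp_all add: f_def cip_simps xy yx)
  have a: "cnj (c p x) * c p f + cnj (c q x) * c q f = 0"
    "cnj (c p y) * c p f + cnj (c q y) * c q f = 0"
    "cnj (c p x) * c p y + cnj (c q x) * c q y = 0"
    using ip[OF x, of f] ip[OF y, of f] ip[OF x, of y] xf xy by simp_all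
  define D where "D = cnj (c p x) * cnj (c q y) - cnj (c q x) * cnj (c p y)"
  have "D * c p f = 0" "D * c q f = 0" using a(1,2) unfolding D_def by algebra+
  moreover have "D \<noteq> 0"
  proof
    assume D: "D = 0"
    then have D': "c p x * c q y - c q x * c p y = 0"
      using arg_cong[OF D[unfolded D_def], of cnj]
      by (simp only: complex_cnj_diff complex_cnj_mult complex_cnj_cnj complex_cnj_zero)
    have "c p y * cip x x = 0" "c q y * cip x x = 0"
      unfolding ip[OF x, of x] using a(3) D' by algebra+
    then have "cip y y = 0" using ip[OF y, of y] xy by simp
    then show False using xy by simp
  qed
  ultimately have "cip f f = 0" using ip[OF fE, of f] by simp
  then have "f = 0" by simp
  then show ?thesis by (simp add: f_def algebra_simps)
qed

section \<open>Conically connected families\<close>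

text \<open>The assumption of at least two controls enters the argument through this lemma alone:
  one real condition on the direction can always be met.\<close>

lemma functional_kernel_nontrivial:
  fixes f :: "real^'m \<Rightarrow> real"
  assumes "linear f" "CARD('m) \<ge> 2"
  obtains v where "v \<noteq> 0" "f v = 0"
proof -
  obtain i k :: 'm where ik: "i \<noteq> k"
    using assms(2) card_le_Suc0_iff_eq[of "UNIV :: 'm set"] by auto
  show thesis
  proof (cases "f (axis i 1) = 0")
    case True
    then show ?thesis using that[of "axis i 1"] by simp
  next
    case False
    let ?v = "f (axis k 1) *\<^sub>R axis i 1 - f (axis i 1) *\<^sub>R axis k (1::real)"
    have "?v $ k = - f (axis i 1)" using ik by (simp add: axis_def)
    then have "?v \<noteq> 0" using False by (metis neg_equal_0_iff_equal zero_index)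
    moreover have "f ?v = 0"
      using assms(1) by (simp add: linear_diff linear_scale)
    ultimately show ?thesis using that by blast
  qed
qed

locale conical_family =
  fixes H0 :: "complex^'n^'n" and Hs :: "'m::finite \<Rightarrow> complex^'n^'n" and U :: "(real^'m) set"
  assumes n2: "CARD('n) \<ge> 2" and m2: "CARD('m) \<ge> 2"
    and U_open: "open U" and U_conn: "connected U"
    and herm0: "hermitian H0" and herm: "\<And>k. hermitian (Hs k)"
    and conic: "conically_connected (\<lambda>u. H0 + (\<Sum>k\<in>UNIV. (u$k) *\<^sub>R Hs k)) U"
begin

definition dH :: "real^'m \<Rightarrow> complex^'n^'n" where
  "dH v = (\<Sum>k\<in>UNIV. (v$k) *\<^sub>R Hs k)"

definition H :: "real^'m \<Rightarrow> complex^'n^'n" where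
  "H u = H0 + dH u"

lemma linear_dH: "linear dH"
  by (rule linearI) (simp_all add: dH_def scaleR_add_left sum.distrib scaleR_sum_right)

lemma H_add: "H (u + t *\<^sub>R v) = H u + t *\<^sub>R dH v"
  by (simp add: H_def linear_add[OF linear_dH] linear_scale[OF linear_dH])

lemma hermitian_dH: "hermitian (dH v)"
proof -
  have "mat_adj (\<Sum>k\<in>K. (v$k) *\<^sub>R Hs k) = (\<Sum>k\<in>K. (v$k) *\<^sub>R Hs k)" for K
    by (induction K rule: infinite_finite_induct)
       (use herm in \<open>auto simp: mat_adj_add mat_adj_scaleR hermitian_def\<close>)
  then show ?thesis by (simp add: hermitian_def dH_def)
qed

lemma hermitian_H: "hermitian (H u)"
  using herm0 hermitian_dH[of u] by (simp add: hermitian_def H_def mat_adj_add)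

lemma conic_H: "conically_connected H U"
  using conic by (simp add: H_def[abs_def] dH_def)

lemma continuous_on_H: "continuous_on S H"
  unfolding H_def using linear_continuous_on[OF linear_conv_bounded_linear[THEN iffD1, OF linear_dH]]
  by (intro continuous_intros)

lemma continuous_on_eig_H:
  assumes "1 \<le> k" "k \<le> CARD('n)"
  shows "continuous_on UNIV (\<lambda>u. eig (H u) k)"
  unfolding continuous_on_iff
proof (intro ballI allI impI)
  fix u e assume "(e::real) > 0"
  then obtain d where d: "d > 0" "\<And>u'. dist u' u < d \<Longrightarrow> dist (H u') (H u) < e"
    using continuous_on_H[of UNIV] unfolding continuous_on_iff by (metis UNIV_I)
  have "dist (eig (H u') k) (eig (H u) k) < e" if "dist u' u < d" for u'
    using eig_Lipschitz[OF hermitian_H[of u] hermitian_H[of u'] assms] d(2)[OF that]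
    by (simp add: dist_norm)
  with d(1) show "\<exists>d>0. \<forall>x'\<in>UNIV. dist x' u < d \<longrightarrow> dist (eig (H x') k) (eig (H u) k) < e"
    by blast
qed

lemma intersection_conical:
  assumes "u \<in> U" "1 \<le> j" "j < CARD('n)" "eig (H u) j = eig (H u) (j + 1)"
  shows "conical_intersection H U u j"
  using conic_H assms by (auto simp: conically_connected_def)

lemma conical_multiplicity:
  assumes c: "conical_intersection H U u j" and k: "1 \<le> k" "k \<le> CARD('n)"
  shows "eig (H u) k = eig (H u) j \<longleftrightarrow> k = j \<or> k = j + 1"
proof -
  let ?F = "{k \<in> {1..CARD('n)}. eig (H u) k = eig (H u) j}"
  have j: "1 \<le> j" "j < CARD('n)" "eig (H u) j = eig (H u) (j + 1)" 
    and "eig_mult (H u) (eig (H u) j) = 2"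
    using c by (auto simp: conical_intersection_def)
  then have "card ?F = 2" by (simp add: eig_mult_eq_card[OF hermitian_H])
  moreover have sub: "{j, j + 1} \<subseteq> ?F" using j by auto
  ultimately have "{j, j + 1} = ?F" by (intro card_subset_eq) auto
  then show ?thesis using k by (auto simp: set_eq_iff)
qed

text \<open>If \<open>dH v\<close> acted as a scalar on the double eigenspace, the two eigenvalues
  would separate only like t^2 along \<open>v\<close>, against the linear opening of the cone. This
  is the sole consequence of the linear opening used afterwards.\<close>

lemma conical_nonscalar:
  assumes c: "conical_intersection H U u j" and v: "v \<noteq> 0"
    and x: "H u *v x = complex_of_real (eig (H u) j) *s x"
    and y: "H u *v y = complex_of_real (eig (H u) j) *s y"
    and xy: "cip x x = 1" "cip y y = 1" "cip x y = 0"
  shows "\<not> (cip x (dH v *v y) = 0 \<and> cip x (dH v *v x) = cip y (dH v *v y))"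
proof
  assume s: "cip x (dH v *v y) = 0 \<and> cip x (dH v *v x) = cip y (dH v *v y)"
  let ?l = "eig (H u) j"
  define w where "w = (1 / norm v) *\<^sub>R v"
  have w: "norm w = 1" using v by (simp add: w_def)
  define B where "B = dH w"
  have Bv: "B = (1 / norm v) *\<^sub>R dH v" by (simp add: B_def w_def linear_scale[OF linear_dH])
  have hB: "hermitian B" by (simp add: B_def hermitian_dH)
  have Bz: "cip a (B *v b) = complex_of_real (1 / norm v) * cip a (dH v *v b)" for a b
    by (simp add: Bv scaleR_eq_cmat_scale cmat_scale_mult_vec cip_simps)
  define \<alpha> where "\<alpha> = Re (cip x (B *v x))"
  have "cnj (cip x (B *v x)) = cip x (B *v x)"
    by (simp add: cnj_cip hermitian_cip[OF hB])
  then have ax: "cip x (B *v x) = complex_of_real \<alpha>"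
    unfolding \<alpha>_def by (metis Reals_cnj_iff of_real_Re)
  have ay: "cip y (B *v y) = complex_of_real \<alpha>" using s ax by (simp add: Bz)
  have bxy: "cip x (B *v y) = 0" using s by (simp add: Bz)
  have byx: "cip y (B *v x) = 0"
    using bxy cnj_cip[of x "B *v y"] by (simp add: hermitian_cip[OF hB])
  have yx: "cip y x = 0" using xy cip_commute_eq_0 by blast
  have j: "1 \<le> j" "j < CARD('n)" using c by (auto simp: conical_intersection_def)
  have scalar: "cip e (B *v f) = complex_of_real \<alpha> * cip e f"
    if e: "H u *v e = complex_of_real ?l *s e" and f: "H u *v f = complex_of_real ?l *s f" for e f
  proof -
    have e': "e = cip x e *s x + cip y e *s y" and f': "f = cip x f *s x + cip y f *s y"
      using two_dim_eigenspace[OF hermitian_H j conical_multiplicity[OF c] x y xy] e f by auto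
    define e1 e2 f1 f2 where "e1 = cip x e" "e2 = cip y e" "f1 = cip x f" "f2 = cip y f"
    have e'': "e = e1 *s x + e2 *s y" and f'': "f = f1 *s x + f2 *s y"
      using e' f' by (simp_all add: e1_e2_f1_f2_def)
    show ?thesis
      unfolding e'' f'' 
      by (simp add: matrix_vector_right_distrib mult_vec_scale cip_simps ax ay bxy byx xy yx algebra_simps)
  qed
  obtain C \<delta> where \<delta>: "\<delta> > 0" 
    "\<And>t. 0 < t \<Longrightarrow> t < \<delta> \<Longrightarrow> eig (H u + t *\<^sub>R B) (j + 1) - eig (H u + t *\<^sub>R B) j \<le> C * t\<^sup>2"
    using scalar_compression_gap[OF hermitian_H hB j conical_multiplicity[OF c] scalar] by blast
  obtain c0 \<delta>' where c0: "c0 > 0" "\<delta>' > 0" 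
    "\<And>t. 0 < t \<Longrightarrow> t < \<delta>' \<Longrightarrow> eig (H (u + t *\<^sub>R w)) (j + 1) - eig (H (u + t *\<^sub>R w)) j > c0 * t"
    using c w unfolding conical_intersection_def by blast
  \<comment> \<open>Nothing is known about the sign of \<open>C\<close>, hence the denominator with
    its absolute value plus 1.\<close>
  have "0 < min (min \<delta> \<delta>') (c0 / (\<bar>C\<bar> + 1))"
    using \<delta>(1) c0(1,2) by (simp add: add_nonneg_pos)
  then obtain t where t: "0 < t" "t < \<delta>" "t < \<delta>'" "t < c0 / (\<bar>C\<bar> + 1)"
    using dense[of 0 "min (min \<delta> \<delta>') (c0 / (\<bar>C\<bar> + 1))"] by auto
  have "c0 * t < C * t\<^sup>2"
    using \<delta>(2)[OF t(1,2)] c0(3)[OF t(1,3)] unfolding H_add B_def by linarith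
  then have "c0 < C * t" using t(1) by (simp add: power2_eq_square)
  moreover have "C * t \<le> (\<bar>C\<bar> + 1) * t" using t(1) by (intro mult_right_mono) auto
  moreover have "(\<bar>C\<bar> + 1) * t < c0" using t(4) by (simp add: field_simps)
  ultimately show False by linarith
qed

text \<open>Conicity speaks of consecutive indices. Two orthogonal eigenvectors give some second
  index with the same eigenvalue, and sortedness squeezes the eigenvalues in between, so a neighbour
  of \<open>k\<close> on that side shares it.\<close>

lemma eigenvalue_repeated:
  assumes k: "1 \<le> k" "k \<le> CARD('n)"
    and x: "H u *v x = complex_of_real (eig (H u) k) *s x" "x \<noteq> 0"
    and y: "H u *v y = complex_of_real (eig (H u) k) *s y" "y \<noteq> 0"
    and xy: "cip x y = 0"
  obtains j where "1 \<le> j" "j < CARD('n)" "eig (H u) j = eig (H u) (j + 1)" "eig (H u) j = eig (H u) k"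
proof -
  obtain W \<tau> where W: "spectral_basis (H u) W \<tau>"
    using spectral_basis_exists[OF hermitian_H] by blast
  have Wu: "W \<in> unitary_group" using W by (simp add: spectral_basis_def)
  obtain p where p: "\<tau> p = k" "\<And>i. \<tau> i = k \<Longrightarrow> i = p" using spectral_basis_index[OF W k] by blast
  have "\<exists>i. i \<noteq> p \<and> eig (H u) (\<tau> i) = eig (H u) k"
  proof (rule ccontr)
    assume n: "\<not> (\<exists>i. i \<noteq> p \<and> eig (H u) (\<tau> i) = eig (H u) k)"
    have line: "z = cip (column p W) z *s column p W" 
      if z: "H u *v z = complex_of_real (eig (H u) k) *s z" for z
    proof -
      have "cip (column i W) z = 0" if "i \<noteq> p" for i
        using spectral_basis_cip_mult[OF hermitian_H W, of i z] n that by (auto simp: z cip_simps)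
      then have "cip (column i W) z *s column i W = 0" if "i \<in> UNIV - {p}" for i using that by simp
      then show ?thesis
        using unitary_expand[OF Wu, of z]
        by (metis (no_types, lifting) UNIV_I finite sum.neutral sum.remove add.right_neutral)
    qed
    have "cip x y = cnj (cip (column p W) x) * cip (column p W) y"
      using Wu arg_cong2[OF line[OF x(1)] line[OF y(1)], of cip]
      by (simp add: cip_simps unitary_iff_columns)
    moreover have "cip (column p W) x \<noteq> 0" "cip (column p W) y \<noteq> 0"
      using line[OF x(1)] line[OF y(1)] x(2) y(2) by auto
    ultimately show False using xy by simp
  qed
  then obtain i where i: "i \<noteq> p" "eig (H u) (\<tau> i) = eig (H u) k" by blast
  define k' where "k' = \<tau> i"
  have k': "1 \<le> k'" "k' \<le> CARD('n)" "k' \<noteq> k" "eig (H u) k' = eig (H u) k"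
    using spectral_basis_range[OF W, of i] i p(2)[of i] by (auto simp: k'_def)
  show thesis
  proof (cases "k' < k")
    case True
    have "eig (H u) k' \<le> eig (H u) (k - 1)" "eig (H u) (k - 1) \<le> eig (H u) k"
      by (rule eig_mono[OF hermitian_H]; use True k k' in linarith)+
    then show ?thesis using that[of "k - 1"] k k' True by auto
  next
    case False
    then have "k < k'" using k' by simp
    have "eig (H u) k \<le> eig (H u) (k + 1)" "eig (H u) (k + 1) \<le> eig (H u) k'"
      by (rule eig_mono[OF hermitian_H]; use \<open>k < k'\<close> k k' in linarith)+
    then show ?thesis using that[of k] k k' \<open>k < k'\<close> by auto
  qed
qed

lemma shift_mem:
  assumes "u \<in> U" obtains t where "t > 0" "u + t *\<^sub>R v \<in> U"
proof -
  obtain e where e: "e > 0" "ball u e \<subseteq> U" using U_open openE assms by blast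
  obtain t where t: "t > 0" "t * norm v < e"
  proof (cases "v = 0")
    case True
    then show ?thesis using that[of 1] e by simp
  next
    case False
    then show ?thesis using that[of "e / (2 * norm v)"] e by simp
  qed
  then have "u + t *\<^sub>R v \<in> U" using e(2) by (auto simp: subset_iff dist_norm)
  then show thesis using that t(1) by blast
qed

text \<open>The difference of the commutation relations at \<open>u\<close> and at a nearby point in
  direction \<open>v\<close> isolates the linear part of the family.\<close>

lemma commute_dH:
  assumes u: "u \<in> U" and comm: "\<And>u. u \<in> U \<Longrightarrow> P ** H u = H u ** P"
  shows "P ** dH v = dH v ** P"
proof -
  obtain t where t: "t > 0" "u + t *\<^sub>R v \<in> U" using shift_mem[OF u] by blast
  from comm[OF t(2)] comm[OF u] show ?thesis
    using t(1) by (simp add: H_add matrix_ring_simps)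
qed

theorem irreducible:
  assumes P: "P ** P = P" "hermitian P" and comm: "\<And>u. u \<in> U \<Longrightarrow> P ** H u = H u ** P"
  shows "P = 0 \<or> P = mat 1"
proof -
  obtain u0 where u0: "u0 \<in> U" using conic_H n2 unfolding conically_connected_def by force
  have PH: "H u *v (P *v x) = P *v (H u *v x)" if "u \<in> U" for u x
    using comm[OF that] by (simp add: matrix_vector_mul_assoc)
  have PP: "P *v (P *v x) = P *v x" for x using P(1) by (simp add: matrix_vector_mul_assoc)
  \<comment> \<open>The parameters at which some unit eigenvector for the k-th eigenvalue is killed
    by \<open>Q\<close>. With \<open>Q\<close> being \<open>P\<close> or its complement, these are
    the two alternatives for the k-th eigenspace. Unit vectors form a compact set, so the
    existential quantifier preserves closedness.\<close>
  define C where "C Q k = {u. \<exists>x. x \<in> sphere 0 1 \<and> H u *v x = complex_of_real (eig (H u) k) *s x \<and> Q *v x = 0}" 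
    for Q :: "complex^'n^'n" and k
  have closed_C: "closed (C Q k)" if k: "1 \<le> k" "k \<le> CARD('n)" for Q k
  proof -
    let ?T = "{(x, u). H u *v x = complex_of_real (eig (H u) k) *s x} \<inter> {(x, u). Q *v x = 0}"
    have cH: "continuous_on UNIV (\<lambda>z::(complex^'n)\<times>(real^'m). H (snd z))"
      by (rule continuous_on_compose2[OF continuous_on_H[of UNIV]]) (auto intro: continuous_intros)
    have ce: "continuous_on UNIV (\<lambda>z::(complex^'n)\<times>(real^'m). eig (H (snd z)) k)"
      by (rule continuous_on_compose2[OF continuous_on_eig_H[OF k]]) (auto intro: continuous_intros)
    have eq: "{(x, u). H u *v x = complex_of_real (eig (H u) k) *s x} =
        {z. H (snd z) *v fst z = eig (H (snd z)) k *\<^sub>R fst z}"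
      by (auto simp: scaleR_eq_smult)
    have "closed ?T"
    proof (rule closed_Int)
      show "closed {(x, u). H u *v x = complex_of_real (eig (H u) k) *s x}"
        unfolding eq by (intro closed_Collect_eq mv.continuous_on cH continuous_on_scaleR ce
            continuous_on_fst continuous_on_id)
      have "closed {z::(complex^'n)\<times>(real^'m). Q *v fst z = 0}"
        by (intro closed_Collect_eq mv.continuous_on continuous_on_const continuous_on_fst continuous_on_id)
      then show "closed {(x, u::real^'m). Q *v x = 0}" by (simp add: case_prod_unfold)
    qed
    from closed_compact_projection[OF compact_sphere[of 0 1] this]
    show ?thesis unfolding C_def by simp
  qed
  have normalize: "u \<in> C Q k" 
    if x: "x \<noteq> 0" "H u *v x = complex_of_real (eig (H u) k) *s x" "Q *v x = 0" for u Q k x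
    unfolding C_def mem_Collect_eq
    by (rule exI[of _ "complex_of_real (1 / norm x) *s x"])
       (use x in \<open>simp add: norm_scale_vec norm_divide mult_vec_scale vector_smult_assoc mult.commute\<close>)
  let ?R = "mat 1 - P"
  have R: "?R *v x = x - P *v x" for x by (simp add: matrix_vector_mult_diff_rdistrib)
  \<comment> \<open>With \<open>x\<close> in the kernel and \<open>y\<close> in the range of
    \<open>P\<close> for the same eigenvalue, the point is a conical intersection. Every
    \<open>dH v\<close> commutes with \<open>P\<close>, so its off-diagonal entry vanishes, and some
    nonzero \<open>v\<close> equalizes the diagonal entries: a scalar compression, contrary to
    \<open>conical_nonscalar\<close>.\<close>
  have disj: "C P k \<inter> C ?R k \<inter> U = {}" if k: "1 \<le> k" "k \<le> CARD('n)" for k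
  proof (rule ccontr)
    assume "C P k \<inter> C ?R k \<inter> U \<noteq> {}"
    then obtain u x y where u: "u \<in> U" 
      and x: "norm x = 1" "H u *v x = complex_of_real (eig (H u) k) *s x" "P *v x = 0"
      and y: "norm y = 1" "H u *v y = complex_of_real (eig (H u) k) *s y" "P *v y = y"
      by (fastforce simp: C_def R)
    have "cip (P *v y) x = cip y (P *v x)" using P(2) by (rule hermitian_cip)
    then have yx: "cip y x = 0" using x y by simp
    then have xy: "cip x y = 0" using cip_commute_eq_0 by blast
    obtain j where j: "1 \<le> j" "j < CARD('n)" "eig (H u) j = eig (H u) (j + 1)" "eig (H u) j = eig (H u) k"
      using eigenvalue_repeated[OF k x(2) _ y(2) _ xy] x(1) y(1) by (metis norm_zero zero_neq_one)
    have c: "conical_intersection H U u j" using intersection_conical[OF u j(1-3)] .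
    define f where "f v = Re (cip x (dH v *v x)) - Re (cip y (dH v *v y))" for v
    have "linear f"
      by (rule linearI) (simp_all add: f_def linear_add[OF linear_dH] linear_scale[OF linear_dH]
          matrix_vector_mult_add_rdistrib scaleR_eq_cmat_scale cmat_scale_mult_vec cip_simps algebra_simps)
    then obtain v where v: "v \<noteq> 0" "f v = 0" using functional_kernel_nontrivial[OF _ m2] by blast
    have real: "cip z (dH v *v z) = complex_of_real (Re (cip z (dH v *v z)))" for z
      using cnj_cip[of z "dH v *v z"] by (simp add: hermitian_cip[OF hermitian_dH])
        (metis Reals_cnj_iff of_real_Re)
    have "dH v *v y = P *v (dH v *v y)"
      using commute_dH[OF u comm, of v] y(3) by (metis matrix_vector_mul_assoc)
    then have "cip x (dH v *v y) = cip (P *v x) (dH v *v y)"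
      using hermitian_cip[OF P(2), of x "dH v *v y"] by simp
    then have "cip x (dH v *v y) = 0" by (simp add: x(3))
    moreover have "cip x (dH v *v x) = cip y (dH v *v y)"
      using v(2) real[of x] real[of y] by (simp add: f_def)
    moreover have "cip x x = 1" "cip y y = 1" using x y by (simp_all add: cip_self)
    ultimately show False
      using conical_nonscalar[OF c v(1), of x y] x(2) y(2) xy j(4) by simp
  qed
  have cover: "U \<subseteq> C P k \<union> C ?R k" if k: "1 \<le> k" "k \<le> CARD('n)" for k
  proof
    fix u assume u: "u \<in> U"
    obtain W \<tau> where W: "spectral_basis (H u) W \<tau>"
      using spectral_basis_exists[OF hermitian_H] by blast
    obtain p where "\<tau> p = k" using spectral_basis_index[OF W k] by blast
    then have x: "H u *v column p W = complex_of_real (eig (H u) k) *s column p W" "column p W \<noteq> 0"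
      using spectral_basis_eigen[OF W, of p] W column_nonzero by (auto simp: spectral_basis_def)
    show "u \<in> C P k \<union> C ?R k"
    proof (cases "P *v column p W = 0")
      case True
      then show ?thesis using normalize x by blast
    next
      case False
      have "H u *v (P *v column p W) = complex_of_real (eig (H u) k) *s (P *v column p W)"
        by (simp add: PH[OF u] x mult_vec_scale)
      then show ?thesis using normalize[OF False, of u k ?R] by (simp add: R PP)
    qed
  qed
  have dich: "C P k \<inter> U = {} \<or> C ?R k \<inter> U = {}" if k: "1 \<le> k" "k \<le> CARD('n)" for k
    using U_conn[unfolded connected_closed] closed_C[OF k, of P] closed_C[OF k, of ?R] disj[OF k] cover[OF k]
    by blast
  \<comment> \<open>Where the eigenvalues \<open>k\<close> and \<open>k + 1\<close> meet they have
    the same eigenspace, so the alternative valid there, and hence throughout \<open>U\<close>, is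
    the same for both indices.\<close>
  have step: "C Q k \<inter> U = {} \<longleftrightarrow> C Q (k + 1) \<inter> U = {}" if Q: "Q = P \<or> Q = ?R" and k: "1 \<le> k" "k < CARD('n)" for k Q
  proof -
    obtain u where u: "u \<in> U" "eig (H u) k = eig (H u) (k + 1)"
      using conic_H k unfolding conically_connected_def conical_intersection_def by blast
    then have eq: "u \<in> C Q k \<longleftrightarrow> u \<in> C Q (k + 1)" for Q by (simp add: C_def)
    show ?thesis
      using eq[of P] eq[of ?R] u(1) dich[of k] dich[of "k + 1"] cover[of k] cover[of "k + 1"] k Q 
      by (auto simp: disjoint_iff subset_iff)
  qed
  have all: "C Q k \<inter> U = {} \<longleftrightarrow> C Q 1 \<inter> U = {}" if Q: "Q = P \<or> Q = ?R" and "1 \<le> k" "k \<le> CARD('n)" for k Q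
    using that(2,3)
  proof (induction k rule: dec_induct)
    case (step i)
    then show ?case using \<open>\<And>k Q. \<lbrakk>Q = P \<or> Q = ?R; 1 \<le> k; k < CARD('n)\<rbrakk> \<Longrightarrow> _\<close>[OF Q, of i] by simp
  qed simp
  obtain W \<tau> where W: "spectral_basis (H u0) W \<tau>"
    using spectral_basis_exists[OF hermitian_H] by blast
  have Wu: "W \<in> unitary_group" using W by (simp add: spectral_basis_def)
  \<comment> \<open>Each \<open>Q *v column i W\<close> would be an eigenvector fixed by
    \<open>Q\<close>, that is, killed by its complement. If no index admits such a vector,
    \<open>Q\<close> annihilates a whole basis.\<close>
  have kill: "Q = 0" if "C (mat 1 - Q) 1 \<inter> U = {}" and Q: "mat 1 - Q = P \<or> mat 1 - Q = ?R" 
     "Q ** Q = Q" "Q ** H u0 = H u0 ** Q" for Q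
  proof -
    have "Q *v column i W = 0" for i
    proof (rule ccontr)
      assume n: "Q *v column i W \<noteq> 0"
      have "H u0 *v (Q *v column i W) = complex_of_real (eig (H u0) (\<tau> i)) *s (Q *v column i W)"
        by (metis Q(3) matrix_vector_mul_assoc mult_vec_scale spectral_basis_eigen[OF W])
      moreover have "(mat 1 - Q) *v (Q *v column i W) = 0"
        using Q(2) by (simp add: matrix_vector_mul_assoc matrix_ring_simps)
      ultimately have "u0 \<in> C (mat 1 - Q) (\<tau> i)" using normalize[OF n] by blast
      then show False using all[OF Q(1), of "\<tau> i"] spectral_basis_range[OF W, of i] that(1) u0 by blast
    qed
    then have "Q ** W = 0" unfolding column_mult by (simp add: vec_eq_iff column_def)
    then show "Q = 0" by (metis Wu matrix_mul_assoc matrix_mul_rid times0_left unitary_right)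
  qed
  have "?R ** ?R = ?R" using P(1) by (simp add: matrix_ring_simps)
  moreover have "?R ** H u0 = H u0 ** ?R" using comm[OF u0] by (simp add: matrix_ring_simps)
  ultimately have "?R = 0" if "C P 1 \<inter> U = {}" using kill[of ?R] that by simp
  moreover have "P = 0" if "C ?R 1 \<inter> U = {}" using kill[of P] that P(1) comm[OF u0] by simp
  ultimately show ?thesis using dich[of 1] by auto
qed

end

section \<open>The generated Lie algebra\<close>

lemma lie_generated_base: "S \<subseteq> lie_generated S"
  and subspace_lie_generated: "subspace (lie_generated S)"
  and comm_lie_generated: "A \<in> lie_generated S \<Longrightarrow> B \<in> lie_generated S \<Longrightarrow> comm A B \<in> lie_generated S"
  unfolding lie_generated_def by (auto intro!: subspace_Inter)

lemma lie_generated_minimal: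
  "S \<subseteq> L \<Longrightarrow> subspace L \<Longrightarrow> (\<And>A B. A \<in> L \<Longrightarrow> B \<in> L \<Longrightarrow> comm A B \<in> L) \<Longrightarrow> lie_generated S \<subseteq> L"
  unfolding lie_generated_def by auto

lemma mat_adj_comm: "mat_adj (comm A B) = comm (mat_adj B) (mat_adj A)"
  by (simp add: comm_def mat_adj_diff mat_adj_mult)

lemma subspace_u_alg: "subspace u_alg"
  by (simp add: subspace_def u_alg_def skew_hermitian_def mat_adj_add mat_adj_scaleR)

lemma comm_u_alg: "A \<in> u_alg \<Longrightarrow> B \<in> u_alg \<Longrightarrow> comm A B \<in> u_alg"
  by (simp add: u_alg_def skew_hermitian_def mat_adj_comm) (simp add: comm_def matrix_ring_simps)

lemma trace_scaleR: "trace (r *\<^sub>R (A::complex^'n^'n)) = r *\<^sub>R trace A"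
  by (simp add: trace_def scaleR_sum_right)

lemma trace_cmat_scale: "trace (cmat_scale c A) = c * trace A"
  by (simp add: trace_def sum_distrib_left)

lemma trace_comm: "trace (comm A B) = 0"
  by (simp add: comm_def trace_sub trace_mul_sym[of A B])

lemma trace_u_alg: "X \<in> u_alg \<Longrightarrow> trace X = \<i> * complex_of_real (Im (trace X))"
proof -
  assume X: "X \<in> u_alg"
  have "cnj (trace X) = trace (mat_adj X)" by (simp add: trace_def)
  also have "\<dots> = - trace X" using X by (simp add: u_alg_def skew_hermitian_def trace_def sum_negf)
  finally show ?thesis by (simp add: complex_eq_iff)
qed

lemma subspace_su_alg: "subspace su_alg"
  using subspace_u_alg
  by (auto simp: subspace_def u_alg_def su_alg_def trace_add trace_scaleR) (simp add: trace_def)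

lemma comm_su_alg: "A \<in> su_alg \<Longrightarrow> B \<in> su_alg \<Longrightarrow> comm A B \<in> su_alg"
  using comm_u_alg by (auto simp: u_alg_def su_alg_def trace_comm)

lemma i_hermitian_u_alg: "hermitian A \<Longrightarrow> cmat_scale \<i> A \<in> u_alg"
  by (simp add: u_alg_def skew_hermitian_def mat_adj_scale hermitian_def cmat_scale_simps)

section \<open>Complex Lie algebras of matrices closed under the adjoint\<close>

definition munit :: "'n \<Rightarrow> 'n \<Rightarrow> complex^'n^'n" where
  "munit i j = (\<chi> a b. if a = i \<and> b = j then 1 else 0)"

lemma munit_nth: "munit i j $ a $ b = (if a = i \<and> b = j then 1 else 0)"
  by (simp add: munit_def)

lemma mult_munit_nth: "(A ** munit i j) $ a $ b = (if b = j then A $ a $ i else 0)"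
  and munit_mult_nth: "(munit i j ** A) $ a $ b = (if a = i then A $ j $ b else 0)"
  by (auto simp: matrix_matrix_mult_def munit_nth if_distrib if_distribR sum.delta sum.delta' cong: if_cong
      intro!: sum.neutral)

lemma munit_mult: "munit i j ** munit k l = (if j = k then munit i l else 0)"
  by (auto simp: vec_eq_iff mult_munit_nth munit_nth)

lemma mat_adj_munit: "mat_adj (munit i j) = munit j i"
  by (auto simp: vec_eq_iff munit_nth)

text \<open>Models the complexification L + i L of a real Lie algebra L of skew-Hermitian matrices,
  in unitary coordinates. Complex scalars make weight decompositions available; closure under
  \<open>mat_adj\<close> is what remains of the real form.\<close>

locale star_lie_algebra =
  fixes M :: "(complex^'n^'n) set"
  assumes zero_mem: "0 \<in> M"
    and add_mem: "A \<in> M \<Longrightarrow> B \<in> M \<Longrightarrow> A + B \<in> M"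
    and scale_mem: "A \<in> M \<Longrightarrow> cmat_scale c A \<in> M"
    and comm_mem: "A \<in> M \<Longrightarrow> B \<in> M \<Longrightarrow> comm A B \<in> M"
    and adj_mem: "A \<in> M \<Longrightarrow> mat_adj A \<in> M"
begin

lemma diff_mem: "A \<in> M \<Longrightarrow> B \<in> M \<Longrightarrow> A - B \<in> M"
  using add_mem[of A "cmat_scale (-1) B"] scale_mem[of B "-1"] by (simp add: cmat_scale_simps)

lemma sum_mem: "(\<And>i. i \<in> I \<Longrightarrow> f i \<in> M) \<Longrightarrow> (\<Sum>i\<in>I. f i) \<in> M"
  by (induction I rule: infinite_finite_induct) (auto intro: add_mem zero_mem)

lemma unscale_mem: "cmat_scale c A \<in> M \<Longrightarrow> c \<noteq> 0 \<Longrightarrow> A \<in> M"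
  using scale_mem[of "cmat_scale c A" "1 / c"] by (simp add: cmat_scale_simps)

text \<open>The weight spaces of the adjoint action of a diagonal matrix are separated by the polynomial
  in that action vanishing on all other weights.\<close>

lemma weight_component_mem:
  assumes a: "diag_mat a \<in> M" and A: "A \<in> M"
  shows "(\<chi> i j. if a i - a j = \<delta> then A $ i $ j else 0) \<in> M"
proof -
  have prods: "(\<chi> i j. (\<Prod>\<epsilon>\<in>F. a i - a j - \<epsilon>) * A $ i $ j) \<in> M" if "finite F" for F
    using that
  proof (induction F)
    case empty
    then show ?case using A by simp
  next
    case (insert \<epsilon> F)
    let ?X = "(\<chi> i j. (\<Prod>\<epsilon>\<in>F. a i - a j - \<epsilon>) * A $ i $ j)"
    have "comm (diag_mat a) ?X - cmat_scale \<epsilon> ?X \<in> M"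
      using insert.IH a by (intro diff_mem comm_mem scale_mem)
    moreover have "comm (diag_mat a) ?X - cmat_scale \<epsilon> ?X =
        (\<chi> i j. (\<Prod>\<epsilon>\<in>insert \<epsilon> F. a i - a j - \<epsilon>) * A $ i $ j)"
      using insert.hyps
      by (simp add: vec_eq_iff comm_def diag_mat_mult_left diag_mat_mult_right algebra_simps)
    ultimately show ?case by simp
  qed
  define F where "F = (\<lambda>(i, j). a i - a j) ` UNIV - {\<delta>}"
  define c where "c = (\<Prod>\<epsilon>\<in>F. \<delta> - \<epsilon>)"
  have F: "finite F" by (simp add: F_def)
  have c: "c \<noteq> 0" using F by (auto simp: c_def F_def)
  have "(\<chi> i j. (\<Prod>\<epsilon>\<in>F. a i - a j - \<epsilon>) * A $ i $ j) = 
     cmat_scale c (\<chi> i j. if a i - a j = \<delta> then A $ i $ j else 0)"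
  proof -
    have "(\<Prod>\<epsilon>\<in>F. a i - a j - \<epsilon>) * A $ i $ j = c * (if a i - a j = \<delta> then A $ i $ j else 0)" for i j
    proof (cases "a i - a j = \<delta>")
      case False
      then have "a i - a j \<in> F" by (auto simp: F_def image_iff)
      then have "(\<Prod>\<epsilon>\<in>F. a i - a j - \<epsilon>) = 0" using F by auto
      then show ?thesis using False by simp
    qed (simp add: c_def)
    then show ?thesis by (simp add: vec_eq_iff)
  qed
  then have "cmat_scale c (\<chi> i j. if a i - a j = \<delta> then A $ i $ j else 0) \<in> M" using prods[OF F] by simp
  then show ?thesis by (rule unscale_mem[OF _ c])
qed

lemma isolated_weight_mem:
  assumes "diag_mat a \<in> M" "A \<in> M"
    and "\<And>k l. a k - a l = a i - a p \<Longrightarrow> k = i \<and> l = p"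
  shows "cmat_scale (A $ i $ p) (munit i p) \<in> M"
proof -
  have "(\<chi> k l. if a k - a l = a i - a p then A $ k $ l else 0) = cmat_scale (A $ i $ p) (munit i p)"
    using assms(3) by (auto simp: vec_eq_iff munit_nth)
  then show ?thesis using weight_component_mem[OF assms(1,2), of "a i - a p"] by simp
qed

text \<open>The weight-0 parts for \<open>d\<close> consist of the diagonal and the block on {p, q}.
  Diagonal entries outside the block commute with all of this, so commutators are traceless matrices
  on the block, and two of them suffice to produce sl(2). The normalizations \<open>Ad\<close> and
  \<open>Be\<close> are achieved by the choice of the two control directions.\<close>

lemma munit_block_mem:
  fixes d :: "'n \<Rightarrow> real" and y :: real
  assumes pq: "p \<noteq> q" and d: "diag_mat (\<lambda>i. complex_of_real (d i)) \<in> M"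
    and dd: "\<And>k l. d k = d l \<longleftrightarrow> k = l \<or> k = p \<and> l = q \<or> k = q \<and> l = p"
    and A: "A \<in> M" "hermitian A" and B: "B \<in> M" "hermitian B"
    and Ad: "A $ p $ p = A $ q $ q" and Ae: "A $ p $ q \<noteq> 0"
    and Be: "B $ p $ q = \<i> * complex_of_real y * A $ p $ q"
    and nz: "B $ p $ p \<noteq> B $ q $ q \<or> y \<noteq> 0"
  shows "munit p q \<in> M" "munit q p \<in> M"
proof -
  \<comment> \<open>The sparsity pattern of the weight-0 matrices: diagonal entries plus the two
    entries coupling \<open>p\<close> and \<open>q\<close>.\<close>
  define Z where "Z X \<longleftrightarrow> (\<forall>k l. X $ k $ l \<noteq> 0 \<longrightarrow> k = l \<or> k = p \<and> l = q \<or> k = q \<and> l = p)"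
    for X :: "complex^'n^'n"
  define blk :: "complex \<Rightarrow> complex \<Rightarrow> complex \<Rightarrow> complex^'n^'n" where
    "blk h e f = cmat_scale h (munit p p - munit q q) + cmat_scale e (munit p q) + cmat_scale f (munit q p)" for h e f
  have blk_nth: "blk h e f $ p $ p = h" "blk h e f $ q $ q = - h" "blk h e f $ p $ q = e" "blk h e f $ q $ p = f"
    for h e f using pq pq[symmetric] by (simp_all add: blk_def munit_nth)
  have blk_add: "blk h e f + blk h' e' f' = blk (h + h') (e + e') (f + f')" for h e f h' e' f'
    by (simp add: blk_def cmat_scale_simps)
  have blk_scale: "cmat_scale c (blk h e f) = blk (c * h) (c * e) (c * f)" for c h e f
    by (simp add: blk_def cmat_scale_simps)
  have blk_0: "blk h e f $ k $ l = 0" if "\<not> (k = p \<or> k = q) \<or> \<not> (l = p \<or> l = q)" for h e f k l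
    using that by (elim disjE) (simp_all add: blk_def munit_nth)
  have blk_cong: "blk h e f = blk h' e' f'" if "h = h'" "e = e'" "f = f'" for h e f h' e' f'
    using that by simp
  have Z_blk: "Z (blk h e f)" for h e f
    unfolding Z_def using blk_0 by metis
  have comm_Z: "comm X Y = blk (X$p$q * Y$q$p - Y$p$q * X$q$p)
      ((X$p$p - X$q$q) * Y$p$q - (Y$p$p - Y$q$q) * X$p$q)
      ((Y$p$p - Y$q$q) * X$q$p - (X$p$p - X$q$q) * Y$q$p)" if X: "Z X" and Y: "Z Y" for X Y
  proof -
    have mult: "(X ** Y) $ k $ l = (if k = p then X$p$p * Y$p$l + X$p$q * Y$q$l
        else if k = q then X$q$p * Y$p$l + X$q$q * Y$q$l else X$k$k * Y$k$l)"
      if X: "Z X" for X Y :: "complex^'n^'n" and k l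
    proof -
      let ?S = "if k = p \<or> k = q then {p, q} else {k}"
      have "X$k$m = 0" if "m \<notin> ?S" for m
        using X that unfolding Z_def by (metis insertCI)
      then have "(X ** Y) $ k $ l = (\<Sum>m\<in>?S. X$k$m * Y$m$l)"
        unfolding matrix_matrix_mult_def vec_lambda_beta
        by (intro sum.mono_neutral_right) auto
      then show ?thesis using pq by auto
    qed
    have z: "X$k$l = 0" "Y$k$l = 0" if "k \<noteq> l" "\<not> (k = p \<and> l = q)" "\<not> (k = q \<and> l = p)" for k l
      using X Y that by (auto simp: Z_def)
    show ?thesis
      unfolding comm_def vec_eq_iff
    proof (intro allI)
      fix k l
      consider "k = p" "l = p" | "k = p" "l = q" | "k = q" "l = p" | "k = q" "l = q" 
        | "k = p \<or> k = q" "l \<noteq> p" "l \<noteq> q" | "k \<noteq> p" "k \<noteq> q" by blast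
      then show "(X ** Y - Y ** X) $ k $ l = blk (X$p$q * Y$q$p - Y$p$q * X$q$p)
          ((X$p$p - X$q$q) * Y$p$q - (Y$p$p - Y$q$q) * X$p$q)
          ((Y$p$p - Y$q$q) * X$q$p - (X$p$p - X$q$q) * Y$q$p) $ k $ l"
      proof cases
        case 5
        then show ?thesis using z[of p l] z[of q l] pq by (auto simp: mult[OF X] mult[OF Y] blk_0)
      next
        case 6
        then show ?thesis using z[of k l] by (cases "k = l") (auto simp: mult[OF X] mult[OF Y] blk_0)
      qed (use pq in \<open>simp_all add: mult[OF X] mult[OF Y] blk_nth algebra_simps\<close>)
    qed
  qed
  define z where "z X = (\<chi> k l. if complex_of_real (d k) - complex_of_real (d l) = 0 then X $ k $ l else 0)" for X :: "complex^'n^'n"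
  have zM: "z X \<in> M" if "X \<in> M" for X
    unfolding z_def using weight_component_mem[OF d that, of 0] by simp
  have Zz: "Z (z X)" for X using dd by (auto simp: Z_def z_def)
  have z_nth: "z X $ p $ p = X $ p $ p" "z X $ q $ q = X $ q $ q" "z X $ p $ q = X $ p $ q" "z X $ q $ p = X $ q $ p" for X
    using dd[of p q] dd[of q p] by (simp_all add: z_def)
  define e where "e = A $ p $ q"
  have e: "e \<noteq> 0" using Ae by (simp add: e_def)
  have herm_nth: "X $ k $ l = cnj (X $ l $ k)" if "hermitian X" for X :: "complex^'n^'n" and k l
    using that by (metis hermitian_def mat_adj_nth)
  have Af: "A $ q $ p = cnj e" using herm_nth[OF A(2), of q p] by (simp add: e_def)
  have Bf: "B $ q $ p = - \<i> * complex_of_real y * cnj e" using herm_nth[OF B(2), of q p] by (simp add: e_def Be)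
  define \<beta> where "\<beta> = Re (B $ p $ p - B $ q $ q)"
  have Bd: "B $ p $ p - B $ q $ q = complex_of_real \<beta>"
    using herm_nth[OF B(2), of p p] herm_nth[OF B(2), of q q] unfolding \<beta>_def
    by (simp add: complex_eq_iff)
  define s where "s = (cmod e)\<^sup>2"
  have s: "complex_of_real s = e * cnj e" by (simp add: s_def complex_norm_square del: of_real_power)
  have s0: "s > 0" using e by (simp add: s_def)
  let ?y = "complex_of_real y" and ?b = "complex_of_real \<beta>" and ?s = "complex_of_real s"
  define X where "X = comm (z A) (z B)"
  have X: "X = blk (- 2 * \<i> * ?y * ?s) (- ?b * e) (?b * cnj e)"
    unfolding X_def comm_Z[OF Zz Zz] z_nth Af Bf Be Ad e_def[symmetric] 
    by (simp add: Bd[unfolded Ad] s algebra_simps)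
  have XM: "X \<in> M" unfolding X_def by (intro comm_mem zM A B)
  define X' where "X' = comm X (z A)"
  have X': "X' = blk (- 2 * ?b * ?s) (- 4 * \<i> * ?y * ?s * e) (4 * \<i> * ?y * ?s * cnj e)"
    unfolding X'_def X comm_Z[OF Z_blk Zz] z_nth Af Ad e_def[symmetric] blk_nth
    by (simp add: s algebra_simps)
  have X'M: "X' \<in> M" unfolding X'_def by (intro comm_mem zM A XM)
  \<comment> \<open>Written in terms of \<open>blk 1 0 0\<close> and
    \<open>blk 0 e (- cnj e)\<close>, the matrices \<open>X\<close> and \<open>X'\<close> have
    coefficient determinant \<open>D\<close>. The two linear combinations below are Cramer's
    rule.\<close>
  define D where "D = - 2 * s * (4 * y\<^sup>2 * s + \<beta>\<^sup>2)"
  have "4 * y\<^sup>2 * s + \<beta>\<^sup>2 > 0"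
  proof (cases "y = 0")
    case True
    then have "\<beta> \<noteq> 0" using nz Bd by auto
    then show ?thesis using True by simp
  next
    case False
    then show ?thesis using s0 by (simp add: add_pos_nonneg)
  qed
  then have D: "complex_of_real D \<noteq> 0" using s0 by (simp add: D_def del: of_real_mult of_real_add)
  have "cmat_scale (- 4 * \<i> * ?y * ?s) X + cmat_scale ?b X' = cmat_scale (complex_of_real D) (blk 1 0 0)"
    unfolding X X' D_def blk_scale blk_add
    by (rule blk_cong) (simp_all add: algebra_simps power2_eq_square)
  then have H1: "blk 1 0 0 \<in> M"
    by (metis D XM X'M add_mem scale_mem unscale_mem)
  have "cmat_scale (- 2 * \<i> * ?y * ?s) X' + cmat_scale (2 * ?b * ?s) X = cmat_scale (complex_of_real D) (blk 0 e (- cnj e))"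
    unfolding X X' D_def blk_scale blk_add
    by (rule blk_cong) (simp_all add: algebra_simps power2_eq_square)
  then have N1: "blk 0 e (- cnj e) \<in> M"
    by (metis D XM X'M add_mem scale_mem unscale_mem)
  \<comment> \<open>The bracket with the diagonal element flips the sign of one off-diagonal entry
    relative to the other, so a sum with a multiple of the original isolates a single matrix
    unit.\<close>
  have "comm (blk 1 0 0) (blk 0 e (- cnj e)) = blk 0 (2 * e) (2 * cnj e)"
    unfolding comm_Z[OF Z_blk Z_blk] blk_nth by simp
  then have N2: "blk 0 (2 * e) (2 * cnj e) \<in> M" using comm_mem[OF H1 N1] by simp
  have "munit p q = blk 0 1 0" by (simp add: blk_def cmat_scale_simps)
  then have "blk 0 (2 * e) (2 * cnj e) + cmat_scale 2 (blk 0 e (- cnj e)) = cmat_scale (4 * e) (munit p q)"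
    by (simp add: blk_scale blk_add)
  then have "cmat_scale (4 * e) (munit p q) \<in> M"
    using add_mem[OF N2 scale_mem[OF N1, of 2]] by simp
  then show *: "munit p q \<in> M" by (rule unscale_mem) (use e in simp)
  show "munit q p \<in> M" using adj_mem[OF *] by (simp add: mat_adj_munit)
qed

text \<open>Shifting \<open>d\<close> by a generic multiple of the diagonal block element leaves (k,
  p) and (q, l), with k and l outside the block, as the only entries that can share the weight of
  (i, p). The first forces k = i by simplicity; the second is impossible because it lowers the
  eigenvalue whereas (i, p) raises it.\<close>

lemma isolate_row_mem:
  fixes d :: "'n \<Rightarrow> real"
  assumes pq: "p \<noteq> q" and d: "diag_mat (\<lambda>i. complex_of_real (d i)) \<in> M"
    and dd: "\<And>k l. d k = d l \<longleftrightarrow> k = l \<or> k = p \<and> l = q \<or> k = q \<and> l = p"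
    and low: "\<And>k. d p \<le> d k"
    and u: "munit p q \<in> M" "munit q p \<in> M"
    and A: "A \<in> M" and i: "i \<noteq> p" "i \<noteq> q"
  shows "cmat_scale (A $ i $ p) (munit i p) \<in> M"
proof -
  \<comment> \<open>The diagonal of \<open>munit p p - munit q q\<close>. A coincidence of weights
    with different \<open>c\<close>-differences would determine \<open>s\<close>, so only finitely
    many values of \<open>s\<close> have to be avoided.\<close>
  define c :: "'n \<Rightarrow> real" where "c k = (if k = p then 1 else if k = q then -1 else 0)" for k
  have low': "d p < d k" if "k \<noteq> p" "k \<noteq> q" for k
    using low[of k] dd[of p k] that by auto
  have "finite ((\<lambda>(k, l). - (d k - d l - d i + d p) / (c k - c l + 1)) ` UNIV)" (is "finite ?F") by simp
  then obtain s where s: "s \<notin> ?F" using ex_new_if_finite[OF infinite_UNIV_char_0] by blast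
  define a where "a k = d k + s * c k" for k
  have "comm (munit p q) (munit q p) \<in> M" using u by (rule comm_mem)
  then have h: "munit p p - munit q q \<in> M" by (simp add: comm_def munit_mult)
  have "diag_mat (\<lambda>k. complex_of_real (a k)) = 
     diag_mat (\<lambda>i. complex_of_real (d i)) + cmat_scale (complex_of_real s) (munit p p - munit q q)"
    using pq by (auto simp: vec_eq_iff diag_mat_nth munit_nth a_def c_def)
  then have aM: "diag_mat (\<lambda>k. complex_of_real (a k)) \<in> M" 
    using add_mem[OF d scale_mem[OF h]] by simp
  show ?thesis
  proof (rule isolated_weight_mem[OF aM A])
    fix k l assume "complex_of_real (a k) - complex_of_real (a l) = complex_of_real (a i) - complex_of_real (a p)"
    then have "a k - a l = a i - a p" by (metis of_real_diff of_real_eq_iff)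
    then have eq: "(d k - d l - d i + d p) + s * (c k - c l + 1) = 0"
      using i by (simp add: a_def c_def algebra_simps)
    have c0: "c k - c l + 1 = 0"
    proof (rule ccontr)
      assume "c k - c l + 1 \<noteq> 0"
      then have "s = - (d k - d l - d i + d p) / (c k - c l + 1)"
        using eq by (simp add: field_simps)
      then show False using s by (auto simp: image_iff)
    qed
    then have eq': "d k - d l - d i + d p = 0" using eq by simp
    from c0 have "(l = p \<and> k \<noteq> p \<and> k \<noteq> q) \<or> (k = q \<and> l \<noteq> p \<and> l \<noteq> q)"
      using pq by (auto simp: c_def split: if_splits)
    then show "k = i \<and> l = p"
    proof
      assume *: "l = p \<and> k \<noteq> p \<and> k \<noteq> q"
      then have "d k = d i" using eq' by simp
      then show ?thesis using dd[of k i] i * by auto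
    next
      assume *: "k = q \<and> l \<noteq> p \<and> l \<noteq> q"
      then have "d l > d p" "d i > d p" "d q = d p" using low' i dd[of q p] by auto
      then show ?thesis using eq' * by auto
    qed
  qed
qed

text \<open>\<open>R\<close> consists of \<open>p\<close> and of the rows that can be isolated in
  column \<open>p\<close>. The commutator with \<open>munit i p\<close> transports column
  \<open>i\<close> of \<open>A\<close> to column \<open>p\<close>, where a nonzero entry would put
  its row into \<open>R\<close>. Hence the coordinates in \<open>R\<close> span an invariant
  subspace of \<open>M\<close>.\<close>

lemma coupled_block:
  fixes d :: "'n \<Rightarrow> real"
  assumes pq: "p \<noteq> q" and d: "diag_mat (\<lambda>i. complex_of_real (d i)) \<in> M"
    and dd: "\<And>k l. d k = d l \<longleftrightarrow> k = l \<or> k = p \<and> l = q \<or> k = q \<and> l = p"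
    and low: "\<And>k. d p \<le> d k"
    and u: "munit p q \<in> M" "munit q p \<in> M"
  obtains R where "p \<in> R" "\<And>i j. i \<in> R \<Longrightarrow> j \<in> R \<Longrightarrow> i \<noteq> j \<Longrightarrow> munit i j \<in> M"
    "\<And>A k i. A \<in> M \<Longrightarrow> k \<notin> R \<Longrightarrow> i \<in> R \<Longrightarrow> A $ k $ i = 0"
proof -
  define R where "R = {p} \<union> {i. munit i p \<in> M}"
  have col: "A $ k $ p = 0" if "A \<in> M" "k \<notin> R" for A k
  proof (rule ccontr)
    assume "A $ k $ p \<noteq> 0"
    moreover have "k \<noteq> p" "k \<noteq> q" using that(2) u by (auto simp: R_def)
    ultimately have "munit k p \<in> M"
      using isolate_row_mem[OF pq d dd low u that(1), of k] unscale_mem by blast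
    then show False using that by (simp add: R_def)
  qed
  have "munit i j \<in> M" if ij: "i \<in> R" "j \<in> R" "i \<noteq> j" for i j
  proof -
    have ip: "munit i p \<in> M" if "i \<in> R" "i \<noteq> p" for i using that by (auto simp: R_def)
    have pj: "munit p j \<in> M" if "j \<in> R" "j \<noteq> p" for j
      using adj_mem[OF ip[OF that]] by (simp add: mat_adj_munit)
    have "munit i j \<in> M" if "i \<noteq> p" "j \<noteq> p"
    proof -
      have "comm (munit i p) (munit p j) \<in> M" using ip pj ij that by (intro comm_mem) auto
      then show ?thesis using ij by (simp add: comm_def munit_mult)
    qed
    then show ?thesis using ip pj ij by metis
  qed
  moreover have "A $ k $ i = 0" if A: "A \<in> M" and k: "k \<notin> R" and i: "i \<in> R" for A k i
  proof (cases "i = p")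
    case True
    then show ?thesis using col[OF A k] by simp
  next
    case False
    then have "comm A (munit i p) \<in> M" using i A by (intro comm_mem) (auto simp: R_def)
    then have "comm A (munit i p) $ k $ p = 0" using col k by blast
    then show ?thesis using i k by (auto simp: comm_def mult_munit_nth munit_mult_nth)
  qed
  moreover have "p \<in> R" by (simp add: R_def)
  ultimately show thesis using that by blast
qed

lemma traceless_mem:
  assumes off: "\<And>i j. i \<noteq> j \<Longrightarrow> munit i j \<in> M" and X: "trace X = 0"
  shows "X \<in> M"
proof -
  fix p :: 'n
  have dg: "munit i i - munit p p \<in> M" for i
  proof (cases "i = p")
    case True
    then show ?thesis by (simp add: zero_mem)
  next
    case False
    then have "comm (munit i p) (munit p i) \<in> M" using off by (intro comm_mem) auto
    then show ?thesis by (simp add: comm_def munit_mult)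
  qed
  have "(\<Sum>i\<in>UNIV. \<Sum>j\<in>UNIV - {i}. cmat_scale (X $ i $ j) (munit i j)) + 
     (\<Sum>i\<in>UNIV. cmat_scale (X $ i $ i) (munit i i - munit p p)) \<in> M"
    by (intro add_mem sum_mem scale_mem dg off) auto
  also have "(\<Sum>i\<in>UNIV. \<Sum>j\<in>UNIV - {i}. cmat_scale (X $ i $ j) (munit i j)) + 
     (\<Sum>i\<in>UNIV. cmat_scale (X $ i $ i) (munit i i - munit p p)) = X"
  proof -
    have "(\<Sum>i\<in>UNIV. cmat_scale (X $ i $ i) (munit i i - munit p p)) =
        (\<Sum>i\<in>UNIV. cmat_scale (X $ i $ i) (munit i i)) - cmat_scale (trace X) (munit p p)"
      by (simp add: vec_eq_iff trace_def sum_subtractf sum_distrib_right right_diff_distrib)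
    moreover have "(\<Sum>j\<in>UNIV - {i}. cmat_scale (X $ i $ j) (munit i j)) + cmat_scale (X $ i $ i) (munit i i)
        = (\<Sum>j\<in>UNIV. cmat_scale (X $ i $ j) (munit i j))" for i
      by (subst sum.remove[of UNIV i]) (auto simp: add.commute)
    then have "(\<Sum>i\<in>UNIV. \<Sum>j\<in>UNIV - {i}. cmat_scale (X $ i $ j) (munit i j)) + 
       (\<Sum>i\<in>UNIV. cmat_scale (X $ i $ i) (munit i i)) = (\<Sum>i\<in>UNIV. \<Sum>j\<in>UNIV. cmat_scale (X $ i $ j) (munit i j))"
      by (simp add: sum.distrib[symmetric])
    moreover have "(\<Sum>i\<in>UNIV. \<Sum>j\<in>UNIV. cmat_scale (X $ i $ j) (munit i j)) = X"
    proof -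
      have "(\<Sum>i\<in>UNIV. \<Sum>j\<in>UNIV. X $ i $ j * (if a = i \<and> b = j then 1 else 0)) = X $ a $ b" for a b
      proof -
        have "(\<Sum>j\<in>UNIV. X $ i $ j * (if a = i \<and> b = j then 1 else 0)) = (if i = a then X $ a $ b else 0)" for i
          by (cases "i = a") (auto simp: if_distrib sum.delta cong: if_cong)
        then show ?thesis by simp
      qed
      then show ?thesis by (simp add: vec_eq_iff munit_nth)
    qed
    ultimately show ?thesis by (simp add: X cmat_scale_simps)
  qed
  finally show ?thesis .
qed

end

lemma conj_comm:
  assumes "W \<in> unitary_group"
  shows "comm (mat_adj W ** A ** W) (mat_adj W ** B ** W) = mat_adj W ** comm A B ** W"
proof -
  have "(mat_adj W ** A ** W) ** (mat_adj W ** B ** W) = mat_adj W ** (A ** B) ** W" for A B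
    using unitary_right'[OF assms] by (simp flip: matrix_mul_assoc)
  then show ?thesis by (simp add: comm_def matrix_ring_simps)
qed

lemma complexified_star_lie_algebra:
  assumes W: "W \<in> unitary_group" and L: "subspace L" "\<And>A B. A \<in> L \<Longrightarrow> B \<in> L \<Longrightarrow> comm A B \<in> L" "L \<subseteq> u_alg"
  shows "star_lie_algebra {mat_adj W ** (A + cmat_scale \<i> B) ** W | A B. A \<in> L \<and> B \<in> L}" (is "star_lie_algebra ?M")
proof
  have I: "mat_adj W ** X ** W \<in> ?M" if "X = A + cmat_scale \<i> B" "A \<in> L" "B \<in> L" for X A B
    using that by blast
  have "mat_adj W ** 0 ** W \<in> ?M" 
    by (rule I[of _ 0 0]) (auto simp: cmat_scale_simps subspace_0 L)
  then show "0 \<in> ?M" by simp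
  fix X assume "X \<in> ?M"
  then obtain A B where X: "X = mat_adj W ** (A + cmat_scale \<i> B) ** W" and AB: "A \<in> L" "B \<in> L" by blast
  have "cmat_scale c X = mat_adj W ** cmat_scale c (A + cmat_scale \<i> B) ** W" for c
    by (simp add: X cmat_scale_mult_left cmat_scale_mult_right)
  moreover have "cmat_scale c (A + cmat_scale \<i> B) = 
      (Re c *\<^sub>R A - Im c *\<^sub>R B) + cmat_scale \<i> (Im c *\<^sub>R A + Re c *\<^sub>R B)" for c
    by (auto simp: vec_eq_iff scaleR_eq_cmat_scale complex_eq_iff algebra_simps)
  ultimately show "cmat_scale c X \<in> ?M" for c
    by (metis (no_types, lifting) I AB subspace_add subspace_diff subspace_scale L(1))
  have "mat_adj A = - A" "mat_adj B = - B" using AB L(3) by (auto simp: u_alg_def skew_hermitian_def)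
  then have "mat_adj X = mat_adj W ** (- A + cmat_scale \<i> B) ** W"
    by (simp add: X mat_adj_mult mat_adj_add mat_adj_scale cmat_scale_simps matrix_mul_assoc)
  then show "mat_adj X \<in> ?M" using I[of _ "- A" B] AB L(1) by (simp add: subspace_neg)
  fix Y assume "Y \<in> ?M"
  then obtain C D where Y: "Y = mat_adj W ** (C + cmat_scale \<i> D) ** W" and CD: "C \<in> L" "D \<in> L" by blast
  have "X + Y = mat_adj W ** ((A + C) + cmat_scale \<i> (B + D)) ** W"
    by (simp add: X Y cmat_scale_simps matrix_ring_simps)
  then show "X + Y \<in> ?M" using I[of _ "A + C" "B + D"] AB CD L(1) by (simp add: subspace_add)
  have "comm (A + cmat_scale \<i> B) (C + cmat_scale \<i> D) = 
     (comm A C - comm B D) + cmat_scale \<i> (comm A D + comm B C)"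
    by (simp add: comm_def matrix_ring_simps cmat_scale_mult_left cmat_scale_mult_right cmat_scale_simps)
  then have "comm X Y = mat_adj W ** ((comm A C - comm B D) + cmat_scale \<i> (comm A D + comm B C)) ** W"
    by (simp add: X Y conj_comm[OF W])
  then show "comm X Y \<in> ?M"
    using I[OF refl, of "comm A C - comm B D" "comm A D + comm B C"] AB CD L 
    by (simp add: subspace_add subspace_diff)
qed

section \<open>The Lie algebra generated by a conically connected family\<close>

context conical_family
begin

definition generators :: "(complex^'n^'n) set" where
  "generators = {cmat_scale \<i> (H u) | u. u \<in> U}"

lemma lie_generated_subset_u_alg: "lie_generated generators \<subseteq> u_alg"
  using lie_generated_minimal[of generators u_alg] i_hermitian_u_alg[OF hermitian_H]
    subspace_u_alg comm_u_alg by (auto simp: generators_def)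

lemma i_dH_mem:
  assumes "u \<in> U" shows "cmat_scale \<i> (dH v) \<in> lie_generated generators"
proof -
  obtain t where t: "t > 0" "u + t *\<^sub>R v \<in> U" using shift_mem[OF assms] by blast
  then have "cmat_scale \<i> (H (u + t *\<^sub>R v)) - cmat_scale \<i> (H u) \<in> lie_generated generators"
    using assms lie_generated_base[of generators]
    by (intro subspace_diff subspace_lie_generated) (auto simp: generators_def)
  moreover have "cmat_scale \<i> (H (u + t *\<^sub>R v)) - cmat_scale \<i> (H u) = t *\<^sub>R cmat_scale \<i> (dH v)"
    by (simp add: H_add cmat_scale_simps scaleR_eq_cmat_scale mult.commute)
  ultimately have "(1 / t) *\<^sub>R (t *\<^sub>R cmat_scale \<i> (dH v)) \<in> lie_generated generators"
    by (metis subspace_lie_generated subspace_scale)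
  then show ?thesis using t by simp
qed

theorem su_alg_subset_lie_generated: "su_alg \<subseteq> lie_generated generators"
proof -
  let ?L = "lie_generated generators"
  obtain u where c: "conical_intersection H U u 1"
    and simple: "\<And>l. 1 \<le> l \<Longrightarrow> l \<le> CARD('n) \<Longrightarrow> l \<noteq> 1 \<Longrightarrow> l \<noteq> 2 \<Longrightarrow> eig_mult (H u) (eig (H u) l) = 1"
    using conic_H n2 unfolding conically_connected_def
    by (metis One_nat_def Suc_1 Suc_le_lessD le_refl Suc_eq_plus1)
  have u: "u \<in> U" using c by (simp add: conical_intersection_def)
  obtain W \<tau> where W: "spectral_basis (H u) W \<tau>"
    using spectral_basis_exists[OF hermitian_H] by blast
  have Wu: "W \<in> unitary_group" using W by (simp add: spectral_basis_def)
  have inj: "inj \<tau>" using W by (auto simp: spectral_basis_def bij_betw_def)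
  define d where "d i = eig (H u) (\<tau> i)" for i
  obtain p where p: "\<tau> p = 1" using spectral_basis_index[OF W, of 1] n2 by auto
  obtain q where q: "\<tau> q = 2" using spectral_basis_index[OF W, of 2] n2 by auto
  have pq: "p \<noteq> q" using p q by auto
  have dd: "d k = d l \<longleftrightarrow> k = l \<or> k = p \<and> l = q \<or> k = q \<and> l = p" for k l
  proof
    assume eq: "d k = d l"
    have rk: "1 \<le> \<tau> i" "\<tau> i \<le> CARD('n)" for i using spectral_basis_range[OF W] by auto
    have key: "k = l" if eq: "d k = d l" and k: "\<tau> k \<noteq> 1" "\<tau> k \<noteq> 2" for k l
    proof -
      have "card {j \<in> {1..CARD('n)}. eig (H u) j = eig (H u) (\<tau> k)} = 1"
        using simple[OF rk[of k] k] by (simp add: eig_mult_eq_card[OF hermitian_H])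
      then obtain j0 where "{j \<in> {1..CARD('n)}. eig (H u) j = eig (H u) (\<tau> k)} = {j0}"
        using card_1_singletonE by blast
      moreover have "\<tau> k \<in> {j \<in> {1..CARD('n)}. eig (H u) j = eig (H u) (\<tau> k)}"
        "\<tau> l \<in> {j \<in> {1..CARD('n)}. eig (H u) j = eig (H u) (\<tau> k)}"
        using rk eq by (auto simp: d_def)
      ultimately have "\<tau> k = \<tau> l" by (metis singletonD)
      then show ?thesis using inj by (simp add: inj_def)
    qed
    have tp: "i = p" if "\<tau> i = 1" for i using that p inj by (metis injD)
    have tq: "i = q" if "\<tau> i = 2" for i using that q inj by (metis injD)
    show "k = l \<or> k = p \<and> l = q \<or> k = q \<and> l = p"
      using key[OF eq] key[OF eq[symmetric]] tp tq by metis
  next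
    have "d p = d q" using c p q by (simp add: d_def conical_intersection_def numeral_2_eq_2)
    then show "k = l \<or> k = p \<and> l = q \<or> k = q \<and> l = p \<Longrightarrow> d k = d l" by auto
  qed
  have low: "d p \<le> d k" for k
    unfolding d_def p using spectral_basis_range[OF W, of k] by (intro eig_mono[OF hermitian_H]) auto
  define M where "M = {mat_adj W ** (A + cmat_scale \<i> B) ** W | A B. A \<in> ?L \<and> B \<in> ?L}"
  interpret star_lie_algebra M
    unfolding M_def
    by (rule complexified_star_lie_algebra[OF Wu subspace_lie_generated comm_lie_generated lie_generated_subset_u_alg])
  \<comment> \<open>A Hermitian \<open>A\<close> enters the complexification through its second
    summand, as \<open>\<i>\<close> times the skew-Hermitian matrix -i A.\<close>
  have MI: "mat_adj W ** A ** W \<in> M" if "cmat_scale \<i> A \<in> ?L" for A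
  proof -
    have "cmat_scale (-1) (cmat_scale \<i> A) \<in> ?L"
      using subspace_neg[OF subspace_lie_generated that] by (simp add: cmat_scale_simps)
    moreover have "mat_adj W ** A ** W = mat_adj W ** (0 + cmat_scale \<i> (cmat_scale (-1) (cmat_scale \<i> A))) ** W"
      by (simp add: cmat_scale_simps)
    ultimately show ?thesis
      unfolding M_def using subspace_0[OF subspace_lie_generated[of generators]] by blast
  qed
  have HM: "mat_adj W ** H u' ** W \<in> M" if "u' \<in> U" for u'
    using that lie_generated_base[of generators] by (intro MI) (auto simp: generators_def)
  have dHM: "mat_adj W ** dH v ** W \<in> M" for v by (intro MI i_dH_mem[OF u])
  have "mat_adj W ** H u ** W = diag_mat (\<lambda>i. complex_of_real (d i))"
    using W unitary_left'[OF Wu] unfolding spectral_basis_def d_def by (simp flip: matrix_mul_assoc)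
  then have dM: "diag_mat (\<lambda>i. complex_of_real (d i)) \<in> M" using HM[OF u] by simp
  define b where "b v = mat_adj W ** dH v ** W" for v
  have b_herm: "hermitian (b v)" for v
    using hermitian_dH[of v] by (simp add: b_def hermitian_def mat_adj_mult matrix_mul_assoc)
  have b_nth: "b v $ i $ j = cip (column i W) (dH v *v column j W)" for v i j
    by (simp add: b_def conj_nth)
  have b_lin: "b (v - r *\<^sub>R w) = b v - r *\<^sub>R b w" for v w r
    by (simp add: b_def linear_diff[OF linear_dH] linear_scale[OF linear_dH] matrix_ring_simps)
  have ns: "\<not> (b v $ p $ q = 0 \<and> b v $ p $ p = b v $ q $ q)" if "v \<noteq> 0" for v
  proof -
    have "H u *v column p W = complex_of_real (eig (H u) 1) *s column p W"
      "H u *v column q W = complex_of_real (eig (H u) 1) *s column q W"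
      using spectral_basis_eigen[OF W, of p] spectral_basis_eigen[OF W, of q] p dd[of p q]
      unfolding d_def by auto
    moreover have "cip (column p W) (column p W) = 1" "cip (column q W) (column q W) = 1" 
      "cip (column p W) (column q W) = 0"
      using Wu pq by (simp_all add: unitary_iff_columns)
    ultimately show ?thesis using conical_nonscalar[OF c that, of "column p W" "column q W"] by (simp add: b_nth)
  qed
  have real_diag: "Im (b v $ i $ i) = 0" for v i
    using b_herm[of v] by (metis hermitian_def mat_adj_nth Reals_cnj_iff complex_is_Real_iff)
  have "linear (\<lambda>v. Re (b v $ p $ p) - Re (b v $ q $ q))"
  proof (rule linearI)
    fix v w :: "real^'m" and r
    show "Re (b (v + w) $ p $ p) - Re (b (v + w) $ q $ q) = 
       (Re (b v $ p $ p) - Re (b v $ q $ q)) + (Re (b w $ p $ p) - Re (b w $ q $ q))"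
      using b_lin[of v "-1" w] by simp
    have "b (r *\<^sub>R v) = r *\<^sub>R b v" by (simp add: b_def linear_scale[OF linear_dH] matrix_ring_simps)
    then show "Re (b (r *\<^sub>R v) $ p $ p) - Re (b (r *\<^sub>R v) $ q $ q) = r *\<^sub>R (Re (b v $ p $ p) - Re (b v $ q $ q))"
      by (simp add: algebra_simps)
  qed
  \<comment> \<open>Equal diagonal entries on the block force, by \<open>ns\<close>, a nonzero
    off-diagonal entry in direction \<open>v\<close>.\<close>
  then obtain v where v: "v \<noteq> 0" "Re (b v $ p $ p) - Re (b v $ q $ q) = 0"
    using functional_kernel_nontrivial[OF _ m2] by blast
  have vd: "b v $ p $ p = b v $ q $ q" using v(2) real_diag by (simp add: complex_eq_iff)
  then have ve: "b v $ p $ q \<noteq> 0" using ns[OF v(1)] by blast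
  \<comment> \<open>Orthogonality to \<open>v\<close> serves only to make \<open>w0\<close>
    independent of \<open>v\<close>, so that w = w0 - r v is nonzero. The real number
    \<open>r\<close> removes the real part of the quotient of the two off-diagonal entries, leaving
    an imaginary multiple.\<close>
  have "linear (\<lambda>w. inner v w)" by (simp add: linear_iff inner_add_right)
  then obtain w0 where w0: "w0 \<noteq> 0" "inner v w0 = 0" using functional_kernel_nontrivial[OF _ m2] by blast
  define r where "r = Re (b w0 $ p $ q / b v $ p $ q)"
  define w where "w = w0 - r *\<^sub>R v"
  have "w \<noteq> 0"
  proof
    assume "w = 0"
    then have "inner w0 w0 = r * inner v w0" by (simp add: w_def inner_commute)
    then show False using w0 by simp
  qed
  define y where "y = Im (b w0 $ p $ q / b v $ p $ q)"
  have "b w0 $ p $ q / b v $ p $ q = complex_of_real r + \<i> * complex_of_real y"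
    by (simp add: r_def y_def complex_eq_iff)
  then have "b w0 $ p $ q = (complex_of_real r + \<i> * complex_of_real y) * b v $ p $ q"
    using ve by (simp add: field_simps)
  then have we: "b w $ p $ q = \<i> * complex_of_real y * b v $ p $ q"
    by (simp add: w_def b_lin scaleR_conv_of_real[where 'a=complex] algebra_simps)
  have "b w $ p $ p \<noteq> b w $ q $ q \<or> y \<noteq> 0"
    using ns[OF \<open>w \<noteq> 0\<close>] we by auto
  then have un: "munit p q \<in> M" "munit q p \<in> M"
    using munit_block_mem[OF pq dM dd _ b_herm _ b_herm vd ve we] dHM unfolding b_def by auto
  obtain R where R: "p \<in> R" "\<And>i j. i \<in> R \<Longrightarrow> j \<in> R \<Longrightarrow> i \<noteq> j \<Longrightarrow> munit i j \<in> M"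
    "\<And>A k i. A \<in> M \<Longrightarrow> k \<notin> R \<Longrightarrow> i \<in> R \<Longrightarrow> A $ k $ i = 0"
    using coupled_block[OF pq dM dd low un] by blast
  \<comment> \<open>\<open>P\<close> is the orthogonal projection onto the span of the columns with
    index in \<open>R\<close>. Invariance of this span under both \<open>A\<close> and
    \<open>mat_adj A\<close> makes \<open>P\<close> commute with every \<open>H u'\<close>, so
    irreducibility forces \<open>R\<close> to contain all indices.\<close>
  define D where "D = diag_mat (\<lambda>i. if i \<in> R then 1 else 0 :: complex)"
  define P where "P = W ** D ** mat_adj W"
  have DD: "D ** D = D" unfolding D_def diag_mat_mult by (rule arg_cong[where f = diag_mat]) auto
  have Dadj: "mat_adj D = D" unfolding D_def mat_adj_diag by (rule arg_cong[where f = diag_mat]) auto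
  have "P ** P = W ** (D ** (mat_adj W ** (W ** (D ** mat_adj W))))" by (simp add: P_def matrix_mul_assoc)
  also have "\<dots> = W ** (D ** (D ** mat_adj W))" by (simp only: unitary_left'[OF Wu])
  also have "\<dots> = P" by (simp add: P_def matrix_mul_assoc) (simp add: DD flip: matrix_mul_assoc)
  finally have PP: "P ** P = P" .
  have Ph: "hermitian P" by (simp add: hermitian_def P_def mat_adj_mult Dadj matrix_mul_assoc)
  have com: "P ** H u' = H u' ** P" if "u' \<in> U" for u'
  proof -
    define A where "A = mat_adj W ** H u' ** W"
    have A: "A \<in> M" "mat_adj A \<in> M" using HM[OF that] adj_mem by (auto simp: A_def)
    have z: "A $ k $ i = 0" if "k \<in> R \<longleftrightarrow> i \<notin> R" for k i
    proof (cases "k \<in> R")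
      case True
      then have "mat_adj A $ i $ k = 0" using that R(3)[OF A(2)] by blast
      then show ?thesis by simp
    next
      case False
      then show ?thesis using that R(3)[OF A(1)] by blast
    qed
    have DA: "D ** A = A ** D"
      using z by (auto simp: vec_eq_iff D_def diag_mat_mult_left diag_mat_mult_right)
    have H: "H u' = W ** A ** mat_adj W"
      using unitary_right[OF Wu] unitary_right'[OF Wu] by (simp add: A_def flip: matrix_mul_assoc)
    have "P ** H u' = W ** (D ** A) ** mat_adj W"
      unfolding H P_def using unitary_left'[OF Wu] by (simp flip: matrix_mul_assoc)
    also have "\<dots> = H u' ** P"
      unfolding H P_def DA using unitary_left'[OF Wu] by (simp flip: matrix_mul_assoc)
    finally show ?thesis .
  qed
  have D: "D = mat_adj W ** P ** W"
    using unitary_left[OF Wu] unitary_left'[OF Wu] by (simp add: P_def flip: matrix_mul_assoc)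
  have "P \<noteq> 0"
  proof
    assume "P = 0"
    then have "D $ p $ p = 0" by (simp add: D)
    then show False using R(1) by (simp add: D_def diag_mat_nth)
  qed
  then have "P = mat 1" using irreducible[OF PP Ph com] by blast
  then have D1: "D = mat 1" by (simp add: D unitary_left[OF Wu])
  have "i \<in> R" for i
  proof -
    have "D $ i $ i = 1" by (simp add: D1 mat_def)
    then show ?thesis by (simp add: D_def diag_mat_nth split: if_splits)
  qed
  then have off: "munit i j \<in> M" if "i \<noteq> j" for i j using R(2) that by blast
  show ?thesis
  proof
    fix X :: "complex^'n^'n" assume X: "X \<in> su_alg"
    have "trace (mat_adj W ** X ** W) = trace (W ** (mat_adj W ** X))" by (rule trace_mul_sym)
    also have "\<dots> = 0" using X by (simp add: unitary_right'[OF Wu] su_alg_def)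
    finally have "mat_adj W ** X ** W \<in> M" using traceless_mem[OF off] by blast
    then obtain A B where AB: "A \<in> ?L" "B \<in> ?L" "mat_adj W ** X ** W = mat_adj W ** (A + cmat_scale \<i> B) ** W"
      unfolding M_def by blast
    have "W ** (mat_adj W ** Y ** W) ** mat_adj W = Y" for Y
      using unitary_right[OF Wu] unitary_right'[OF Wu] by (simp flip: matrix_mul_assoc)
    then have XAB: "X = A + cmat_scale \<i> B" using AB(3) by metis
    have sk: "mat_adj X = - X" "mat_adj A = - A" "mat_adj B = - B"
      using X AB lie_generated_subset_u_alg by (auto simp: su_alg_def u_alg_def skew_hermitian_def)
    \<comment> \<open>Return from the complexification to the real algebra: \<open>X\<close> and
      \<open>A\<close> are skew-Hermitian whereas \<open>\<i>\<close> times \<open>B\<close> is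
      Hermitian, so this summand vanishes.\<close>
    have "cmat_scale (2 * \<i>) B = 0"
      using sk(1) unfolding XAB mat_adj_add mat_adj_scale sk(2,3)
      by (simp add: vec_eq_iff)
    then have "B = 0" by (simp add: vec_eq_iff)
    then show "X \<in> ?L" using XAB AB by (simp add: cmat_scale_simps)
  qed
qed

theorem lie_generated_su:
  assumes "\<And>u. u \<in> U \<Longrightarrow> trace (H u) = 0"
  shows "lie_generated generators = su_alg"
proof
  show "lie_generated generators \<subseteq> su_alg"
  proof (rule lie_generated_minimal[OF _ subspace_su_alg comm_su_alg])
    show "generators \<subseteq> su_alg"
      using i_hermitian_u_alg[OF hermitian_H] assms
      by (auto simp: generators_def su_alg_def u_alg_def trace_cmat_scale)
  qed
qed (rule su_alg_subset_lie_generated)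

text \<open>su(n) has real codimension one in u(n), and one generator with nonzero trace supplies
  the missing direction.\<close>

theorem lie_generated_u:
  assumes "u0 \<in> U" "trace (H u0) \<noteq> 0"
  shows "lie_generated generators = u_alg"
proof
  let ?L = "lie_generated generators"
  show "u_alg \<subseteq> ?L"
  proof
    fix X :: "complex^'n^'n" assume X: "X \<in> u_alg"
    define Y where "Y = cmat_scale \<i> (H u0)"
    have YL: "Y \<in> ?L" using assms(1) lie_generated_base[of generators] by (auto simp: Y_def generators_def)
    then have Yu: "Y \<in> u_alg" using lie_generated_subset_u_alg by blast
    obtain x y where x: "trace X = \<i> * complex_of_real x" and y: "trace Y = \<i> * complex_of_real y"
      using trace_u_alg X Yu by blast
    have y0: "y \<noteq> 0" using y assms(2) by (auto simp: Y_def trace_cmat_scale)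
    have "trace (X - (x / y) *\<^sub>R Y) = 0"
      using y0 by (simp add: trace_sub trace_scaleR x y) (simp add: scaleR_conv_of_real)
    moreover have "X - (x / y) *\<^sub>R Y \<in> u_alg"
      using X Yu by (intro subspace_diff subspace_scale subspace_u_alg)
    ultimately have "X - (x / y) *\<^sub>R Y \<in> ?L"
      using su_alg_subset_lie_generated by (auto simp: su_alg_def u_alg_def)
    then have "X - (x / y) *\<^sub>R Y + (x / y) *\<^sub>R Y \<in> ?L"
      using YL by (intro subspace_add subspace_scale subspace_lie_generated)
    then show "X \<in> ?L" by simp
  qed
qed (rule lie_generated_subset_u_alg)

end

section \<open>Semigroups of unitary matrices\<close>

text \<open>The one-parameter group exp(t X) for X = \<open>gen W d\<close>, expressed through a
  diagonalization of X. By \<open>gen_exists\<close> every skew-Hermitian matrix has such a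
  form.\<close>

definition evol :: "complex^'n^'n \<Rightarrow> ('n \<Rightarrow> real) \<Rightarrow> real \<Rightarrow> complex^'n^'n" where
  "evol W d t = W ** diag_mat (\<lambda>i. cis (t * d i)) ** mat_adj W"

definition gen :: "complex^'n^'n \<Rightarrow> ('n \<Rightarrow> real) \<Rightarrow> complex^'n^'n" where
  "gen W d = W ** diag_mat (\<lambda>i. \<i> * complex_of_real (d i)) ** mat_adj W"

lemma conj_mult:
  assumes "W \<in> unitary_group"
  shows "(W ** A ** mat_adj W) ** (W ** B ** mat_adj W) = W ** (A ** B) ** mat_adj W"
  by (simp add: unitary_left'[OF assms] flip: matrix_mul_assoc)

lemma evol_unitary: "W \<in> unitary_group \<Longrightarrow> evol W d t \<in> unitary_group"
  unfolding evol_def by (intro unitary_mult unitary_diag unitary_adj) auto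

lemma evol_add: "W \<in> unitary_group \<Longrightarrow> evol W d (s + t) = evol W d s ** evol W d t"
  by (simp add: evol_def conj_mult diag_mat_mult cis_mult distrib_right)

lemma evol_0: "W \<in> unitary_group \<Longrightarrow> evol W d 0 = mat 1"
  by (simp add: evol_def unitary_right)

lemma gen_skew: "gen W d \<in> u_alg"
proof -
  have "mat_adj (gen W d) = W ** diag_mat (\<lambda>i. - (\<i> * complex_of_real (d i))) ** mat_adj W"
    by (simp add: gen_def mat_adj_mult mat_adj_diag matrix_mul_assoc)
  also have "diag_mat (\<lambda>i. - (\<i> * complex_of_real (d i))) = - diag_mat (\<lambda>i. \<i> * complex_of_real (d i))"
    by (simp add: vec_eq_iff diag_mat_nth)
  finally show ?thesis by (simp add: u_alg_def skew_hermitian_def gen_def matrix_ring_simps)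
qed

lemma gen_exists:
  assumes "X \<in> u_alg"
  obtains W d where "W \<in> unitary_group" "X = gen W d"
proof -
  have "hermitian (cmat_scale (- \<i>) X)"
    using assms by (simp add: hermitian_def u_alg_def skew_hermitian_def mat_adj_scale mat_adj_uminus cmat_scale_simps)
  then obtain W and d :: "'a \<Rightarrow> real" where W: "W \<in> unitary_group" 
    "cmat_scale (- \<i>) X ** W = W ** diag_mat (\<lambda>i. complex_of_real (d i))"
    using hermitian_diagonalizable by blast
  have "X = cmat_scale \<i> (cmat_scale (- \<i>) X ** W ** mat_adj W)"
    using unitary_right[OF W(1)] 
    by (simp add: cmat_scale_simps cmat_scale_mult_left matrix_ring_simps flip: matrix_mul_assoc)
  also have "\<dots> = W ** cmat_scale \<i> (diag_mat (\<lambda>i. complex_of_real (d i))) ** mat_adj W"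
    unfolding W(2) by (simp add: cmat_scale_mult_left cmat_scale_mult_right)
  also have "cmat_scale \<i> (diag_mat (\<lambda>i. complex_of_real (d i))) = diag_mat (\<lambda>i. \<i> * complex_of_real (d i))"
    by (simp add: vec_eq_iff diag_mat_nth)
  finally show thesis using that W(1) by (simp add: gen_def)
qed

lemma cis_has_vector_derivative:
  "((\<lambda>t. cis (t * d)) has_vector_derivative (\<i> * complex_of_real d * cis (t * d))) (at t)"
proof -
  have "((\<lambda>z. exp (z * (\<i> * complex_of_real d))) has_field_derivative
      (exp (complex_of_real t * (\<i> * complex_of_real d)) * (\<i> * complex_of_real d))) (at (complex_of_real t))"
    by (auto intro!: derivative_eq_intros)
  from has_vector_derivative_real_field[OF this]
  have "((\<lambda>t. exp (complex_of_real t * (\<i> * complex_of_real d))) has_vector_derivative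
      (exp (complex_of_real t * (\<i> * complex_of_real d)) * (\<i> * complex_of_real d))) (at t)" .
  then show ?thesis by (simp add: cis_conv_exp mult_ac)
qed

lemma evol_has_vector_derivative:
  fixes W :: "complex^'n^'n"
  assumes "W \<in> unitary_group"
  shows "(evol W d has_vector_derivative (gen W d ** evol W d t)) (at t within S)"
proof -
  have dm: "diag_mat f = (\<Sum>i\<in>UNIV. cmat_scale (f i) (munit i i))" for f :: "'n \<Rightarrow> complex"
  proof -
    have "(\<Sum>i\<in>UNIV. f i * (if a = i \<and> b = i then 1 else 0)) = (if a = b then f a else 0)" for a b
      by (cases "a = b") (auto simp: if_distrib sum.delta' cong: if_cong intro!: sum.neutral)
    then show ?thesis by (simp add: vec_eq_iff diag_mat_nth munit_nth)
  qed
  have bl: "bounded_linear (\<lambda>c. cmat_scale c A)" for A :: "complex^'n^'n"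
    by (intro linear_conv_bounded_linear[THEN iffD1] linearI)
       (simp_all add: cmat_scale_simps scaleR_eq_cmat_scale scaleR_conv_of_real[where 'a=complex])
  have "((\<lambda>t. diag_mat (\<lambda>i. cis (t * d i))) has_vector_derivative
      diag_mat (\<lambda>i. \<i> * complex_of_real (d i) * cis (t * d i))) (at t)"
    unfolding dm
    by (intro has_vector_derivative_sum bounded_linear.has_vector_derivative[OF bl] cis_has_vector_derivative)
  then have "(evol W d has_vector_derivative 
      W ** diag_mat (\<lambda>i. \<i> * complex_of_real (d i) * cis (t * d i)) ** mat_adj W) (at t)"
    unfolding evol_def
    by (intro bounded_linear.has_vector_derivative[OF mm.bounded_linear_left]
        bounded_linear.has_vector_derivative[OF mm.bounded_linear_right])
  moreover have "W ** diag_mat (\<lambda>i. \<i> * complex_of_real (d i) * cis (t * d i)) ** mat_adj W = gen W d ** evol W d t"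
    by (simp add: gen_def evol_def conj_mult[OF assms] diag_mat_mult)
  ultimately show ?thesis using has_vector_derivative_at_within by metis
qed

lemma evol_has_vector_derivative_0:
  "W \<in> unitary_group \<Longrightarrow> (evol W d has_vector_derivative gen W d) (at 0 within S)"
  using evol_has_vector_derivative[of W d 0 S] by (simp add: evol_0)

lemma unitary_evol:
  assumes "g \<in> unitary_group" obtains W \<theta> where "W \<in> unitary_group" "g = evol W \<theta> 1"
proof -
  obtain W \<theta> where W: "W \<in> unitary_group" "g ** W = W ** diag_mat (\<lambda>i. cis (\<theta> i))"
    using unitary_diagonalizable[OF assms] by blast
  have "g = g ** W ** mat_adj W" using unitary_right[OF W(1)] by (simp flip: matrix_mul_assoc)
  then show thesis using that[of W \<theta>] W by (simp add: evol_def)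
qed

definition mpow :: "complex^'n^'n \<Rightarrow> nat \<Rightarrow> complex^'n^'n" where
  "mpow g n = ((**) g ^^ n) (mat 1)"

lemma mpow_0 [simp]: "mpow g 0 = mat 1" and mpow_Suc [simp]: "mpow g (Suc n) = g ** mpow g n"
  by (simp_all add: mpow_def)

lemma mpow_add: "mpow g (m + n) = mpow g m ** mpow g n"
  by (induction m) (simp_all add: matrix_mul_assoc)

lemma mpow_closed:
  "mat 1 \<in> S \<Longrightarrow> (\<And>a b. a \<in> S \<Longrightarrow> b \<in> S \<Longrightarrow> a ** b \<in> S) \<Longrightarrow> g \<in> S \<Longrightarrow> mpow g n \<in> S"
  by (induction n) auto

lemma mpow_unitary: "g \<in> unitary_group \<Longrightarrow> mpow g n \<in> unitary_group"
  by (rule mpow_closed) (auto intro: unitary_mult)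

lemma mpow_evol: "W \<in> unitary_group \<Longrightarrow> mpow (evol W d t) n = evol W d (real n * t)"
  by (induction n) (simp_all add: evol_0 distrib_right evol_add)

text \<open>Unitary factors act isometrically, so in the telescoping product the errors of the n
  factors only add up.\<close>

lemma mpow_diff_le:
  fixes a b :: "complex^'n^'n"
  assumes "a \<in> unitary_group" "b \<in> unitary_group"
  shows "norm (mpow a n - mpow b n) \<le> real n * norm (a - b)"
proof (induction n)
  case (Suc n)
  have "mpow a (Suc n) - mpow b (Suc n) = a ** (mpow a n - mpow b n) + (a - b) ** mpow b n"
    by (simp add: matrix_ring_simps)
  also have "norm \<dots> \<le> norm (mpow a n - mpow b n) + norm (a - b)"
    using norm_triangle_ineq unitary_norm_mult_left[OF assms(1)] 
      unitary_norm_mult_right[OF mpow_unitary[OF assms(2)]] by metis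
  finally show ?case using Suc.IH by (simp add: distrib_right)
qed simp

lemma difference_quotient_tendsto:
  fixes Z :: "real \<Rightarrow> 'a::real_normed_vector"
  assumes "(Z has_vector_derivative D) (at 0 within {0..})"
  shows "((\<lambda>t. (1 / t) *\<^sub>R (Z t - Z 0)) \<longlongrightarrow> D) (at_right 0)"
proof -
  have "((\<lambda>y. (1 / norm (y - 0)) *\<^sub>R (Z y - (Z 0 + (y - 0) *\<^sub>R D))) \<longlongrightarrow> 0) (at 0 within {0..})"
    using assms unfolding has_vector_derivative_def has_derivative_within by simp
  then have "((\<lambda>y. (1 / norm (y - 0)) *\<^sub>R (Z y - (Z 0 + (y - 0) *\<^sub>R D))) \<longlongrightarrow> 0) (at_right 0)"
    by (rule tendsto_within_subset) auto
  then have "((\<lambda>y. (1 / norm (y - 0)) *\<^sub>R (Z y - (Z 0 + (y - 0) *\<^sub>R D)) + D) \<longlongrightarrow> 0 + D) (at_right 0)"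
    by (intro tendsto_add tendsto_const)
  moreover have "\<forall>\<^sub>F y in at_right 0. (1 / norm (y - 0)) *\<^sub>R (Z y - (Z 0 + (y - 0) *\<^sub>R D)) + D = (1 / y) *\<^sub>R (Z y - Z 0)"
  proof -
    have "\<forall>\<^sub>F y in at_right 0. (0::real) < y" by (simp add: eventually_at_right_less)
    then show ?thesis by eventually_elim (simp add: algebra_simps)
  qed
  ultimately show ?thesis by (simp add: tendsto_cong)
qed

lemma derivative_in_subspace:
  fixes Z :: "real \<Rightarrow> 'a::euclidean_space"
  assumes "subspace V" "\<And>t. t \<ge> 0 \<Longrightarrow> Z t \<in> V" "(Z has_vector_derivative D) (at 0 within {0..})"
  shows "D \<in> V"
proof (rule Lim_in_closed_set[OF closed_subspace[OF assms(1)] _ _ difference_quotient_tendsto[OF assms(3)]])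
  have "\<forall>\<^sub>F y in at_right 0. (0::real) < y" by (simp add: eventually_at_right_less)
  then show "\<forall>\<^sub>F t in at_right 0. (1 / t) *\<^sub>R (Z t - Z 0) \<in> V"
    by eventually_elim (use assms(1,2) in \<open>auto intro!: subspace_scale subspace_diff\<close>)
qed simp

lemma Ad_has_vector_derivative:
  fixes \<gamma> :: "real \<Rightarrow> complex^'n^'n"
  assumes "(\<gamma> has_vector_derivative X) (at 0 within S)" "\<gamma> 0 = mat 1" "X \<in> u_alg"
  shows "((\<lambda>t. \<gamma> t ** Y ** mat_adj (\<gamma> t)) has_vector_derivative comm X Y) (at 0 within S)"
proof -
  have "((\<lambda>t. mat_adj (\<gamma> t)) has_vector_derivative mat_adj X) (at 0 within S)"
    by (rule bounded_linear.has_vector_derivative[OF bounded_linear_mat_adj assms(1)])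
  moreover have "((\<lambda>t. \<gamma> t ** Y) has_vector_derivative X ** Y) (at 0 within S)"
    by (rule bounded_linear.has_vector_derivative[OF mm.bounded_linear_left assms(1)])
  ultimately have "((\<lambda>t. \<gamma> t ** Y ** mat_adj (\<gamma> t)) has_vector_derivative 
      (\<gamma> 0 ** Y ** mat_adj X + X ** Y ** mat_adj (\<gamma> 0))) (at 0 within S)"
    by (intro mm.has_vector_derivative)
  moreover have "mat_adj X = - X" using assms(3) by (simp add: u_alg_def skew_hermitian_def)
  ultimately show ?thesis by (simp add: assms(2) comm_def matrix_ring_simps)
qed

lemma Ad_u_alg: "X \<in> u_alg \<Longrightarrow> g ** X ** mat_adj g \<in> u_alg"
  by (simp add: u_alg_def skew_hermitian_def mat_adj_mult matrix_ring_simps matrix_mul_assoc)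

lemma linear_Ad: "linear (\<lambda>X. g ** X ** mat_adj g)" for g :: "complex^'n^'n"
  by (rule linearI) (simp_all add: matrix_ring_simps)

text \<open>Only forward flows are put into \<open>S\<close>, as a control system with drift cannot
  be run backwards. The generators are required to give all of u(n); the traceless case is reduced
  to this one later by adjoining the scalars.\<close>

locale unitary_semigroup =
  fixes S :: "(complex^'n^'n) set" and \<Gamma> :: "(complex^'n^'n) set"
  assumes S_unitary: "S \<subseteq> unitary_group" and S_one: "mat 1 \<in> S"
    and S_mult: "\<And>a b. a \<in> S \<Longrightarrow> b \<in> S \<Longrightarrow> a ** b \<in> S"
    and \<Gamma>_skew: "\<Gamma> \<subseteq> u_alg"
    and evol_mem: "\<And>W d t. W \<in> unitary_group \<Longrightarrow> gen W d \<in> \<Gamma> \<Longrightarrow> 0 \<le> t \<Longrightarrow> evol W d t \<in> S"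
    and \<Gamma>_generates: "u_alg \<subseteq> lie_generated \<Gamma>"
begin

section \<open>Density: tangent vectors of the closure of the semigroup\<close>

lemma closure_unitary: "g \<in> closure S \<Longrightarrow> g \<in> unitary_group"
  using closure_minimal[OF S_unitary closed_unitary_group] by blast

lemma closure_mult:
  assumes "a \<in> closure S" "b \<in> closure S" shows "a ** b \<in> closure S"
proof -
  obtain f g where fg: "\<And>n. f n \<in> S" "f \<longlonglongrightarrow> a" "\<And>n. g n \<in> S" "g \<longlonglongrightarrow> b"
    using assms unfolding closure_sequential by blast
  then have "(\<lambda>n. f n ** g n) \<longlonglongrightarrow> a ** b" by (intro mm.tendsto)
  then show ?thesis unfolding closure_sequential using fg S_mult
    by (intro exI[of _ "\<lambda>n. f n ** g n"]) auto
qed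

lemma closure_mpow: "g \<in> closure S \<Longrightarrow> mpow g n \<in> closure S"
  using S_one closure_subset[of S] by (intro mpow_closed) (auto intro: closure_mult)

text \<open>Recurrence: a convergent subsequence of the powers of \<open>g\<close> contains two
  close members, and cancelling the smaller power isometrically shows that some power g^(k+1) is
  close to 1. Then g^k is close to the inverse of \<open>g\<close>.\<close>

lemma closure_adj:
  assumes g: "g \<in> closure S" shows "mat_adj g \<in> closure S"
proof -
  have gu: "g \<in> unitary_group" using closure_unitary g by blast
  have "compact (closure S)"
    using compact_Int_closed[OF compact_unitary_group closed_closure[of S]] closure_unitary
    by (metis Int_absorb1 subsetI)
  then obtain l r where r: "strict_mono (r :: nat \<Rightarrow> nat)" "((\<lambda>n. mpow g n) \<circ> r) \<longlonglongrightarrow> l"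
    using closure_mpow[OF g] unfolding compact_def by metis
  have "mat_adj g \<in> closure (closure S)"
    unfolding closure_approachable[of _ "closure S"]
  proof (intro allI impI)
    fix e :: real assume "e > 0"
    have "Cauchy ((\<lambda>n. mpow g n) \<circ> r)" using r(2) LIMSEQ_imp_Cauchy by blast
    then obtain N where N: "\<And>m n. m \<ge> N \<Longrightarrow> n \<ge> N \<Longrightarrow> dist (mpow g (r m)) (mpow g (r n)) < e"
      using \<open>e > 0\<close> unfolding Cauchy_def comp_def by meson
    define k where "k = r (Suc N) - r N - 1"
    have "r N < r (Suc N)" using r(1) by (simp add: strict_mono_def)
    then have eq: "r (Suc N) = r N + Suc k" by (simp add: k_def)
    have "mpow g (r (Suc N)) - mpow g (r N) = mpow g (r N) ** (g ** (mpow g k - mat_adj g))"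
      unfolding eq mpow_add by (simp add: matrix_ring_simps unitary_right[OF gu])
    then have "norm (mpow g (r (Suc N)) - mpow g (r N)) = norm (mpow g k - mat_adj g)"
      by (simp add: unitary_norm_mult_left mpow_unitary gu)
    then have "dist (mpow g k) (mat_adj g) < e" using N[of "Suc N" N] by (simp add: dist_norm)
    then show "\<exists>y\<in>closure S. dist y (mat_adj g) < e" using closure_mpow[OF g] by blast
  qed
  then show ?thesis by simp
qed

text \<open>Curves are only asked for a one-sided derivative at 0. This is all that forward flows
  provide, and it survives products, adjoints and conjugation of curves.\<close>

definition tangent :: "(complex^'n^'n) set" where
  "tangent = {X \<in> u_alg. \<exists>\<gamma>. (\<forall>t\<ge>0. \<gamma> t \<in> closure S) \<and> \<gamma> 0 = mat 1 \<and>
     (\<gamma> has_vector_derivative X) (at 0 within {0..})}"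

lemma tangentI:
  "X \<in> u_alg \<Longrightarrow> (\<And>t. t \<ge> 0 \<Longrightarrow> \<gamma> t \<in> closure S) \<Longrightarrow> \<gamma> 0 = mat 1 \<Longrightarrow> 
   (\<gamma> has_vector_derivative X) (at 0 within {0..}) \<Longrightarrow> X \<in> tangent"
  unfolding tangent_def by blast

lemma tangentE:
  assumes "X \<in> tangent"
  obtains \<gamma> where "X \<in> u_alg" "\<And>t. t \<ge> 0 \<Longrightarrow> \<gamma> t \<in> closure S" "\<gamma> 0 = mat 1" 
    "(\<gamma> has_vector_derivative X) (at 0 within {0..})"
  using assms unfolding tangent_def by blast

text \<open>Sums arise from products of curves, nonnegative multiples from reparametrization, and
  negatives from adjoint curves, which stay in the closure by recurrence.\<close>

lemma subspace_tangent: "subspace tangent"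
proof -
  have one: "mat 1 \<in> closure S" using S_one closure_subset by blast
  have zero: "0 \<in> tangent"
    by (rule tangentI[of _ "\<lambda>t. mat 1"]) (use one in \<open>auto intro: subspace_0 subspace_u_alg derivative_eq_intros\<close>)
  have add: "X + Y \<in> tangent" if XY: "X \<in> tangent" "Y \<in> tangent" for X Y
  proof -
    obtain \<gamma> where g: "X \<in> u_alg" "\<And>t. t \<ge> 0 \<Longrightarrow> \<gamma> t \<in> closure S" "\<gamma> 0 = mat 1" 
      "(\<gamma> has_vector_derivative X) (at 0 within {0..})" using tangentE[OF XY(1)] by blast
    obtain \<eta> where h: "Y \<in> u_alg" "\<And>t. t \<ge> 0 \<Longrightarrow> \<eta> t \<in> closure S" "\<eta> 0 = mat 1" 
      "(\<eta> has_vector_derivative Y) (at 0 within {0..})" using tangentE[OF XY(2)] by blast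
    have "((\<lambda>t. \<gamma> t ** \<eta> t) has_vector_derivative (\<gamma> 0 ** Y + X ** \<eta> 0)) (at 0 within {0..})"
      by (intro mm.has_vector_derivative g h)
    then have "((\<lambda>t. \<gamma> t ** \<eta> t) has_vector_derivative (X + Y)) (at 0 within {0..})"
      by (simp add: g h add.commute)
    then show ?thesis
      by (rule tangentI[rotated -1]) (use g h in \<open>auto intro: subspace_add subspace_u_alg closure_mult\<close>)
  qed
  have pos: "c *\<^sub>R X \<in> tangent" if X: "X \<in> tangent" and c: "c \<ge> 0" for X c
  proof -
    obtain \<gamma> where g: "X \<in> u_alg" "\<And>t. t \<ge> 0 \<Longrightarrow> \<gamma> t \<in> closure S" "\<gamma> 0 = mat 1" 
      "(\<gamma> has_vector_derivative X) (at 0 within {0..})" using tangentE[OF X] by blast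
    have "((\<lambda>t. c * t) has_vector_derivative c) (at 0 within {0..})"
      by (auto intro!: derivative_eq_intros)
    moreover have "(\<gamma> has_vector_derivative X) (at (c * 0) within (\<lambda>t. c * t) ` {0..})"
      using g(4) c by (auto intro: has_vector_derivative_within_subset)
    ultimately have "(\<gamma> \<circ> (\<lambda>t. c * t) has_vector_derivative c *\<^sub>R X) (at 0 within {0..})"
      by (rule vector_diff_chain_within)
    then show ?thesis
      by (rule tangentI[rotated -1]) (use g c in \<open>auto intro: subspace_scale subspace_u_alg\<close>)
  qed
  have neg: "- X \<in> tangent" if X: "X \<in> tangent" for X
  proof -
    obtain \<gamma> where g: "X \<in> u_alg" "\<And>t. t \<ge> 0 \<Longrightarrow> \<gamma> t \<in> closure S" "\<gamma> 0 = mat 1" 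
      "(\<gamma> has_vector_derivative X) (at 0 within {0..})" using tangentE[OF X] by blast
    have "((\<lambda>t. mat_adj (\<gamma> t)) has_vector_derivative mat_adj X) (at 0 within {0..})"
      by (rule bounded_linear.has_vector_derivative[OF bounded_linear_mat_adj g(4)])
    moreover have "mat_adj X = - X" using g(1) by (simp add: u_alg_def skew_hermitian_def)
    ultimately have "((\<lambda>t. mat_adj (\<gamma> t)) has_vector_derivative - X) (at 0 within {0..})" by simp
    then show ?thesis
      by (rule tangentI[rotated -1]) (use g in \<open>auto intro: subspace_neg subspace_u_alg closure_adj\<close>)
  qed
  have "c *\<^sub>R X \<in> tangent" if "X \<in> tangent" for c X
    using pos[OF that, of c] pos[OF neg[OF that], of "- c"] by (cases "c \<ge> 0") auto
  then show ?thesis using zero add by (simp add: subspace_def)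
qed

text \<open>Conjugating the curve of \<open>Y\<close> by \<open>\<gamma> t\<close> shows that the
  conjugates of \<open>Y\<close> are tangent vectors. They move in a closed subspace, and their
  derivative at 0 is the bracket.\<close>

lemma comm_tangent:
  assumes "X \<in> tangent" "Y \<in> tangent" shows "comm X Y \<in> tangent"
proof -
  obtain \<gamma> where g: "X \<in> u_alg" "\<And>t. t \<ge> 0 \<Longrightarrow> \<gamma> t \<in> closure S" "\<gamma> 0 = mat 1" 
    "(\<gamma> has_vector_derivative X) (at 0 within {0..})" using tangentE[OF assms(1)] by blast
  obtain \<eta> where h: "Y \<in> u_alg" "\<And>t. t \<ge> 0 \<Longrightarrow> \<eta> t \<in> closure S" "\<eta> 0 = mat 1" 
    "(\<eta> has_vector_derivative Y) (at 0 within {0..})" using tangentE[OF assms(2)] by blast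
  have "\<gamma> t ** Y ** mat_adj (\<gamma> t) \<in> tangent" if t: "t \<ge> 0" for t
  proof (rule tangentI[of _ "\<lambda>s. \<gamma> t ** \<eta> s ** mat_adj (\<gamma> t)"])
    show "\<gamma> t ** Y ** mat_adj (\<gamma> t) \<in> u_alg" using h(1) by (rule Ad_u_alg)
    show "\<gamma> t ** \<eta> s ** mat_adj (\<gamma> t) \<in> closure S" if "s \<ge> 0" for s
      using that t g(2) h(2) by (intro closure_mult closure_adj) auto
    show "\<gamma> t ** \<eta> 0 ** mat_adj (\<gamma> t) = mat 1"
      using closure_unitary[OF g(2)[OF t]] by (simp add: h(3) unitary_right)
    show "((\<lambda>s. \<gamma> t ** \<eta> s ** mat_adj (\<gamma> t)) has_vector_derivative \<gamma> t ** Y ** mat_adj (\<gamma> t)) (at 0 within {0..})"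
      by (intro bounded_linear.has_vector_derivative[OF mm.bounded_linear_left]
        bounded_linear.has_vector_derivative[OF mm.bounded_linear_right] h(4))
  qed
  then show ?thesis
    by (rule derivative_in_subspace[OF subspace_tangent _ Ad_has_vector_derivative[OF g(4,3,1)]])
qed

lemma u_alg_subset_tangent: "u_alg \<subseteq> tangent"
proof -
  have "\<Gamma> \<subseteq> tangent"
  proof
    fix X assume X: "X \<in> \<Gamma>"
    then obtain W d where W: "W \<in> unitary_group" "X = gen W d" using gen_exists \<Gamma>_skew by blast
    show "X \<in> tangent"
    proof (rule tangentI[of _ "evol W d"])
      show "(evol W d has_vector_derivative X) (at 0 within {0..})"
        using evol_has_vector_derivative_0[OF W(1)] by (simp add: W)
      show "evol W d t \<in> closure S" if "t \<ge> 0" for t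
        using evol_mem[OF W(1) _ that] X closure_subset[of S] by (auto simp: W)
    qed (use W X \<Gamma>_skew in \<open>auto simp: evol_0\<close>)
  qed
  from lie_generated_minimal[OF this subspace_tangent comm_tangent] show ?thesis
    using \<Gamma>_generates by blast
qed

text \<open>A curve with the velocity of a one-parameter group differs from it by o(t). Taking the
  n-th power at time 1/n multiplies this error by at most n, so the powers converge to
  \<open>g\<close>.\<close>

lemma closure_eq: "closure S = unitary_group"
proof
  show "closure S \<subseteq> unitary_group" using closure_unitary by blast
  show "unitary_group \<subseteq> closure S"
  proof
    fix g :: "complex^'n^'n" assume "g \<in> unitary_group"
    then obtain W \<theta> where W: "W \<in> unitary_group" "g = evol W \<theta> 1" using unitary_evol by blast
    have "gen W \<theta> \<in> tangent" using u_alg_subset_tangent gen_skew by blast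
    then obtain \<gamma> where g: "\<And>t. t \<ge> 0 \<Longrightarrow> \<gamma> t \<in> closure S" "\<gamma> 0 = mat 1" 
      "(\<gamma> has_vector_derivative gen W \<theta>) (at 0 within {0..})" using tangentE by blast
    have "(evol W \<theta> has_vector_derivative gen W \<theta>) (at 0 within {0..})"
      by (rule evol_has_vector_derivative_0[OF W(1)])
    then have "((\<lambda>t. \<gamma> t - evol W \<theta> t) has_vector_derivative (gen W \<theta> - gen W \<theta>)) (at 0 within {0..})"
      by (intro has_vector_derivative_diff g)
    from difference_quotient_tendsto[OF this]
    have lim: "((\<lambda>t. (1 / t) *\<^sub>R (\<gamma> t - evol W \<theta> t)) \<longlongrightarrow> 0) (at_right 0)"
      by (simp add: g evol_0 W)
    have "filterlim (\<lambda>n. 1 / real (Suc n)) (at_right 0) sequentially"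
      using LIMSEQ_inverse_real_of_nat by (simp add: filterlim_at inverse_eq_divide)
    from filterlim_compose[OF lim this]
    have lim': "(\<lambda>n. real (Suc n) *\<^sub>R (\<gamma> (1 / real (Suc n)) - evol W \<theta> (1 / real (Suc n)))) \<longlonglongrightarrow> 0"
      by simp
    have "g \<in> closure (closure S)"
      unfolding closure_approachable[of _ "closure S"]
    proof (intro allI impI)
      fix e :: real assume "e > 0"
      then obtain n where n: "norm (real (Suc n) *\<^sub>R (\<gamma> (1 / real (Suc n)) - evol W \<theta> (1 / real (Suc n)))) < e"
        using lim' unfolding lim_sequentially by (metis dist_0_norm dist_commute order_refl)
      let ?a = "\<gamma> (1 / real (Suc n))" and ?b = "evol W \<theta> (1 / real (Suc n))"
      have a: "?a \<in> closure S" by (intro g) simp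
      have "mpow ?b (Suc n) = g" unfolding mpow_evol[OF W(1)] by (simp add: W)
      then have "norm (mpow ?a (Suc n) - g) \<le> real (Suc n) * norm (?a - ?b)"
        using mpow_diff_le[OF closure_unitary[OF a] evol_unitary[OF W(1)], of "Suc n"] by metis
      also have "\<dots> < e" using n by simp
      finally show "\<exists>y\<in>closure S. dist y g < e" using closure_mpow[OF a] unfolding dist_norm by blast
    qed
    then show "g \<in> closure S" by simp
  qed
qed

text \<open>The span of the transported velocities is invariant under conjugation by
  \<open>S\<close>, hence, being closed, under conjugation by the closure, which is the whole
  unitary group. Differentiating along one-parameter groups makes it closed under brackets. Density
  thus replaces iterated brackets by directions in which the semigroup really moves.\<close>

lemma orbit_span: "u_alg \<subseteq> span {s ** X ** mat_adj s | s X. s \<in> S \<and> X \<in> \<Gamma>}" (is "_ \<subseteq> span ?G")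
proof -
  have inv_S: "s ** Y ** mat_adj s \<in> span ?G" if s: "s \<in> S" and Y: "Y \<in> span ?G" for s Y
  proof -
    have "(\<lambda>Y. s ** Y ** mat_adj s) ` ?G \<subseteq> span ?G"
    proof clarify
      fix s' X assume "s' \<in> S" "X \<in> \<Gamma>"
      then have "(s ** s') ** X ** mat_adj (s ** s') \<in> ?G" using S_mult[OF s] by blast
      then show "s ** (s' ** X ** mat_adj s') ** mat_adj s \<in> span ?G"
        by (auto simp: mat_adj_mult matrix_mul_assoc intro: span_base)
    qed
    then have "(\<lambda>Y. s ** Y ** mat_adj s) ` span ?G \<subseteq> span ?G"
      unfolding linear_span_image[OF linear_Ad, symmetric] by (simp add: span_minimal)
    then show ?thesis using Y by blast
  qed
  have inv: "g ** Y ** mat_adj g \<in> span ?G" if g: "g \<in> unitary_group" and Y: "Y \<in> span ?G" for g Y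
  proof -
    let ?C = "(\<lambda>g. g ** Y ** mat_adj g) -` span ?G"
    have "closed ?C"
      by (rule closed_vimage[OF closed_span])
         (intro mm.continuous_on bounded_linear.continuous_on[OF bounded_linear_mat_adj] continuous_on_id continuous_on_const)
    moreover have "S \<subseteq> ?C" using inv_S Y by auto
    ultimately have "closure S \<subseteq> ?C" by (simp add: closure_minimal)
    then show ?thesis using g closure_eq by blast
  qed
  have "?G \<subseteq> u_alg" using Ad_u_alg \<Gamma>_skew by blast
  then have sub: "span ?G \<subseteq> u_alg" by (simp add: span_minimal subspace_u_alg)
  have "lie_generated \<Gamma> \<subseteq> span ?G"
  proof (rule lie_generated_minimal)
    show "\<Gamma> \<subseteq> span ?G"
    proof
      fix X assume "X \<in> \<Gamma>"
      then have "mat 1 ** X ** mat_adj (mat 1) \<in> ?G" using S_one by blast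
      then show "X \<in> span ?G" by (simp add: span_base)
    qed
    fix A B assume A: "A \<in> span ?G" and B: "B \<in> span ?G"
    then obtain W d where W: "W \<in> unitary_group" "A = gen W d" using gen_exists sub by blast
    have "(evol W d has_vector_derivative A) (at 0 within {0..})"
      using evol_has_vector_derivative_0[OF W(1)] by (simp add: W)
    from Ad_has_vector_derivative[OF this, of B] have
      "((\<lambda>t. evol W d t ** B ** mat_adj (evol W d t)) has_vector_derivative comm A B) (at 0 within {0..})"
      using W A sub by (auto simp: evol_0)
    then show "comm A B \<in> span ?G"
      by (rule derivative_in_subspace[OF subspace_span inv[OF evol_unitary[OF W(1)] B]])
  qed simp
  then show ?thesis using \<Gamma>_generates by blast
qed

text \<open>A subspace is charted if it is covered, to first order at some point of \<open>S\<close>, by a chart with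
  values in \<open>S\<close>.\<close>

definition charted :: "(complex^'n^'n) set \<Rightarrow> bool" where
  "charted V \<longleftrightarrow> (\<exists>\<Phi> \<pi> \<epsilon>. continuous_on UNIV \<Phi> \<and> \<epsilon> > 0 \<and> (\<forall>Y. norm Y < \<epsilon> \<longrightarrow> \<Phi> Y \<in> S) \<and>
     linear \<pi> \<and> (\<forall>Y\<in>V. \<pi> Y = Y) \<and> (\<Phi> has_derivative (\<lambda>Y. \<pi> Y ** \<Phi> 0)) (at (0::complex^'n^'n)))"

lemma charted_zero: "charted {0}"
  unfolding charted_def using S_one
  by (intro exI[of _ "\<lambda>_. mat 1"] exI[of _ "\<lambda>_. 0"] exI[of _ 1]) (auto simp: linear_zero)

text \<open>Append to the chart a fixed \<open>s\<close> and the flow of some \<open>X\<close> in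
  \<open>\<Gamma>\<close> for a variable time. At the base point the new parameter moves with
  velocity \<open>Z\<close>, the conjugate of \<open>X\<close> by b s, and by
  \<open>orbit_span\<close> this can be chosen outside \<open>V\<close>.\<close>

lemma charted_extend:
  assumes V: "subspace V" "charted V" and nV: "\<not> u_alg \<subseteq> V"
  obtains V' where "subspace V'" "charted V'" "dim V' = Suc (dim V)"
proof -
  obtain \<Phi> \<pi> \<epsilon> where \<Phi>: "continuous_on UNIV \<Phi>" "\<epsilon> > 0" "\<And>Y. norm Y < \<epsilon> \<Longrightarrow> \<Phi> Y \<in> S"
    "linear \<pi>" "\<And>Y. Y \<in> V \<Longrightarrow> \<pi> Y = Y" "(\<Phi> has_derivative (\<lambda>Y. \<pi> Y ** \<Phi> 0)) (at 0)"
    using V(2) unfolding charted_def by blast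
  define b where "b = \<Phi> 0"
  have bS: "b \<in> S" using \<Phi>(2,3) by (simp add: b_def)
  then have bU: "b \<in> unitary_group" using S_unitary by blast
  \<comment> \<open>If all conjugates by b s were in \<open>V\<close>, conjugation by
    \<open>b\<close> would map the span of the orbit, hence all of \<open>u_alg\<close>, into
    \<open>V\<close>. But it maps \<open>u_alg\<close> onto itself.\<close>
  obtain s X where s: "s \<in> S" and X: "X \<in> \<Gamma>" and nZ: "(b ** s) ** X ** mat_adj (b ** s) \<notin> V"
  proof (rule ccontr)
    assume n: "\<not> thesis"
    let ?G = "{s ** X ** mat_adj s | s X. s \<in> S \<and> X \<in> \<Gamma>}"
    have "(\<lambda>Y. b ** Y ** mat_adj b) ` ?G \<subseteq> V"
    proof clarify
      fix s X assume "s \<in> S" "X \<in> \<Gamma>"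
      then have "(b ** s) ** X ** mat_adj (b ** s) \<in> V" using n that by blast
      then show "b ** (s ** X ** mat_adj s) ** mat_adj b \<in> V"
        by (simp add: mat_adj_mult matrix_mul_assoc)
    qed
    then have *: "(\<lambda>Y. b ** Y ** mat_adj b) ` span ?G \<subseteq> V"
      unfolding linear_span_image[OF linear_Ad, symmetric] by (simp add: span_minimal V(1))
    have "u_alg \<subseteq> V"
    proof
      fix Y :: "complex^'n^'n" assume "Y \<in> u_alg"
      then have "mat_adj b ** Y ** mat_adj (mat_adj b) \<in> span ?G" using Ad_u_alg orbit_span by blast
      then have "b ** (mat_adj b ** Y ** b) ** mat_adj b \<in> V" using * by auto
      then show "Y \<in> V" using unitary_right[OF bU] unitary_right'[OF bU] by (simp flip: matrix_mul_assoc)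
    qed
    then show False using nV by simp
  qed
  define Z where "Z = (b ** s) ** X ** mat_adj (b ** s)"
  obtain W d where W: "W \<in> unitary_group" "X = gen W d" using gen_exists X \<Gamma>_skew by blast
  have ES: "evol W d t \<in> S" if "t \<ge> 0" for t using evol_mem[OF W(1) _ that] X W by simp
  have ZV: "Z \<notin> span V" using nZ V(1) by (simp add: Z_def span_eq_iff[THEN iffD2])
  obtain w where w: "w \<noteq> 0" "w \<in> span (insert Z V)" "\<And>y. y \<in> span V \<Longrightarrow> orthogonal w y"
  proof (rule orthogonal_to_subspace_exists_gen[of V "insert Z V"])
    show "span V \<subset> span (insert Z V)"
      using ZV by (metis insertI1 psubsetI span_base span_mono subset_insertI)
  qed auto
  have wZ: "inner w Z \<noteq> 0"
  proof
    assume "inner w Z = 0"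
    then have "orthogonal w y" if "y \<in> insert Z V" for y
      using that w(3) span_base by (auto simp: orthogonal_def)
    then have "orthogonal w w" using orthogonal_to_span[OF w(2)] by blast
    then show False using w(1) by (simp add: orthogonal_def)
  qed
  \<comment> \<open>\<open>\<kappa>\<close> is the coordinate along \<open>Z\<close>: it vanishes on
    \<open>V\<close> and is 1 at \<open>Z\<close>. Accordingly \<open>\<rho>\<close> fixes
    \<open>V\<close> and kills \<open>Z\<close>, so old and new parameters are separated.\<close>
  define \<kappa> where "\<kappa> Y = inner w Y / inner w Z" for Y
  have lin\<kappa>: "linear \<kappa>" by (rule linearI) (simp_all add: \<kappa>_def inner_add_right add_divide_distrib)
  have \<kappa>V: "\<kappa> Y = 0" if "Y \<in> V" for Y using w(3) that span_base by (auto simp: \<kappa>_def orthogonal_def)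
  have \<kappa>Z: "\<kappa> Z = 1" using wZ by (simp add: \<kappa>_def)
  define \<rho> where "\<rho> Y = Y - \<kappa> Y *\<^sub>R Z" for Y
  have lin\<rho>: "linear \<rho>"
    by (rule linearI) (simp_all add: \<rho>_def linear_add[OF lin\<kappa>] linear_scale[OF lin\<kappa>] algebra_simps)
  have bl: "bounded_linear \<kappa>" "bounded_linear \<rho>"
    using lin\<kappa> lin\<rho> by (simp_all add: linear_conv_bounded_linear)
  \<comment> \<open>Running the flow for time 1 + \<kappa> Y leaves room to vary the time in both
    directions while it stays nonnegative.\<close>
  define \<Phi>' where "\<Phi>' Y = \<Phi> (\<rho> Y) ** (s ** evol W d (1 + \<kappa> Y))" for Y
  define \<pi>' where "\<pi>' Y = \<pi> (\<rho> Y) + \<kappa> Y *\<^sub>R Z" for Y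
  have "linear (\<pi> \<circ> \<rho>)" using lin\<rho> \<Phi>(4) by (rule linear_compose)
  then have lin\<pi>': "linear \<pi>'"
    unfolding \<pi>'_def comp_def
    by (intro linear_compose_add) (auto intro!: linearI simp: linear_add[OF lin\<kappa>] linear_scale[OF lin\<kappa>] algebra_simps)
  have cont_evol: "continuous_on UNIV (evol W d)"
    using evol_has_vector_derivative[OF W(1)] by (intro continuous_at_imp_continuous_on ballI has_vector_derivative_continuous) blast
  have cont: "continuous_on UNIV \<Phi>'"
    unfolding \<Phi>'_def
    by (intro mm.continuous_on continuous_on_const continuous_on_compose2[OF \<Phi>(1)] continuous_on_compose2[OF cont_evol]
        continuous_on_add linear_continuous_on bl) auto
  have at0: "\<kappa> 0 = 0" "\<rho> 0 = 0" using linear_0[OF lin\<kappa>] linear_0[OF lin\<rho>] by auto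
  obtain \<epsilon>' where \<epsilon>': "\<epsilon>' > 0" "\<And>Y. norm Y < \<epsilon>' \<Longrightarrow> norm (\<rho> Y) < \<epsilon> \<and> \<bar>\<kappa> Y\<bar> < 1"
  proof -
    have "isCont \<rho> 0" "isCont \<kappa> 0" using bl linear_continuous_at by blast+
    then have "(\<rho> \<longlongrightarrow> 0) (at 0)" "(\<kappa> \<longlongrightarrow> 0) (at 0)" using at0 by (auto simp: isCont_def)
    then have "\<forall>\<^sub>F Y in at 0. norm (\<rho> Y) < \<epsilon>" "\<forall>\<^sub>F Y in at 0. \<bar>\<kappa> Y\<bar> < 1"
      using \<Phi>(2) by (auto simp: tendsto_iff dest: spec[of _ \<epsilon>] spec[of _ 1])
    then have "\<forall>\<^sub>F Y in at 0. norm (\<rho> Y) < \<epsilon> \<and> \<bar>\<kappa> Y\<bar> < 1" by (rule eventually_conj)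
    then obtain e where e: "e > 0" "\<And>Y. Y \<noteq> 0 \<Longrightarrow> norm Y < e \<Longrightarrow> norm (\<rho> Y) < \<epsilon> \<and> \<bar>\<kappa> Y\<bar> < 1"
      unfolding eventually_at by (auto simp: dist_norm)
    have "norm (\<rho> Y) < \<epsilon> \<and> \<bar>\<kappa> Y\<bar> < 1" if "norm Y < e" for Y
      using e(2)[of Y] that at0 \<Phi>(2) by (cases "Y = 0") auto
    then show thesis using that e(1) by blast
  qed
  have in_S: "\<Phi>' Y \<in> S" if "norm Y < \<epsilon>'" for Y
    unfolding \<Phi>'_def using \<epsilon>'(2)[OF that] by (intro S_mult \<Phi>(3) s ES) auto
  have b': "\<Phi>' 0 = b ** (s ** evol W d 1)" by (simp add: \<Phi>'_def at0 b_def)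
  have sU: "s \<in> unitary_group" using s S_unitary by blast
  have deriv: "(\<Phi>' has_derivative (\<lambda>Y. \<pi>' Y ** \<Phi>' 0)) (at 0)"
  proof -
    have d1: "((\<lambda>Y. \<Phi> (\<rho> Y)) has_derivative (\<lambda>Y. \<pi> (\<rho> Y) ** b)) (at 0)"
      using has_derivative_compose[of \<rho> \<rho> 0 UNIV \<Phi> "\<lambda>Y. \<pi> Y ** b"] \<Phi>(6) at0(2)
        bounded_linear_imp_has_derivative[OF bl(2)] by (simp add: b_def)
    have "((\<lambda>Y. 1 + \<kappa> Y) has_derivative \<kappa>) (at 0)"
      using bounded_linear_imp_has_derivative[OF bl(1)] by (auto intro!: derivative_eq_intros)
    moreover have "(evol W d has_derivative (\<lambda>h. h *\<^sub>R (X ** evol W d 1))) (at (1 + \<kappa> 0))"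
      using evol_has_vector_derivative[OF W(1), of d 1 UNIV] by (simp add: at0 W has_vector_derivative_def)
    ultimately have "((\<lambda>Y. evol W d (1 + \<kappa> Y)) has_derivative (\<lambda>Y. \<kappa> Y *\<^sub>R (X ** evol W d 1))) (at 0)"
      using has_derivative_compose[of "\<lambda>Y. 1 + \<kappa> Y" \<kappa> 0 UNIV "evol W d"] by simp
    then have d2: "((\<lambda>Y. s ** evol W d (1 + \<kappa> Y)) has_derivative (\<lambda>Y. s ** (\<kappa> Y *\<^sub>R (X ** evol W d 1)))) (at 0)"
      by (rule bounded_linear.has_derivative[OF mm.bounded_linear_right])
    have "(\<Phi>' has_derivative (\<lambda>Y. \<Phi> (\<rho> 0) ** (s ** (\<kappa> Y *\<^sub>R (X ** evol W d 1))) + 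
        \<pi> (\<rho> Y) ** b ** (s ** evol W d (1 + \<kappa> 0)))) (at 0)"
      unfolding \<Phi>'_def using mm.FDERIV[OF d1 d2] by simp
    moreover have "\<Phi> (\<rho> 0) ** (s ** (\<kappa> Y *\<^sub>R (X ** evol W d 1))) + 
        \<pi> (\<rho> Y) ** b ** (s ** evol W d (1 + \<kappa> 0)) = \<pi>' Y ** \<Phi>' 0" for Y
    proof -
      have "Z ** (b ** (s ** evol W d 1)) = b ** (s ** (X ** evol W d 1))"
        by (simp add: Z_def mat_adj_mult unitary_left'[OF bU] unitary_left'[OF sU] flip: matrix_mul_assoc)
      then show ?thesis
        by (simp add: b' \<pi>'_def at0 matrix_ring_simps b_def[symmetric] matrix_mul_assoc)
    qed
    ultimately show ?thesis by simp
  qed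
  have fixed: "\<pi>' Y = Y" if "Y \<in> span (insert Z V)" for Y
  proof -
    have "\<pi>' Y = id Y"
    proof (rule linear_eq_on_span[OF lin\<pi>' linear_id _ that])
      fix Y assume "Y \<in> insert Z V"
      then show "\<pi>' Y = id Y"
        using \<Phi>(5) \<kappa>V \<kappa>Z linear_0[OF \<Phi>(4)] by (auto simp: \<pi>'_def \<rho>_def)
    qed
    then show ?thesis by simp
  qed
  have "charted (span (insert Z V))"
    unfolding charted_def using cont \<epsilon>'(1) in_S lin\<pi>' fixed deriv by blast
  moreover have "dim (span (insert Z V)) = Suc (dim V)" using ZV by (simp add: dim_insert)
  ultimately show thesis using that subspace_span by blast
qed

lemma charted_u_alg: obtains V where "charted V" "u_alg \<subseteq> V"
proof -
  have "\<exists>V. subspace V \<and> charted V \<and> (u_alg \<subseteq> V \<or> k \<le> dim V)" for k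
  proof (induction k)
    case 0
    then show ?case using charted_zero subspace_0[OF subspace_UNIV] by (metis subspace_single_0 zero_le)
  next
    case (Suc k)
    then obtain V where V: "subspace V" "charted V" "u_alg \<subseteq> V \<or> k \<le> dim V" by blast
    show ?case
    proof (cases "u_alg \<subseteq> V")
      case False
      then obtain V' where "subspace V'" "charted V'" "dim V' = Suc (dim V)"
        using charted_extend[OF V(1,2)] by blast
      then show ?thesis using V(3) False by auto
    qed (use V in blast)
  qed
  from this[of "Suc DIM(complex^'n^'n)"] show thesis
    using that dim_subset_UNIV not_less_eq_eq by metis
qed

text \<open>The chart covers only skew-Hermitian directions. Multiplying by 1 plus the Hermitian
  part gives a map \<open>f\<close> of the full matrix space whose derivative X \<mapsto> X b is
  invertible, so its image contains a ball. On the unitary points of that ball the additional factor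
  is trivial.\<close>

lemma interior_point: obtains b \<eta> where "b \<in> S" "\<eta> > 0" "\<And>g. g \<in> unitary_group \<Longrightarrow> norm (g - b) < \<eta> \<Longrightarrow> g \<in> S"
proof -
  obtain V where V: "charted V" "u_alg \<subseteq> V" using charted_u_alg by blast
  obtain \<Phi> \<pi> \<epsilon> where \<Phi>: "continuous_on UNIV \<Phi>" "\<epsilon> > 0" "\<And>Y. norm Y < \<epsilon> \<Longrightarrow> \<Phi> Y \<in> S"
    "linear \<pi>" "\<And>Y. Y \<in> V \<Longrightarrow> \<pi> Y = Y" "(\<Phi> has_derivative (\<lambda>Y. \<pi> Y ** \<Phi> 0)) (at 0)"
    using V(1) unfolding charted_def by blast
  define b where "b = \<Phi> 0"
  have bS: "b \<in> S" using \<Phi>(2,3) by (simp add: b_def)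
  then have bU: "b \<in> unitary_group" using S_unitary by blast
  define he where "he X = (1/2) *\<^sub>R (X + mat_adj X)" for X :: "complex^'n^'n"
  define sk where "sk X = (1/2) *\<^sub>R (X - mat_adj X)" for X :: "complex^'n^'n"
  have lin: "linear he" "linear sk"
    by (auto intro!: linearI simp: he_def sk_def mat_adj_add mat_adj_scaleR algebra_simps)
  then have bl: "bounded_linear he" "bounded_linear sk" by (simp_all add: linear_conv_bounded_linear)
  have sum: "he X + sk X = X" for X by (simp add: he_def sk_def vec_eq_iff algebra_simps)
  have nle: "norm (he X) \<le> norm X" "norm (sk X) \<le> norm X" for X
    using norm_triangle_ineq[of X "mat_adj X"] norm_triangle_ineq4[of X "mat_adj X"] by (simp_all add: he_def sk_def)
  have sku: "sk X \<in> u_alg" for X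
    by (simp add: sk_def u_alg_def skew_hermitian_def mat_adj_scaleR mat_adj_diff algebra_simps)
  have heh: "mat_adj (he X) = he X" for X
    by (simp add: he_def mat_adj_scaleR mat_adj_add add.commute)
  define f where "f X = (mat 1 + he X) ** \<Phi> (sk X)" for X
  have at0: "he 0 = 0" "sk 0 = 0" using linear_0 lin by auto
  have f0: "f 0 = b" by (simp add: f_def at0 b_def)
  have cont: "continuous_on UNIV f"
    unfolding f_def
    by (intro mm.continuous_on continuous_on_add continuous_on_const linear_continuous_on bl 
        continuous_on_compose2[OF \<Phi>(1)]) auto
  have deriv: "(f has_derivative (\<lambda>X. X ** b)) (at 0)"
  proof -
    have d1: "((\<lambda>X. mat 1 + he X) has_derivative he) (at 0)"
      using bounded_linear_imp_has_derivative[OF bl(1)] by (auto intro!: derivative_eq_intros)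
    have d2: "((\<lambda>X. \<Phi> (sk X)) has_derivative (\<lambda>X. \<pi> (sk X) ** b)) (at 0)"
      using has_derivative_compose[of sk sk 0 UNIV \<Phi> "\<lambda>Y. \<pi> Y ** b"] \<Phi>(6) at0(2)
        bounded_linear_imp_has_derivative[OF bl(2)] by (simp add: b_def)
    have "(f has_derivative (\<lambda>X. (mat 1 + he 0) ** (\<pi> (sk X) ** b) + he X ** \<Phi> (sk 0))) (at 0)"
      unfolding f_def using mm.FDERIV[OF d1 d2] by simp
    moreover have "(mat 1 + he 0) ** (\<pi> (sk X) ** b) + he X ** \<Phi> (sk 0) = X ** b" for X
    proof -
      have "\<pi> (sk X) = sk X" using sku V(2) \<Phi>(5) by blast
      then show ?thesis using sum[of X] 
        by (simp add: at0 b_def[symmetric]) (metis add.commute matrix_mult_add_left)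
    qed
    ultimately show ?thesis by simp
  qed
  define r where "r = min \<epsilon> 1"
  have r: "r > 0" using \<Phi>(2) by (simp add: r_def)
  \<comment> \<open>Differentiability is known at the single point 0 only. Together with continuity
    and a right inverse of the derivative this suffices for Sussmann's open mapping theorem.\<close>
  have "f 0 \<in> interior (f ` ball 0 r)"
  proof (rule sussmann_open_mapping[OF open_UNIV cont UNIV_I deriv])
    show "bounded_linear (\<lambda>Y :: complex^'n^'n. Y ** mat_adj b)" by (rule mm.bounded_linear_left)
    show "(\<lambda>X. X ** b) \<circ> (\<lambda>Y. Y ** mat_adj b) = id"
      using unitary_left[OF bU] by (simp add: fun_eq_iff flip: matrix_mul_assoc)
  qed (use r in auto)
  then obtain \<eta> where \<eta>: "\<eta> > 0" "ball b \<eta> \<subseteq> f ` ball 0 r" unfolding f0 mem_interior by blast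
  have "g \<in> S" if g: "g \<in> unitary_group" "norm (g - b) < \<eta>" for g
  proof -
    have "g \<in> ball b \<eta>" using g(2) by (simp add: dist_norm norm_minus_commute)
    then obtain X where X: "norm X < r" "g = f X" using \<eta>(2) by auto
    have PS: "\<Phi> (sk X) \<in> S" using nle(2)[of X] X(1) by (intro \<Phi>(3)) (auto simp: r_def)
    then have PU: "\<Phi> (sk X) \<in> unitary_group" using S_unitary by blast
    define Y where "Y = he X"
    have "mat 1 + Y = g ** mat_adj (\<Phi> (sk X))"
      using unitary_right[OF PU] by (simp add: X f_def Y_def flip: matrix_mul_assoc)
    then have "mat 1 + Y \<in> unitary_group" using g(1) PU by (simp add: unitary_mult unitary_adj)
    \<comment> \<open>A matrix that is both unitary and Hermitian is its own inverse. Hence 2 Y = -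
      Y^2, which for |Y| < 1 is possible only if Y = 0.\<close>
    then have "(mat 1 + Y) ** (mat 1 + Y) = mat 1"
      using unitary_left[of "mat 1 + Y"] heh[of X] by (simp add: mat_adj_add Y_def)
    then have "2 *\<^sub>R Y = - (Y ** Y)" by (simp add: matrix_ring_simps scaleR_2 algebra_simps add_eq_0_iff)
    then have "norm (2 *\<^sub>R Y) = norm (Y ** Y)" by simp
    then have "2 * norm Y \<le> norm Y * norm Y" using norm_matrix_mult_le[of Y Y] by simp
    moreover have "norm Y < 1" using nle(1)[of X] X(1) by (simp add: Y_def r_def)
    ultimately have "Y = 0"
      by (metis mult_le_cancel_right not_le norm_ge_zero norm_le_zero_iff one_less_numeral_iff semiring_norm(76) order.strict_trans)
    then show "g \<in> S" using PS X by (simp add: f_def Y_def)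
  qed
  then show thesis using that bS \<eta>(1) by blast
qed

text \<open>By density some \<open>s\<close> in \<open>S\<close> is close to g b^{-1}, so s^{-1} g
  is close to the interior point \<open>b\<close> and therefore in \<open>S\<close>. Then
  \<open>g\<close> is the product of \<open>s\<close> and this element; no inverse in
  \<open>S\<close> is involved.\<close>

theorem semigroup_eq_unitary_group: "S = unitary_group"
proof
  show "unitary_group \<subseteq> S"
  proof
    fix g :: "complex^'n^'n" assume g: "g \<in> unitary_group"
    obtain b \<eta> where b: "b \<in> S" "\<eta> > 0" "\<And>g. g \<in> unitary_group \<Longrightarrow> norm (g - b) < \<eta> \<Longrightarrow> g \<in> S"
      using interior_point by blast
    have bU: "b \<in> unitary_group" using b(1) S_unitary by blast
    have "g ** mat_adj b \<in> closure S" using g bU by (simp add: closure_eq unitary_mult unitary_adj)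
    then obtain s where s: "s \<in> S" "dist s (g ** mat_adj b) < \<eta>"
      using b(2) unfolding closure_approachable by blast
    have sU: "s \<in> unitary_group" using s(1) S_unitary by blast
    have "s ** (mat_adj s ** g - b) ** mat_adj b = g ** mat_adj b - s"
      by (simp add: matrix_ring_simps unitary_right'[OF sU] unitary_right[OF bU] flip: matrix_mul_assoc)
    then have "norm (mat_adj s ** g - b) = norm (g ** mat_adj b - s)"
      by (metis unitary_norm_mult_left[OF sU] unitary_norm_mult_right[OF unitary_adj[OF bU]])
    then have "mat_adj s ** g \<in> S"
      using s(2) by (intro b(3) unitary_mult unitary_adj sU g) (simp add: dist_norm norm_minus_commute)
    then have "s ** (mat_adj s ** g) \<in> S" using S_mult s(1) by blast
    then show "g \<in> S" by (simp add: unitary_right'[OF sU])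
  qed
qed (rule S_unitary)

end

subsection \<open>The special unitary group\<close>

lemma det_mat_adj: "det (mat_adj A) = cnj (det (A :: complex^'n^'n))"
proof -
  have "det (mat_adj A) = det (transpose (mat_adj A))" by (rule det_transpose[symmetric])
  also have "transpose (mat_adj A) = (\<chi> i j. cnj (A $ i $ j))" by (simp add: transpose_def)
  also have "det \<dots> = cnj (det A)" by (simp add: det_def)
  finally show ?thesis .
qed

lemma det_unitary: "g \<in> unitary_group \<Longrightarrow> cnj (det g) * det g = 1"
  by (metis det_I det_mat_adj det_mul unitary_left)

lemma cmod_det_unitary: "g \<in> unitary_group \<Longrightarrow> cmod (det g) = 1"
proof -
  assume "g \<in> unitary_group"
  then have "complex_of_real ((cmod (det g))\<^sup>2) = 1" using det_unitary[of g] by (simp only: complex_norm_square mult.commute)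
  then have "(cmod (det g))\<^sup>2 = 1" using of_real_eq_1_iff by blast
  then show ?thesis using norm_ge_zero[of "det g"] unfolding power2_eq_1_iff by linarith
qed

lemma det_diag_mat: "det (diag_mat d) = (\<Prod>i\<in>UNIV. d i)"
  by (subst det_diagonal) (auto simp: diag_mat_nth)

lemma det_cmat_scale: "det (cmat_scale c A) = c ^ CARD('n) * det (A :: complex^'n^'n)"
proof -
  have "cmat_scale c A = diag_mat (\<lambda>_. c) ** A" by (simp add: vec_eq_iff diag_mat_mult_left)
  then show ?thesis by (simp add: det_mul det_diag_mat)
qed

lemma cis_sum: "(\<Prod>i\<in>I. cis (f i)) = cis (\<Sum>i\<in>I. f i)"
  by (induction I rule: infinite_finite_induct) (auto simp: cis_mult)

lemma det_evol: "W \<in> unitary_group \<Longrightarrow> det (evol W d t) = cis (t * (\<Sum>i\<in>UNIV. d i))"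
  using det_unitary[of W] by (simp add: evol_def det_mul det_mat_adj det_diag_mat cis_sum sum_distrib_left)
    (metis mult.assoc mult.commute mult.left_neutral)

lemma trace_gen: "W \<in> unitary_group \<Longrightarrow> trace (gen W d) = \<i> * complex_of_real (\<Sum>i\<in>UNIV. d i)"
proof -
  assume W: "W \<in> unitary_group"
  have "trace (gen W d) = trace (mat_adj W ** (W ** diag_mat (\<lambda>i. \<i> * complex_of_real (d i))))"
    unfolding gen_def by (rule trace_mul_sym)
  also have "\<dots> = (\<Sum>i\<in>UNIV. \<i> * complex_of_real (d i))"
    by (simp add: unitary_left'[OF W] trace_def diag_mat_nth)
  finally show ?thesis by (simp add: sum_distrib_left)
qed

lemma special_unitary_iff: "g \<in> special_unitary_group \<longleftrightarrow> g \<in> unitary_group \<and> det g = 1"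
  by (simp add: special_unitary_group_def unitary_group_def)

lemma mpow_cmat_scale: "mpow (cmat_scale c g) n = cmat_scale (c ^ n) (mpow g n)"
  by (induction n) (simp_all add: cmat_scale_simps cmat_scale_mult_left cmat_scale_mult_right mult.commute)

text \<open>Adjoining the scalars gives all of \<open>U(n)\<close>, so every \<open>h \<in> SU(n)\<close> is a root of unity times an
  element of \<open>S\<close>; the root of unity disappears in \<open>g = h\<^sup>n\<close>.\<close>

theorem semigroup_eq_special_unitary_group:
  fixes S \<Gamma> :: "(complex^'n^'n) set"
  assumes S: "S \<subseteq> special_unitary_group" and one: "mat 1 \<in> S"
    and mult: "\<And>a b. a \<in> S \<Longrightarrow> b \<in> S \<Longrightarrow> a ** b \<in> S"
    and \<Gamma>: "\<Gamma> \<subseteq> u_alg"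
    and evol: "\<And>W d t. W \<in> unitary_group \<Longrightarrow> gen W d \<in> \<Gamma> \<Longrightarrow> 0 \<le> t \<Longrightarrow> evol W d t \<in> S"
    and generates: "su_alg \<subseteq> lie_generated \<Gamma>"
  shows "S = special_unitary_group"
proof
  define S' where "S' = {cmat_scale (cis \<phi>) s | \<phi> s. s \<in> S}"
  define J :: "complex^'n^'n" where "J = cmat_scale \<i> (mat 1)"
  have J: "J \<in> u_alg" by (simp add: J_def u_alg_def skew_hermitian_def mat_adj_scale cmat_scale_simps)
  have SS': "s \<in> S'" if "s \<in> S" for s
    unfolding S'_def using that by (intro CollectI exI[of _ 0] exI[of _ s]) (simp add: cmat_scale_simps)
  interpret unitary_semigroup S' "insert J \<Gamma>"
  proof
    show "S' \<subseteq> unitary_group"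
    proof
      fix g assume "g \<in> S'"
      then obtain \<phi> s where g: "g = cmat_scale (cis \<phi>) s" "s \<in> S" by (auto simp: S'_def)
      then have "s \<in> unitary_group" using S by (auto simp: special_unitary_iff)
      then show "g \<in> unitary_group"
        by (simp add: g unitary_group_def mat_adj_scale cmat_scale_mult_left cmat_scale_mult_right
            cmat_scale_simps cis_cnj cis_mult)
    qed
    show "mat 1 \<in> S'" using SS' one by blast
    show "a ** b \<in> S'" if "a \<in> S'" "b \<in> S'" for a b
    proof -
      obtain \<phi> s \<phi>' s' where "a = cmat_scale (cis \<phi>) s" "s \<in> S" "b = cmat_scale (cis \<phi>') s'" "s' \<in> S"
        using \<open>a \<in> S'\<close> \<open>b \<in> S'\<close> by (auto simp: S'_def)
      then have "a ** b = cmat_scale (cis (\<phi> + \<phi>')) (s ** s')" "s ** s' \<in> S"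
        using mult by (auto simp: cmat_scale_mult_left cmat_scale_mult_right cmat_scale_simps cis_mult add.commute)
      then show ?thesis unfolding S'_def by blast
    qed
    show "insert J \<Gamma> \<subseteq> u_alg" using \<Gamma> J by blast
    show "evol W d t \<in> S'" if W: "W \<in> unitary_group" "gen W d \<in> insert J \<Gamma>" "0 \<le> t" for W d t
    proof (cases "gen W d \<in> \<Gamma>")
      case True
      then show ?thesis using SS' evol W by blast
    next
      case False
      then have "gen W d = J" using W by blast
      then have "mat_adj W ** (gen W d ** W) = J"
        by (simp add: J_def cmat_scale_mult_left cmat_scale_mult_right unitary_left[OF W(1)])
      then have "diag_mat (\<lambda>i. \<i> * complex_of_real (d i)) = J"
        using unitary_left[OF W(1)] unitary_left'[OF W(1)] by (simp add: gen_def flip: matrix_mul_assoc)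
      then have "diag_mat (\<lambda>i. \<i> * complex_of_real (d i)) $ i $ i = J $ i $ i" for i by simp
      then have "d i = 1" for i by (simp add: diag_mat_nth J_def mat_def)
      then have "evol W d t = W ** cmat_scale (cis t) (mat 1) ** mat_adj W"
        unfolding evol_def by (intro arg_cong2[where f = "(**)"] refl) (simp add: vec_eq_iff diag_mat_nth mat_def)
      then have "evol W d t = cmat_scale (cis t) (mat 1)"
        using unitary_right[OF W(1)] by (simp add: cmat_scale_mult_left cmat_scale_mult_right)
      then show ?thesis unfolding S'_def using one by blast
    qed
    show "u_alg \<subseteq> lie_generated (insert J \<Gamma>)"
    proof
      fix X :: "complex^'n^'n" assume X: "X \<in> u_alg"
      have "lie_generated \<Gamma> \<subseteq> lie_generated (insert J \<Gamma>)"
        using lie_generated_base[of "insert J \<Gamma>"]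
        by (intro lie_generated_minimal subspace_lie_generated comm_lie_generated) auto
      then have su: "su_alg \<subseteq> lie_generated (insert J \<Gamma>)" using generates by blast
      define c where "c = Im (trace X) / real CARD('n)"
      have "trace J = \<i> * real CARD('n)" by (simp add: J_def trace_cmat_scale trace_I)
      then have "trace (X - c *\<^sub>R J) = 0"
        by (simp add: trace_sub trace_scaleR) (subst trace_u_alg[OF X], simp add: c_def scaleR_conv_of_real)
      moreover have "X - c *\<^sub>R J \<in> u_alg" using X J by (intro subspace_diff subspace_scale subspace_u_alg)
      ultimately have "X - c *\<^sub>R J \<in> lie_generated (insert J \<Gamma>)" using su by (auto simp: su_alg_def u_alg_def)
      moreover have "J \<in> lie_generated (insert J \<Gamma>)" using lie_generated_base by blast
      ultimately have "X - c *\<^sub>R J + c *\<^sub>R J \<in> lie_generated (insert J \<Gamma>)"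
        by (intro subspace_add subspace_scale subspace_lie_generated)
      then show "X \<in> lie_generated (insert J \<Gamma>)" by simp
    qed
  qed
  show "special_unitary_group \<subseteq> S"
  proof
    fix g :: "complex^'n^'n" assume g: "g \<in> special_unitary_group"
    then obtain W \<theta> where W: "W \<in> unitary_group" "g = evol W \<theta> 1"
      using unitary_evol by (auto simp: special_unitary_iff)
    have "cis (\<Sum>i\<in>UNIV. \<theta> i) = 1" using g det_evol[OF W(1), of \<theta> 1] by (simp add: special_unitary_iff W)
    then have "cos (\<Sum>i\<in>UNIV. \<theta> i) = 1" by (metis cis.sel(1) one_complex.sel(1))
    then obtain k :: int where k: "(\<Sum>i\<in>UNIV. \<theta> i) = 2 * pi * real_of_int k"
      unfolding cos_one_2pi_int by (auto simp: mult_ac)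
    fix p :: 'n
    \<comment> \<open>The angles of \<open>g\<close> add up to a multiple of 2 pi. Shifting one of
      them by that multiple leaves \<open>g\<close> unchanged, and division by n then gives an n-th
      root \<open>h\<close> of \<open>g\<close> with angle sum 0, hence of determinant 1.\<close>
    define \<eta> where "\<eta> i = (\<theta> i - (if i = p then 2 * pi * real_of_int k else 0)) / real CARD('n)" for i
    have sum0: "(\<Sum>i\<in>UNIV. \<eta> i) = 0"
      by (simp add: \<eta>_def sum_subtractf k flip: sum_divide_distrib)
    define h where "h = evol W \<eta> 1"
    have hn: "mpow h CARD('n) = g"
    proof -
      have "cis (real CARD('n) * \<eta> i) = cis (\<theta> i)" for i
        by (simp add: \<eta>_def cis_divide[symmetric] cis_multiple_2pi)
      then show ?thesis unfolding h_def mpow_evol[OF W(1)] W(2) by (simp add: evol_def)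
    qed
    have "h \<in> unitary_group" "det h = 1" using W(1) by (simp_all add: h_def evol_unitary det_evol sum0)
    then obtain \<phi> s where h: "h = cmat_scale (cis \<phi>) s" "s \<in> S"
      using semigroup_eq_unitary_group unfolding S'_def by blast
    \<comment> \<open>Both \<open>h\<close> and \<open>s\<close> have determinant 1, while the
      scalar contributes its n-th power.\<close>
    then have "cis \<phi> ^ CARD('n) = 1"
      using \<open>det h = 1\<close> S by (auto simp: det_cmat_scale special_unitary_iff)
    then have "g = mpow s CARD('n)" using hn by (simp add: h mpow_cmat_scale cmat_scale_simps)
    then show "g \<in> S" using mpow_closed[OF one mult h(2)] by simp
  qed
qed (rule S)

section \<open>Transitivity of SU(n) on the unit sphere\<close>

lemma unit_vector_column:
  fixes \<psi> :: "complex^'n"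
  assumes "norm \<psi> = 1"
  obtains W where "W \<in> unitary_group" "column p W = \<psi>"
proof -
  have o: "orthonormal {\<psi>}" using assms by (simp add: orthonormal_def cip_self)
  have ext: "\<exists>x. x \<noteq> 0 \<and> (\<forall>y\<in>T. cip y x = 0) \<and> (\<forall>c::complex. c \<noteq> 0 \<longrightarrow> True)"
    if T: "orthonormal T" "card T < CARD('n)" for T :: "(complex^'n) set"
  proof -
    have "finite T" using orthonormal_card T(1) by blast
    then obtain x where "x \<noteq> 0" "\<And>y. y \<in> T \<Longrightarrow> cip y x = 0"
      using exists_orthogonal[OF _ T(2)] by metis
    then show ?thesis by auto
  qed
  obtain T where T: "{\<psi>} \<subseteq> T" "orthonormal T" "card T = CARD('n)"
    by (rule orthonormal_extend[of "{\<psi>}" "\<lambda>_. True"]) (use o ext in auto)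
  then obtain W where W: "W \<in> unitary_group" "range (\<lambda>i. column i W) = T" using orthonormal_columns by blast
  then obtain q where q: "column q W = \<psi>" using T(1) by auto
  \<comment> \<open>The basis contains \<open>\<psi>\<close> as some column \<open>q\<close>; a
    transposition of columns moves it to the prescribed position.\<close>
  define \<sigma> where "\<sigma> j = (if j = p then q else if j = q then p else j)" for j
  have inj: "\<sigma> i = \<sigma> j \<longleftrightarrow> i = j" for i j by (auto simp: \<sigma>_def)
  define W' where "W' = (\<chi> i j. W $ i $ \<sigma> j)"
  have col: "column j W' = column (\<sigma> j) W" for j by (simp add: column_def W'_def)
  have "W' \<in> unitary_group" using W(1) by (simp add: unitary_iff_columns col inj)
  moreover have "column p W' = \<psi>" by (simp add: col \<sigma>_def q)
  ultimately show thesis using that by blast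
qed

text \<open>V W^{-1} maps \<open>\<psi>\<close> to \<open>\<phi>\<close> but may have the wrong
  determinant. As n \<ge> 2 there is a second basis direction \<open>q\<close>, where the diagonal
  factor \<open>D\<close> corrects the determinant without moving the image of
  \<open>\<psi>\<close>.\<close>

lemma special_unitary_transitive:
  fixes \<psi> \<phi> :: "complex^'n"
  assumes n2: "CARD('n) \<ge> 2" and "norm \<psi> = 1" "norm \<phi> = 1"
  obtains g where "g \<in> special_unitary_group" "g *v \<psi> = \<phi>"
proof -
  obtain p q :: 'n where pq: "p \<noteq> q"
    using n2 card_le_Suc0_iff_eq[of "UNIV :: 'n set"] by auto
  obtain W where W: "W \<in> unitary_group" "column p W = \<psi>" using unit_vector_column assms by blast
  obtain V where V: "V \<in> unitary_group" "column p V = \<phi>" using unit_vector_column assms by blast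
  define z where "z = det V * det (mat_adj W)"
  define D where "D = diag_mat (\<lambda>i. if i = q then cnj z else 1)"
  have z: "z * cnj z = 1"
    using det_unitary[OF V(1)] det_unitary[OF W(1)] 
    by (simp add: z_def det_mat_adj) (metis mult.assoc mult.commute mult.left_neutral)
  have "cmod z = 1" using V W by (simp add: z_def norm_mult cmod_det_unitary unitary_adj)
  then have DU: "D \<in> unitary_group" unfolding D_def by (intro unitary_diag) auto
  define g where "g = V ** D ** mat_adj W"
  have "det D = cnj z" by (simp add: D_def det_diag_mat prod.delta)
  then have "det g = 1" using z by (simp add: g_def det_mul z_def mult_ac)
  moreover have "g \<in> unitary_group" unfolding g_def using V W DU by (intro unitary_mult unitary_adj)
  moreover have "g *v \<psi> = \<phi>"
  proof -
    have "g ** W = V ** D" using unitary_left[OF W(1)] by (simp add: g_def flip: matrix_mul_assoc)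
    then have "g *v column p W = V *v column p D" by (simp add: column_mult)
    moreover have "column p D = column p (mat 1)" using pq by (simp add: vec_eq_iff column_def D_def diag_mat_nth mat_def)
    ultimately show ?thesis using W V by (simp add: column_mult)
  qed
  ultimately show thesis using that by (simp add: special_unitary_iff)
qed

section \<open>Reachable sets\<close>

lemma reachable_refl:
  assumes "U \<noteq> {}" shows "q \<in> reachable_set f U q"
proof -
  obtain c where "c \<in> U" using assms by blast
  then show ?thesis
    unfolding reachable_set_def mem_Collect_eq
    by (intro exI[of _ 0] exI[of _ "\<lambda>_. c"] exI[of _ "\<lambda>_. q"]) 
       (auto simp: admissible_control_def is_solution_def intro: has_integral_refl)
qed

text \<open>Concatenation of a trajectory with a piece of constant control. Other concatenations do
  not occur, because \<open>propagators\<close> is defined by its action on reachable sets.\<close>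

lemma reachable_extend:
  fixes f :: "real^'m \<Rightarrow> 'x::euclidean_space \<Rightarrow> 'x"
  assumes q: "q1 \<in> reachable_set f U q0" and c: "c \<in> U" and \<tau>: "0 \<le> \<tau>"
    and \<gamma>: "\<gamma> 0 = q1" "\<And>s. (\<gamma> has_vector_derivative f c (\<gamma> s)) (at s)"
  shows "\<gamma> \<tau> \<in> reachable_set f U q0"
proof -
  obtain T u q where T: "0 \<le> T" and u: "admissible_control U T u" and sol: "is_solution f T u q"
    and q0: "q 0 = q0" "q T = q1"
    using q unfolding reachable_set_def by auto
  \<comment> \<open>The control is continued by \<open>c\<close> on the whole real line, so that its
    measurability follows from that of \<open>u\<close> on [0, T] before restricting to the longer
    interval.\<close>
  define w where "w s = (if s \<in> {0..T} then u s else c)" for s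
  define Q where "Q s = (if s \<le> T then q s else \<gamma> (s - T))" for s
  have "(\<lambda>s. if s \<in> {0..T} then u s else c) \<in> borel_measurable lebesgue"
    using u by (subst measurable_restrict_space_iff[symmetric]) (auto simp: admissible_control_def)
  then have "w \<in> borel_measurable (lebesgue_on {0..T + \<tau>})"
    unfolding w_def by (rule measurable_restrict_space1)
  moreover have "bounded (w ` {0..T + \<tau>})"
  proof (rule bounded_subset)
    show "bounded (insert c (u ` {0..T}))" using u by (simp add: admissible_control_def)
    show "w ` {0..T + \<tau>} \<subseteq> insert c (u ` {0..T})" by (auto simp: w_def)
  qed
  ultimately have adm: "admissible_control U (T + \<tau>) w"
    using u c by (auto simp: admissible_control_def w_def)
  have old: "((\<lambda>s. f (w s) (Q s)) has_integral (Q t - Q 0)) {0..t}" if t: "0 \<le> t" "t \<le> T" for t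
  proof -
    have "((\<lambda>s. f (u s) (q s)) has_integral (q t - q 0)) {0..t}"
      using sol t by (simp add: is_solution_def)
    moreover have "f (u s) (q s) = f (w s) (Q s)" if "s \<in> {0..t}" for s
      using that t by (simp add: w_def Q_def)
    ultimately have "((\<lambda>s. f (w s) (Q s)) has_integral (q t - q 0)) {0..t}" by (rule has_integral_eq[rotated])
    then show ?thesis using t T by (simp add: Q_def)
  qed
  have "is_solution f (T + \<tau>) w Q"
    unfolding is_solution_def
  proof
    fix t assume t: "t \<in> {0..T + \<tau>}"
    show "((\<lambda>s. f (w s) (Q s)) has_integral (Q t - Q 0)) {0..t}"
    proof (cases "t \<le> T")
      case True
      then show ?thesis using old t by simp
    next
      case False
      then have tT: "T \<le> t" by simp
      have "((\<lambda>s. f c (\<gamma> (s - T))) has_integral (\<gamma> (t - T) - \<gamma> (T - T))) {T..t}"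
      proof (rule fundamental_theorem_of_calculus[OF tT])
        fix s
        have "((\<lambda>s. s - T) has_vector_derivative 1) (at s)" by (auto intro!: derivative_eq_intros)
        moreover have "(\<gamma> has_vector_derivative f c (\<gamma> (s - T))) (at (s - T))" by (rule \<gamma>)
        ultimately have "(\<gamma> \<circ> (\<lambda>s. s - T) has_vector_derivative 1 *\<^sub>R f c (\<gamma> (s - T))) (at s)"
          by (rule vector_diff_chain_at)
        then show "((\<lambda>s. \<gamma> (s - T)) has_vector_derivative f c (\<gamma> (s - T))) (at s within {T..t})"
          by (simp add: comp_def has_vector_derivative_at_within)
      qed
      then have "((\<lambda>s. f (w s) (Q s)) has_integral (\<gamma> (t - T) - \<gamma> (T - T))) {T..t}"
        by (rule has_integral_spike_finite[of "{T}", rotated 2]) (auto simp: w_def Q_def)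
      then have "((\<lambda>s. f (w s) (Q s)) has_integral (Q t - Q T)) {T..t}"
        using False q0 \<gamma>(1) by (simp add: Q_def)
      from has_integral_combine[OF T tT old[OF T order_refl] this] show ?thesis by simp
    qed
  qed
  moreover have "Q 0 = q0" using T q0 by (simp add: Q_def)
  moreover have "Q (T + \<tau>) = \<gamma> \<tau>" using q0 \<gamma>(1) \<tau> by (auto simp: Q_def)
  moreover have "0 \<le> T + \<tau>" using T \<tau> by simp
  ultimately show ?thesis using adm unfolding reachable_set_def by (metis (mono_tags, lifting) mem_Collect_eq)
qed

text \<open>A quadratic bound on increments makes the derivative vanish at every point. For
  conserved quantities such a bound follows from the integral equation, although the trajectory
  itself need not be differentiable everywhere.\<close>

lemma quadratic_increment_constant:
  fixes \<Phi> :: "real \<Rightarrow> 'a::real_normed_vector"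
  assumes \<delta>: "\<delta> > 0" and C: "C \<ge> 0"
    and inc: "\<And>s t. 0 \<le> s \<Longrightarrow> s \<le> t \<Longrightarrow> t \<le> T \<Longrightarrow> t - s < \<delta> \<Longrightarrow> norm (\<Phi> t - \<Phi> s) \<le> C * (t - s)\<^sup>2"
    and t: "0 \<le> t" "t \<le> T"
  shows "\<Phi> t = \<Phi> 0"
proof -
  have inc': "norm (\<Phi> y - \<Phi> x) \<le> C * \<bar>y - x\<bar>\<^sup>2" if "x \<in> {0..T}" "y \<in> {0..T}" "\<bar>y - x\<bar> < \<delta>" for x y
    using inc[of x y] inc[of y x] that by (cases "x \<le> y") (auto simp: norm_minus_commute power2_commute)
  have "(\<Phi> has_derivative (\<lambda>h. 0)) (at x within {0..T})" if x: "x \<in> {0..T}" for x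
    unfolding has_derivative_within_alt
  proof (intro conjI allI impI)
    show "bounded_linear (\<lambda>h::real. 0::'a)" by (rule bounded_linear_zero)
    fix e :: real assume e: "e > 0"
    define d where "d = min \<delta> (e / (C + 1))"
    have "d > 0" using e \<delta> C by (simp add: d_def)
    moreover have "norm (\<Phi> y - \<Phi> x - 0) \<le> e * norm (y - x)" if y: "y \<in> {0..T}" "norm (y - x) < d" for y
    proof -
      have "norm (\<Phi> y - \<Phi> x) \<le> C * \<bar>y - x\<bar>\<^sup>2" using inc'[OF x y(1)] y(2) by (simp add: d_def)
      also have "\<dots> = (C * \<bar>y - x\<bar>) * \<bar>y - x\<bar>" by (simp add: power2_eq_square)
      also have "\<dots> \<le> e * \<bar>y - x\<bar>"
      proof (rule mult_right_mono)
        have "C * \<bar>y - x\<bar> \<le> (C + 1) * \<bar>y - x\<bar>" by (intro mult_right_mono) auto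
        also have "\<dots> \<le> (C + 1) * (e / (C + 1))" using y(2) C by (intro mult_left_mono) (auto simp: d_def)
        also have "\<dots> = e" using C by simp
        finally show "C * \<bar>y - x\<bar> \<le> e" .
      qed simp
      finally show ?thesis by simp
    qed
    ultimately show "\<exists>d>0. \<forall>y\<in>{0..T}. norm (y - x) < d \<longrightarrow> norm (\<Phi> y - \<Phi> x - 0) \<le> e * norm (y - x)"
      by blast
  qed
  then obtain c where "\<And>x. x \<in> {0..T} \<Longrightarrow> \<Phi> x = c"
    using has_derivative_zero_constant[of "{0..T}" \<Phi>] by (auto simp: convex_real_interval)
  then show ?thesis using t by auto
qed

text \<open>The integral equation makes \<open>q\<close> an indefinite integral, hence continuous
  and bounded on the compact interval. The linear growth of the field then bounds the integrand, and
  the integral over a subinterval gives the Lipschitz estimate.\<close>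

lemma solution_Lipschitz:
  fixes f :: "real^'m \<Rightarrow> 'x::euclidean_space \<Rightarrow> 'x"
  assumes T: "0 \<le> T" and sol: "is_solution f T u q" and K: "K \<ge> 0" 
    and bound: "\<And>s. s \<in> {0..T} \<Longrightarrow> norm (f (u s) (q s)) \<le> K * norm (q s)"
  obtains C where "C \<ge> 0" "\<And>s. s \<in> {0..T} \<Longrightarrow> norm (q s) \<le> C"
    "\<And>s t. 0 \<le> s \<Longrightarrow> s \<le> t \<Longrightarrow> t \<le> T \<Longrightarrow> ((\<lambda>r. f (u r) (q r)) has_integral (q t - q s)) {s..t}"
    "\<And>s t. 0 \<le> s \<Longrightarrow> s \<le> t \<Longrightarrow> t \<le> T \<Longrightarrow> norm (q t - q s) \<le> C * (t - s)"
proof -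
  let ?F = "\<lambda>r. f (u r) (q r)"
  have hi: "(?F has_integral (q t - q 0)) {0..t}" if "t \<in> {0..T}" for t
    using sol that by (simp add: is_solution_def)
  have int: "?F integrable_on {0..T}" using hi[of T] T by auto
  have qt: "q t = q 0 + integral {0..t} ?F" if "t \<in> {0..T}" for t
    using integral_unique[OF hi[OF that]] by simp
  have "continuous_on {0..T} (\<lambda>t. q 0 + integral {0..t} ?F)"
    by (intro continuous_intros indefinite_integral_continuous_1 int)
  then have "continuous_on {0..T} q" by (rule continuous_on_eq) (rule qt[symmetric])
  then have "bounded (q ` {0..T})" by (intro compact_imp_bounded compact_continuous_image) auto
  then obtain B where B: "\<And>s. s \<in> {0..T} \<Longrightarrow> norm (q s) \<le> B" unfolding bounded_iff by blast
  then have B0: "B \<ge> 0" using order_trans[OF norm_ge_zero B[of 0]] T by simp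
  have sub: "(?F has_integral (q t - q s)) {s..t}" if "0 \<le> s" "s \<le> t" "t \<le> T" for s t
  proof -
    have i: "?F integrable_on {s..t}" using integrable_on_subinterval[OF int] that by auto
    have "integral {0..s} ?F + integral {s..t} ?F = integral {0..t} ?F"
      using that by (intro Henstock_Kurzweil_Integration.integral_combine integrable_on_subinterval[OF int]) auto
    then have "integral {s..t} ?F = q t - q s" using qt[of t] qt[of s] that by (simp add: eq_diff_eq add.commute)
    then show ?thesis using i integrable_integral by metis
  qed
  have lip: "norm (q t - q s) \<le> K * B * (t - s)" if "0 \<le> s" "s \<le> t" "t \<le> T" for s t
  proof -
    have "norm (?F r) \<le> K * B" if "r \<in> {s..t}" for r
    proof -
      have r: "r \<in> {0..T}" using that \<open>0 \<le> s\<close> \<open>t \<le> T\<close> by auto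
      show ?thesis using bound[OF r] mult_left_mono[OF B[OF r] K] by linarith
    qed
    then show ?thesis
      using has_integral_bound_real[OF _ finite.emptyI sub[OF that], of "K * B"] K B0 that by simp
  qed
  show thesis
  proof (rule that[of "max B (K * B)"])
    show "norm (q t - q s) \<le> max B (K * B) * (t - s)" if "0 \<le> s" "s \<le> t" "t \<le> T" for s t
      using lip[OF that] that mult_right_mono[of "K * B" "max B (K * B)" "t - s"] by auto
    show "norm (q s) \<le> max B (K * B)" if "s \<in> {0..T}" for s using B[OF that] by auto
  qed (use B0 sub in auto)
qed

text \<open>The increment of the squared norm is |q t - q s|^2 plus twice the inner product of q s
  with the increment. In the latter q s may be replaced by q s - q r under the integral, as
  \<open>A\<close> is skew; both terms are then quadratic in t - s by the Lipschitz bound.\<close>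

lemma skew_solution_norm:
  fixes A :: "real^'m \<Rightarrow> complex^'n^'n"
  assumes T: "0 \<le> T" and sol: "is_solution (\<lambda>u \<psi>. A u *v \<psi>) T u q" 
    and K: "\<And>s. s \<in> {0..T} \<Longrightarrow> norm (A (u s)) \<le> K" and skew: "\<And>u. A u \<in> u_alg"
    and t: "0 \<le> t" "t \<le> T"
  shows "norm (q t) = norm (q 0)"
proof -
  have K0: "K \<ge> 0" using K[of 0] T norm_ge_zero order_trans by (metis atLeastAtMost_iff order_refl)
  have Ab: "norm (A (u s) *v x) \<le> K * norm x" if "s \<in> {0..T}" for s x
    using norm_mult_vec_le[of "A (u s)" x] mult_right_mono[OF K[OF that], of "norm x"] by simp
  obtain C where C: "C \<ge> 0" "\<And>s. s \<in> {0..T} \<Longrightarrow> norm (q s) \<le> C"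
    "\<And>s t. 0 \<le> s \<Longrightarrow> s \<le> t \<Longrightarrow> t \<le> T \<Longrightarrow> ((\<lambda>r. A (u r) *v q r) has_integral (q t - q s)) {s..t}"
    "\<And>s t. 0 \<le> s \<Longrightarrow> s \<le> t \<Longrightarrow> t \<le> T \<Longrightarrow> norm (q t - q s) \<le> C * (t - s)"
    using solution_Lipschitz[OF T sol K0 Ab] by blast
  have zero: "inner x (A v *v x) = 0" for x v
  proof -
    have "mat_adj (A v) = - A v" using skew by (simp add: u_alg_def skew_hermitian_def)
    then have "cip (A v *v x) x = - cip x (A v *v x)"
      by (simp add: cip_adj) (simp add: cip_def matrix_vector_mult_def sum_negf)
    moreover have "cip (A v *v x) x = cnj (cip x (A v *v x))" by (simp add: cnj_cip)
    ultimately show ?thesis by (simp add: inner_eq_Re_cip complex_eq_iff)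
  qed
  have "inner (q t) (q t) = inner (q 0) (q 0)"
  proof (rule quadratic_increment_constant[where \<delta> = 1 and C = "C\<^sup>2 + 2 * (C * (K * C))" and T = T])
    fix s t assume st: "0 \<le> s" "s \<le> t" "t \<le> T"
    have hi: "((\<lambda>r. inner (q s) (A (u r) *v q r)) has_integral inner (q s) (q t - q s)) {s..t}"
      using has_integral_linear[OF C(3)[OF st] bounded_linear_inner_right, of "q s"] by (simp add: comp_def)
    have "norm (inner (q s) (A (u r) *v q r)) \<le> C * (t - s) * (K * C)" if r: "r \<in> {s..t}" for r
    proof -
      have r': "r \<in> {0..T}" using r st by auto
      have "inner (q s) (A (u r) *v q r) = inner (q s - q r) (A (u r) *v q r)"
        by (simp add: inner_diff_left zero)
      also have "norm \<dots> \<le> norm (q s - q r) * norm (A (u r) *v q r)"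
        by (simp add: Cauchy_Schwarz_ineq2)
      also have "\<dots> \<le> C * (t - s) * (K * C)"
      proof (rule mult_mono)
        have "norm (q s - q r) \<le> C * (r - s)" using C(4)[of s r] r st by (simp add: norm_minus_commute)
        also have "\<dots> \<le> C * (t - s)" using r C(1) by (intro mult_left_mono) auto
        finally show "norm (q s - q r) \<le> C * (t - s)" .
        show "norm (A (u r) *v q r) \<le> K * C"
          using Ab[OF r', of "q r"] mult_left_mono[OF C(2)[OF r'] K0] by linarith
      qed (use C(1) st in auto)
      finally show ?thesis .
    qed
    then have b: "norm (inner (q s) (q t - q s)) \<le> C * (t - s) * (K * C) * (t - s)"
      using has_integral_bound_real[OF _ finite.emptyI hi, of "C * (t - s) * (K * C)"] C(1) K0 st by simp
    have "inner (q t) (q t) - inner (q s) (q s) = (norm (q t - q s))\<^sup>2 + 2 * inner (q s) (q t - q s)"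
      by (simp add: power2_norm_eq_inner inner_diff_left inner_diff_right inner_commute)
    then have "norm (inner (q t) (q t) - inner (q s) (q s)) \<le> (norm (q t - q s))\<^sup>2 + 2 * norm (inner (q s) (q t - q s))"
      using abs_triangle_ineq[of "(norm (q t - q s))\<^sup>2" "2 * inner (q s) (q t - q s)"] by (simp add: abs_mult)
    also have "\<dots> \<le> (C * (t - s))\<^sup>2 + 2 * (C * (t - s) * (K * C) * (t - s))"
      using b C(4)[OF st] by (intro add_mono mult_left_mono power_mono) auto
    also have "\<dots> = (C\<^sup>2 + 2 * (C * (K * C))) * (t - s)\<^sup>2" by (simp add: power2_eq_square algebra_simps)
    finally show "norm (inner (q t) (q t) - inner (q s) (q s)) \<le> (C\<^sup>2 + 2 * (C * (K * C))) * (t - s)\<^sup>2" .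
  qed (use t C(1) K0 in auto)
  then show ?thesis by (simp add: norm_eq_sqrt_inner)
qed

text \<open>\<open>mat_adj g ** g - mat 1\<close> is Hermitian with vanishing quadratic form, so all
  its eigenvalues are 0.\<close>

lemma isometry_unitary:
  fixes g :: "complex^'n^'n"
  assumes "\<And>x. norm (g *v x) = norm x"
  shows "g \<in> unitary_group"
proof -
  define M where "M = mat_adj g ** g - mat 1"
  have "hermitian M" by (simp add: M_def hermitian_def mat_adj_diff mat_adj_mult)
  then obtain W and d :: "'n \<Rightarrow> real" where W: "W \<in> unitary_group" 
    and d: "M ** W = W ** diag_mat (\<lambda>i. complex_of_real (d i))" using hermitian_diagonalizable by blast
  have "d i = 0" for i
  proof -
    let ?x = "column i W"
    have "cip ?x (mat_adj g *v (g *v ?x)) = cip (g *v ?x) (g *v ?x)" by (simp add: cip_adj)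
    then have "cip ?x (M *v ?x) = cip (g *v ?x) (g *v ?x) - cip ?x ?x"
      by (simp add: M_def matrix_vector_mult_diff_rdistrib cip_simps matrix_vector_mul_assoc)
    also have "\<dots> = 0" by (simp add: cip_self assms)
    finally have "complex_of_real (d i) * cip ?x ?x = 0" by (simp add: column_eigen[OF d] cip_simps)
    then show ?thesis using column_nonzero[OF W] by simp
  qed
  then have "M ** W = 0" unfolding d by (simp add: vec_eq_iff diag_mat_mult_right)
  then have "M = 0" by (metis W matrix_mul_assoc matrix_mul_rid times0_left unitary_right)
  then show ?thesis by (simp add: M_def unitary_group_def)
qed

text \<open>Applied to a fixed vector, a solution of the matrix equation solves the state equation
  and conserves its norm, so each \<open>q t\<close> is an isometry.\<close>

lemma skew_solution_unitary:
  fixes A :: "real^'m \<Rightarrow> complex^'n^'n"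
  assumes T: "0 \<le> T" and sol: "is_solution (\<lambda>u g. A u ** g) T u q" 
    and K: "\<And>s. s \<in> {0..T} \<Longrightarrow> norm (A (u s)) \<le> K" and skew: "\<And>u. A u \<in> u_alg"
    and t: "0 \<le> t" "t \<le> T" and q0: "q 0 \<in> unitary_group"
  shows "q t \<in> unitary_group"
proof (rule isometry_unitary)
  fix x
  have "is_solution (\<lambda>u \<psi>. A u *v \<psi>) T u (\<lambda>s. q s *v x)"
    unfolding is_solution_def
  proof
    fix t assume "t \<in> {0..T}"
    then have "((\<lambda>s. A (u s) ** q s) has_integral (q t - q 0)) {0..t}" using sol by (simp add: is_solution_def)
    from has_integral_linear[OF this mv.bounded_linear_left[of x]]
    show "((\<lambda>s. A (u s) *v (q s *v x)) has_integral (q t *v x - q 0 *v x)) {0..t}"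
      by (simp add: comp_def matrix_vector_mul_assoc matrix_vector_mult_diff_rdistrib)
  qed
  from skew_solution_norm[OF T this K skew t] show "norm (q t *v x) = norm x"
    using unitary_norm_vec[OF q0] by simp
qed

text \<open>The constant is chosen to close the induction: a new factor adds at most 2 * 4^k r^2 to
  the old error 4^k r^2, which stays below 4^(k+1) r^2.\<close>

lemma prod_one_plus_expansion:
  fixes x :: "'i \<Rightarrow> complex"
  assumes "finite I" "\<And>i. i \<in> I \<Longrightarrow> cmod (x i) \<le> r" "0 \<le> r" "r \<le> 1"
  shows "cmod ((\<Prod>i\<in>I. 1 + x i) - 1 - (\<Sum>i\<in>I. x i)) \<le> 4 ^ card I * r\<^sup>2"
  using assms(1,2)
proof (induction I)
  case (insert a I)
  let ?P = "\<Prod>i\<in>I. 1 + x i" and ?S = "\<Sum>i\<in>I. x i" and ?k = "card I"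
  have IH: "cmod (?P - 1 - ?S) \<le> 4 ^ ?k * r\<^sup>2" using insert by auto
  have S: "cmod ?S \<le> real ?k * r" using insert.prems by (intro sum_norm_bound) auto
  have k: "real ?k \<le> 4 ^ ?k" 
  proof -
    have "real ?k < 2 ^ ?k" by (rule of_nat_less_two_power)
    also have "\<dots> \<le> 4 ^ ?k" by (rule power_mono) auto
    finally show ?thesis by simp
  qed
  have "cmod (?P - 1) \<le> cmod (?P - 1 - ?S) + cmod ?S" by (metis diff_add_cancel norm_triangle_ineq)
  also have "\<dots> \<le> 4 ^ ?k * r\<^sup>2 + real ?k * r" using IH S by linarith
  also have "\<dots> \<le> 4 ^ ?k * r + 4 ^ ?k * r"
    using k assms(3,4) by (intro add_mono mult_mono mult_left_mono) (auto simp: power2_eq_square mult_left_le)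
  finally have P: "cmod (?P - 1) \<le> 2 * 4 ^ ?k * r" by (simp add: mult_ac)
  have "cmod ((\<Prod>i\<in>insert a I. 1 + x i) - 1 - (\<Sum>i\<in>insert a I. x i)) = cmod ((?P - 1 - ?S) + x a * (?P - 1))"
    using insert.hyps by (simp add: algebra_simps)
  also have "\<dots> \<le> cmod (?P - 1 - ?S) + cmod (x a) * cmod (?P - 1)"
    by (metis norm_triangle_ineq norm_mult)
  also have "\<dots> \<le> 4 ^ ?k * r\<^sup>2 + r * (2 * 4 ^ ?k * r)"
    using IH P insert.prems[of a] assms(3) by (intro add_mono mult_mono) auto
  also have "\<dots> \<le> 4 ^ card (insert a I) * r\<^sup>2"
    using insert.hyps assms(3) by (simp add: power2_eq_square algebra_simps)
  finally show ?case .
qed simp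

text \<open>In the Leibniz formula the identity gives the product of the 1 + X_ii. Any other
  permutation moves at least two points, hence picks two off-diagonal entries of size at most |X|;
  the remaining entries are at most 2.\<close>

lemma det_one_plus_expansion:
  obtains C where "C \<ge> 0" 
    "\<And>X :: complex^'n^'n. norm X \<le> 1 \<Longrightarrow> cmod (det (mat 1 + X) - 1 - trace X) \<le> C * (norm X)\<^sup>2"
proof -
  let ?N = "CARD('n)"
  let ?PS = "{p. p permutes (UNIV :: 'n set)}"
  define C where "C = real (card ?PS) * 2 ^ ?N + 4 ^ ?N"
  have "cmod (det (mat 1 + X) - 1 - trace X) \<le> C * (norm X)\<^sup>2" if X: "norm X \<le> 1" for X :: "complex^'n^'n"
  proof -
    define r where "r = norm X"
    have r: "0 \<le> r" "r \<le> 1" using X by (auto simp: r_def)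
    have ent: "cmod (X $ i $ j) \<le> r" for i j
      unfolding r_def using Finite_Cartesian_Product.norm_nth_le[where x = "X $ i" and i = j] Finite_Cartesian_Product.norm_nth_le[where x = X and i = i] by linarith
    have M: "cmod ((mat 1 + X) $ i $ j) \<le> 2" for i j
    proof -
      have "cmod ((mat 1 + X) $ i $ j) \<le> cmod (mat 1 $ i $ j) + cmod (X $ i $ j)"
        by (simp add: norm_triangle_ineq)
      also have "\<dots> \<le> 2" using ent[of i j] r by (auto simp: mat_def)
      finally show ?thesis .
    qed
    define t where "t p = of_int (sign p) * (\<Prod>i\<in>UNIV. (mat 1 + X) $ i $ p i)" for p :: "'n \<Rightarrow> 'n"
    have fin: "finite ?PS" by (simp add: finite_permutations)
    have id: "id \<in> ?PS" by (simp add: permutes_id)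
    have "det (mat 1 + X) = t id + (\<Sum>p\<in>?PS - {id}. t p)"
      unfolding det_def t_def by (rule sum.remove[OF fin id])
    then have "det (mat 1 + X) - 1 - trace X = ((\<Prod>i\<in>UNIV. 1 + X $ i $ i) - 1 - (\<Sum>i\<in>UNIV. X $ i $ i)) + (\<Sum>p\<in>?PS - {id}. t p)"
      by (simp add: t_def mat_def trace_def sign_id)
    also have "cmod \<dots> \<le> cmod ((\<Prod>i\<in>UNIV. 1 + X $ i $ i) - 1 - (\<Sum>i\<in>UNIV. X $ i $ i)) + cmod (\<Sum>p\<in>?PS - {id}. t p)"
      by (rule norm_triangle_ineq)
    also have "\<dots> \<le> 4 ^ ?N * r\<^sup>2 + real (card ?PS) * (2 ^ ?N * r\<^sup>2)"
    proof (rule add_mono)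
      show "cmod ((\<Prod>i\<in>UNIV. 1 + X $ i $ i) - 1 - (\<Sum>i\<in>UNIV. X $ i $ i)) \<le> 4 ^ ?N * r\<^sup>2"
        using prod_one_plus_expansion[of "UNIV :: 'n set" "\<lambda>i. X $ i $ i" r] ent r by simp
      have "cmod (t p) \<le> 2 ^ ?N * r\<^sup>2" if p: "p \<in> ?PS - {id}" for p
      proof -
        have pp: "p permutes UNIV" "p \<noteq> id" using p by auto
        then obtain a where a: "p a \<noteq> a" by (auto simp: fun_eq_iff)
        define b where "b = p a"
        have b: "p b \<noteq> b" "a \<noteq> b" using a permutes_inj[OF pp(1)] by (auto simp: b_def inj_eq)
        let ?f = "\<lambda>i. (mat 1 + X) $ i $ p i"
        have "(\<Prod>i\<in>UNIV. ?f i) = ?f a * (?f b * (\<Prod>i\<in>UNIV - {a} - {b}. ?f i))"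
          using b(2) by (subst prod.remove[of UNIV a], simp, simp, subst prod.remove[of "UNIV - {a}" b]) auto
        then have "cmod (t p) = cmod (?f a) * (cmod (?f b) * (\<Prod>i\<in>UNIV - {a} - {b}. cmod (?f i)))"
          by (simp add: t_def norm_mult prod_norm sign_def)
        also have "\<dots> \<le> r * (r * (\<Prod>i\<in>UNIV - {a} - {b}. 2))"
        proof (intro mult_mono prod_mono conjI)
          show "cmod (?f a) \<le> r" "cmod (?f b) \<le> r" using a b(1) ent by (auto simp: mat_def)
        qed (use r M in \<open>auto intro!: mult_nonneg_nonneg prod_nonneg\<close>)
        also have "\<dots> \<le> r * (r * 2 ^ ?N)"
          using r by (intro mult_left_mono) (auto intro!: power_increasing card_mono)
        finally show ?thesis by (simp add: power2_eq_square mult_ac)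
      qed
      then have "cmod (\<Sum>p\<in>?PS - {id}. t p) \<le> real (card (?PS - {id})) * (2 ^ ?N * r\<^sup>2)"
        by (intro sum_norm_bound) auto
      also have "\<dots> \<le> real (card ?PS) * (2 ^ ?N * r\<^sup>2)"
        using fin by (intro mult_right_mono) (auto simp: card_Diff1_le)
      finally show "cmod (\<Sum>p\<in>?PS - {id}. t p) \<le> real (card ?PS) * (2 ^ ?N * r\<^sup>2)" .
    qed
    also have "\<dots> = C * (norm X)\<^sup>2" by (simp add: C_def r_def algebra_simps)
    finally show ?thesis .
  qed
  then show thesis using that[of C] by (simp add: C_def)
qed

text \<open>Liouville's formula in increments: det (q t) / det (q s) = det (1 + X) with X = (q t - q
  s) (q s)^{-1}. The trace of X is an integral of tr (A q_r q_s^{-1}), where q_r q_s^{-1} is 1 up to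
  O(t - s). Since tr A = 0 the integral is quadratic in t - s, as is the remainder of the
  determinant.\<close>

lemma traceless_solution_det:
  fixes A :: "real^'m \<Rightarrow> complex^'n^'n"
  assumes T: "0 \<le> T" and sol: "is_solution (\<lambda>u g. A u ** g) T u q" 
    and K: "\<And>s. s \<in> {0..T} \<Longrightarrow> norm (A (u s)) \<le> K" and skew: "\<And>u. A u \<in> u_alg"
    and tr: "\<And>s. s \<in> {0..T} \<Longrightarrow> trace (A (u s)) = 0"
    and t: "0 \<le> t" "t \<le> T" and q0: "q 0 \<in> unitary_group"
  shows "det (q t) = det (q 0)"
proof -
  have qU: "q s \<in> unitary_group" if "s \<in> {0..T}" for s
    using skew_solution_unitary[OF T sol K skew _ _ q0] that by simp
  have K0: "K \<ge> 0" using K[of 0] T norm_ge_zero order_trans by (metis atLeastAtMost_iff order_refl)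
  have Ab: "norm (A (u s) ** x) \<le> K * norm x" if "s \<in> {0..T}" for s and x :: "complex^'n^'n"
    using norm_matrix_mult_le[of "A (u s)" x] mult_right_mono[OF K[OF that], of "norm x"] by simp
  obtain C where C: "C \<ge> 0" "\<And>s. s \<in> {0..T} \<Longrightarrow> norm (q s) \<le> C"
    "\<And>s t. 0 \<le> s \<Longrightarrow> s \<le> t \<Longrightarrow> t \<le> T \<Longrightarrow> ((\<lambda>r. A (u r) ** q r) has_integral (q t - q s)) {s..t}"
    "\<And>s t. 0 \<le> s \<Longrightarrow> s \<le> t \<Longrightarrow> t \<le> T \<Longrightarrow> norm (q t - q s) \<le> C * (t - s)"
    using solution_Lipschitz[OF T sol K0 Ab] by blast
  obtain D where D: "D \<ge> 0" 
    "\<And>X :: complex^'n^'n. norm X \<le> 1 \<Longrightarrow> cmod (det (mat 1 + X) - 1 - trace X) \<le> D * (norm X)\<^sup>2"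
    using det_one_plus_expansion by blast
  have bl: "bounded_linear (trace :: complex^'n^'n \<Rightarrow> complex)"
    by (intro linear_conv_bounded_linear[THEN iffD1] linearI) (auto simp: trace_add trace_scaleR)
  then obtain B where B: "B \<ge> 0" "\<And>X :: complex^'n^'n. cmod (trace X) \<le> norm X * B"
    using bounded_linear.nonneg_bounded by metis
  show ?thesis
  proof (rule quadratic_increment_constant[where \<delta> = "1 / (C + 1)" and C = "D * C\<^sup>2 + K * C * B" and T = T])
    fix s t assume st: "0 \<le> s" "s \<le> t" "t \<le> T" "t - s < 1 / (C + 1)"
    have sT: "s \<in> {0..T}" using st by auto
    note U = qU[OF sT]
    define X where "X = (q t - q s) ** mat_adj (q s)"
    have nX: "norm X = norm (q t - q s)" by (simp add: X_def unitary_norm_mult_right unitary_adj U)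
    have nX1: "norm X \<le> C * (t - s)" unfolding nX by (rule C(4)[OF st(1-3)])
    have "C * (t - s) \<le> (C + 1) * (t - s)" using st by (intro mult_right_mono) auto
    also have "\<dots> \<le> 1" using st C(1) by (simp add: field_simps)
    finally have X1: "norm X \<le> 1" using nX1 by simp
    have "mat 1 + X = q t ** mat_adj (q s)" by (simp add: X_def matrix_ring_simps unitary_right[OF U])
    then have "(mat 1 + X) ** q s = q t" by (simp add: unitary_left[OF U] flip: matrix_mul_assoc)
    then have "det (q t) = det (mat 1 + X) * det (q s)" by (metis det_mul)
    then have "det (q t) - det (q s) = ((det (mat 1 + X) - 1 - trace X) + trace X) * det (q s)"
      by (simp add: algebra_simps)
    moreover have "cmod (det (q s)) = 1" by (rule cmod_det_unitary[OF U])
    ultimately have "cmod (det (q t) - det (q s)) \<le> cmod (det (mat 1 + X) - 1 - trace X) + cmod (trace X)"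
      using norm_triangle_ineq[of "det (mat 1 + X) - 1 - trace X" "trace X"] by (simp add: norm_mult)
    also have "cmod (det (mat 1 + X) - 1 - trace X) \<le> D * (C * (t - s))\<^sup>2"
      using D(2)[OF X1] mult_left_mono[OF power_mono[OF nX1 norm_ge_zero, of 2] D(1)] by linarith
    also have "cmod (trace X) \<le> K * C * (t - s) * B * (t - s)"
    proof -
      have "bounded_linear (\<lambda>Y :: complex^'n^'n. trace (Y ** mat_adj (q s)))"
        by (rule bounded_linear_compose[OF bl mm.bounded_linear_left])
      from has_integral_linear[OF C(3)[OF st(1-3)] this]
      have hi: "((\<lambda>r. trace (A (u r) ** q r ** mat_adj (q s))) has_integral trace X) {s..t}"
        by (simp add: comp_def X_def)
      have "cmod (trace (A (u r) ** q r ** mat_adj (q s))) \<le> K * C * (t - s) * B" if r: "r \<in> {s..t}" for r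
      proof -
        have rT: "r \<in> {0..T}" using r st by auto
        have "A (u r) ** q r ** mat_adj (q s) = A (u r) + A (u r) ** (q r - q s) ** mat_adj (q s)"
          by (simp add: matrix_ring_simps unitary_right[OF U] flip: matrix_mul_assoc)
        then have "trace (A (u r) ** q r ** mat_adj (q s)) = trace (A (u r) ** (q r - q s) ** mat_adj (q s))"
          by (simp add: trace_add tr[OF rT])
        also have "cmod \<dots> \<le> norm (A (u r) ** (q r - q s) ** mat_adj (q s)) * B" by (rule B(2))
        also have "norm (A (u r) ** (q r - q s) ** mat_adj (q s)) = norm (A (u r) ** (q r - q s))"
          by (simp add: unitary_norm_mult_right unitary_adj U)
        also have "\<dots> \<le> K * (C * (t - s))"
        proof -
          have "norm (q r - q s) \<le> C * (r - s)" using C(4)[of s r] r st by simp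
          also have "\<dots> \<le> C * (t - s)" using r C(1) by (intro mult_left_mono) auto
          finally show ?thesis using Ab[OF rT, of "q r - q s"] mult_left_mono[of "norm (q r - q s)" "C * (t - s)" K] K0 by linarith
        qed
        finally show ?thesis using B(1) by (simp add: mult_right_mono mult_ac)
      qed
      then show ?thesis
        using has_integral_bound_real[OF _ finite.emptyI hi, of "K * C * (t - s) * B"] C(1) K0 B(1) st by simp
    qed
    finally show "norm (det (q t) - det (q s)) \<le> (D * C\<^sup>2 + K * C * B) * (t - s)\<^sup>2"
      by (simp add: power2_eq_square algebra_simps)
  qed (use t C(1) K0 D(1) B(1) in auto)
qed

section \<open>Controllability\<close>

context conical_family
begin

definition drift :: "real^'m \<Rightarrow> complex^'n^'n" where
  "drift u = cmat_scale (- \<i>) (H u)"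

abbreviation group_field :: "real^'m \<Rightarrow> complex^'n^'n \<Rightarrow> complex^'n^'n" where
  "group_field \<equiv> \<lambda>u g. drift u ** g"

abbreviation state_field :: "real^'m \<Rightarrow> complex^'n \<Rightarrow> complex^'n" where
  "state_field \<equiv> \<lambda>u \<psi>. drift u *v \<psi>"

lemma drift_skew: "drift u \<in> u_alg"
  using subspace_neg[OF subspace_u_alg i_hermitian_u_alg[OF hermitian_H]] by (simp add: drift_def cmat_scale_simps)

lemma U_nonempty: "U \<noteq> {}"
  using conic_H n2 unfolding conically_connected_def by force

lemma drift_bounded:
  assumes "admissible_control U T u"
  obtains K where "\<And>s. s \<in> {0..T} \<Longrightarrow> norm (drift (u s)) \<le> K"
proof -
  have "bounded_linear dH" using linear_dH by (simp add: linear_conv_bounded_linear)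
  then have "bounded (dH ` (u ` {0..T}))"
    using assms bounded_linear_image unfolding admissible_control_def by blast
  then obtain B where B: "\<And>s. s \<in> {0..T} \<Longrightarrow> norm (dH (u s)) \<le> B" unfolding bounded_iff by blast
  have "norm (drift (u s)) \<le> norm H0 + B" if "s \<in> {0..T}" for s
  proof -
    have "norm (drift (u s)) = norm (H (u s))"
      by (simp add: drift_def norm_vec_def norm_mult)
    also have "\<dots> \<le> norm H0 + norm (dH (u s))" unfolding H_def by (rule norm_triangle_ineq)
    finally show ?thesis using B[OF that] by linarith
  qed
  then show thesis using that by blast
qed

lemma reachable_unitary:
  assumes "g0 \<in> unitary_group" "g \<in> reachable_set group_field U g0"
  shows "g \<in> unitary_group"
proof -
  obtain T u q where T: "0 \<le> T" "admissible_control U T u" "is_solution group_field T u q" "q 0 = g0" "g = q T"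
    using assms(2) unfolding reachable_set_def by auto
  obtain K where K: "\<And>s. s \<in> {0..T} \<Longrightarrow> norm (drift (u s)) \<le> K" using drift_bounded[OF T(2)] by blast
  show ?thesis using skew_solution_unitary[OF T(1,3) K drift_skew] T assms(1) by simp
qed

text \<open>A traceless drift conserves the determinant. This is the well-posedness of the system in
  SU(n).\<close>

lemma reachable_special_unitary:
  assumes tr: "\<And>u. u \<in> U \<Longrightarrow> trace (H u) = 0" 
    and "g0 \<in> special_unitary_group" "g \<in> reachable_set group_field U g0"
  shows "g \<in> special_unitary_group"
proof -
  obtain T u q where T: "0 \<le> T" "admissible_control U T u" "is_solution group_field T u q" "q 0 = g0" "g = q T"
    using assms(3) unfolding reachable_set_def by auto
  obtain K where K: "\<And>s. s \<in> {0..T} \<Longrightarrow> norm (drift (u s)) \<le> K" using drift_bounded[OF T(2)] by blast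
  have "trace (drift (u s)) = 0" if "s \<in> {0..T}" for s
    using T(2) tr that by (simp add: drift_def trace_cmat_scale admissible_control_def)
  from traceless_solution_det[OF T(1,3) K drift_skew this] have "det g = det g0"
    using T assms(2) by (simp add: special_unitary_iff)
  moreover have "g \<in> unitary_group"
    using reachable_unitary assms(2,3) unfolding special_unitary_iff by blast
  ultimately show ?thesis using assms(2) by (simp add: special_unitary_iff)
qed

lemma reachable_norm:
  assumes "\<psi> \<in> reachable_set state_field U \<psi>0"
  shows "norm \<psi> = norm \<psi>0"
proof -
  obtain T u q where T: "0 \<le> T" "admissible_control U T u" "is_solution state_field T u q" "q 0 = \<psi>0" "\<psi> = q T"
    using assms unfolding reachable_set_def by auto
  obtain K where K: "\<And>s. s \<in> {0..T} \<Longrightarrow> norm (drift (u s)) \<le> K" using drift_bounded[OF T(2)] by blast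
  show ?thesis using skew_solution_norm[OF T(1,3) K drift_skew] T by simp
qed

text \<open>Characterizing propagators by their action on the reachable sets of all initial points
  makes products immediate, without concatenating arbitrary trajectories. Asking for both systems at
  once lets one semigroup theorem serve the group and the sphere.\<close>

definition propagators :: "(complex^'n^'n) set" where
  "propagators = {g \<in> unitary_group.
     (\<forall>g0. \<forall>h\<in>reachable_set group_field U g0. g ** h \<in> reachable_set group_field U g0) \<and>
     (\<forall>\<psi>0. \<forall>\<psi>\<in>reachable_set state_field U \<psi>0. g *v \<psi> \<in> reachable_set state_field U \<psi>0)}"

lemma propagators_one: "mat 1 \<in> propagators"
  by (simp add: propagators_def)

lemma propagators_mult: "a \<in> propagators \<Longrightarrow> b \<in> propagators \<Longrightarrow> a ** b \<in> propagators"
  by (auto simp: propagators_def unitary_mult simp flip: matrix_mul_assoc matrix_vector_mul_assoc)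

lemma propagators_evol:
  assumes W: "W \<in> unitary_group" and gen: "gen W d = drift u" and u: "u \<in> U" and t: "0 \<le> t"
  shows "evol W d t \<in> propagators"
proof -
  have "evol W d t ** h \<in> reachable_set group_field U g0" if h: "h \<in> reachable_set group_field U g0" for g0 h
  proof (rule reachable_extend[OF h u t, of "\<lambda>s. evol W d s ** h"])
    show "evol W d 0 ** h = h" by (simp add: evol_0[OF W])
    show "((\<lambda>s. evol W d s ** h) has_vector_derivative drift u ** (evol W d s ** h)) (at s)" for s
      using bounded_linear.has_vector_derivative[OF mm.bounded_linear_left[of h] evol_has_vector_derivative[OF W, of d s UNIV]]
      by (simp add: gen matrix_mul_assoc)
  qed
  moreover have "evol W d t *v \<psi> \<in> reachable_set state_field U \<psi>0" if \<psi>: "\<psi> \<in> reachable_set state_field U \<psi>0" for \<psi>0 \<psi>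
  proof (rule reachable_extend[OF \<psi> u t, of "\<lambda>s. evol W d s *v \<psi>"])
    show "evol W d 0 *v \<psi> = \<psi>" by (simp add: evol_0[OF W])
    show "((\<lambda>s. evol W d s *v \<psi>) has_vector_derivative drift u *v (evol W d s *v \<psi>)) (at s)" for s
      using bounded_linear.has_vector_derivative[OF mv.bounded_linear_left[of \<psi>] evol_has_vector_derivative[OF W, of d s UNIV]]
      by (simp add: gen matrix_vector_mul_assoc)
  qed
  ultimately show ?thesis using evol_unitary[OF W] by (simp add: propagators_def)
qed

lemma lie_generated_drift: "lie_generated generators \<subseteq> lie_generated (drift ` U)"
proof (rule lie_generated_minimal[OF _ subspace_lie_generated comm_lie_generated])
  show "generators \<subseteq> lie_generated (drift ` U)"
  proof
    fix X assume "X \<in> generators"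
    then obtain u where u: "u \<in> U" "X = cmat_scale \<i> (H u)" by (auto simp: generators_def)
    then have "drift u \<in> lie_generated (drift ` U)" using lie_generated_base by blast
    from subspace_neg[OF subspace_lie_generated this] show "X \<in> lie_generated (drift ` U)"
      by (simp add: u drift_def cmat_scale_simps)
  qed
qed

lemma special_propagators:
  assumes tr: "\<And>u. u \<in> U \<Longrightarrow> trace (H u) = 0"
  shows "special_unitary_group \<subseteq> propagators"
proof -
  \<comment> \<open>Membership in \<open>propagators\<close> does not fix the determinant, hence the
    intersection; the flows of the traceless drift lie in it.\<close>
  have "propagators \<inter> {g. det g = 1} = special_unitary_group"
  proof (rule semigroup_eq_special_unitary_group[where \<Gamma> = "drift ` U"])
    show "evol W d t \<in> propagators \<inter> {g. det g = 1}" if W: "W \<in> unitary_group" "gen W d \<in> drift ` U" "0 \<le> t" for W d t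
    proof -
      obtain u where u: "u \<in> U" "gen W d = drift u" using W by blast
      have "\<i> * complex_of_real (\<Sum>i\<in>UNIV. d i) = 0"
        using trace_gen[OF W(1), of d] tr[OF u(1)] by (simp add: u drift_def trace_cmat_scale)
      then have "det (evol W d t) = 1" by (simp add: det_evol[OF W(1)] flip: of_real_sum)
      then show ?thesis using propagators_evol[OF W(1) u(2,1) W(3)] by simp
    qed
    show "su_alg \<subseteq> lie_generated (drift ` U)" using su_alg_subset_lie_generated lie_generated_drift by blast
  qed (use propagators_one propagators_mult drift_skew in \<open>auto simp: special_unitary_iff propagators_def det_mul\<close>)
  then show ?thesis by blast
qed

lemma all_propagators:
  assumes "u0 \<in> U" "trace (H u0) \<noteq> 0"
  shows "unitary_group \<subseteq> propagators"
proof -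
  interpret unitary_semigroup propagators "drift ` U"
  proof
    show "u_alg \<subseteq> lie_generated (drift ` U)" using lie_generated_u[OF assms] lie_generated_drift by blast
    show "evol W d t \<in> propagators" if "W \<in> unitary_group" "gen W d \<in> drift ` U" "0 \<le> t" for W d t
      using propagators_evol that by blast
  qed (use propagators_one propagators_mult drift_skew in \<open>auto simp: propagators_def\<close>)
  show ?thesis using semigroup_eq_unitary_group by simp
qed

section \<open>Exact controllability on the groups and on the sphere\<close>

lemma propagated:
  assumes "g \<in> unitary_group" "h ** mat_adj g \<in> propagators"
  shows "h \<in> reachable_set group_field U g"
proof -
  have "(h ** mat_adj g) ** g \<in> reachable_set group_field U g"
    using assms reachable_refl[OF U_nonempty] unfolding propagators_def by blast
  then show ?thesis by (simp add: unitary_left[OF assms(1)] flip: matrix_mul_assoc)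
qed

theorem controllable_special_unitary_group:
  assumes tr: "\<And>u. u \<in> U \<Longrightarrow> trace (H u) = 0"
  shows "exactly_controllable group_field U special_unitary_group"
  unfolding exactly_controllable_def
proof (intro ballI equalityI subsetI)
  fix g h :: "complex^'n^'n" assume g: "g \<in> special_unitary_group" and h: "h \<in> special_unitary_group"
  then have "h ** mat_adj g \<in> special_unitary_group"
    by (simp add: special_unitary_iff unitary_mult unitary_adj det_mul det_mat_adj)
  then show "h \<in> reachable_set group_field U g"
    using propagated g special_propagators[OF tr] by (auto simp: special_unitary_iff)
qed (rule reachable_special_unitary[OF tr])

theorem controllable_unitary_group:
  assumes "u0 \<in> U" "trace (H u0) \<noteq> 0"
  shows "exactly_controllable group_field U unitary_group"
  unfolding exactly_controllable_def
proof (intro ballI equalityI subsetI)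
  fix g h :: "complex^'n^'n" assume g: "g \<in> unitary_group" and h: "h \<in> unitary_group"
  then have "h ** mat_adj g \<in> unitary_group" by (simp add: unitary_mult unitary_adj)
  then show "h \<in> reachable_set group_field U g" using propagated g all_propagators[OF assms] by blast
qed (rule reachable_unitary)

text \<open>Whatever the trace, all of SU(n) consists of propagators, and SU(n) acts transitively on
  the unit sphere for n \<ge> 2. Conservation of the norm gives the converse inclusion.\<close>

theorem controllable_sphere: "exactly_controllable state_field U {\<psi>. norm \<psi> = 1}"
proof -
  have "special_unitary_group \<subseteq> propagators"
  proof (cases "\<forall>u\<in>U. trace (H u) = 0")
    case True
    then show ?thesis using special_propagators by blast
  next
    case False
    then have "unitary_group \<subseteq> propagators" using all_propagators by blast
    then show ?thesis by (auto simp: special_unitary_iff)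
  qed
  note sub = this
  show ?thesis
    unfolding exactly_controllable_def
  proof (intro ballI equalityI subsetI)
    fix \<psi> \<phi> :: "complex^'n" assume "\<psi> \<in> {\<psi>. norm \<psi> = 1}" "\<phi> \<in> {\<psi>. norm \<psi> = 1}"
    then obtain g where g: "g \<in> special_unitary_group" "g *v \<psi> = \<phi>"
      using special_unitary_transitive[OF n2] by blast
    then have "g \<in> propagators" using sub by blast
    then have "g *v \<psi> \<in> reachable_set state_field U \<psi>"
      using reachable_refl[OF U_nonempty] unfolding propagators_def by blast
    then show "\<phi> \<in> reachable_set state_field U \<psi>" by (simp add: g)
  qed (simp add: reachable_norm)
qed

end

theorem theorem2p1:
  fixes H0 :: "complex^'n::finite^'n::finite" and Hs :: "'m::finite \<Rightarrow> complex^'n^'n" and U :: "(real^'m) set"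
  assumes n2: "CARD('n) \<ge> 2" and m2: "CARD('m) \<ge> 2"
    and U_open: "open U" and U_conn: "connected U"
    and herm0: "hermitian H0" and herm: "\<And>k. hermitian (Hs k)"
    and conic: "conically_connected (\<lambda>u. H0 + (\<Sum>k\<in>UNIV. (u$k) *\<^sub>R Hs k)) U"
  shows
    "(let H = (\<lambda>u::real^'m. H0 + (\<Sum>k\<in>UNIV. (u$k) *\<^sub>R Hs k));
          L = lie_generated {cmat_scale \<i> (H u) | u. u \<in> U};
          fG = (\<lambda>u (g::complex^'n^'n). cmat_scale (- \<i>) (H u ** g));
          f\<psi> = (\<lambda>u (\<psi>::complex^'n). cmat_scale (- \<i>) (H u) *v \<psi>)
      in ((\<forall>u\<in>U. trace (H u) = 0) \<longrightarrow>
             L = su_alg \<and> exactly_controllable fG U special_unitary_group) \<and>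
         (\<not> (\<forall>u\<in>U. trace (H u) = 0) \<longrightarrow>
             L = u_alg \<and> exactly_controllable fG U unitary_group) \<and>
         exactly_controllable f\<psi> U {\<psi>. norm \<psi> = 1})"
proof -
  interpret conical_family H0 Hs U by standard (fact assms)+
  have H: "(\<lambda>u::real^'m. H0 + (\<Sum>k\<in>UNIV. (u$k) *\<^sub>R Hs k)) = H"
    by (simp add: H_def[abs_def] dH_def)
  have fG: "(\<lambda>u (g::complex^'n^'n). cmat_scale (- \<i>) (H u ** g)) = group_field"
    by (simp add: drift_def cmat_scale_mult_left)
  have f\<psi>: "(\<lambda>u (\<psi>::complex^'n). cmat_scale (- \<i>) (H u) *v \<psi>) = state_field"
    by (simp add: drift_def)
  show ?thesis
    unfolding Let_def H fG f\<psi> generators_def[symmetric]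
    using lie_generated_su lie_generated_u controllable_special_unitary_group
      controllable_unitary_group controllable_sphere by blast
qed

end
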